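(* Let $\Bbbk$ be a field with $\mathrm{char}(\Bbbk)=0$ or $\mathrm{char}(\Bbbk)>n$, and let $\lambda^1,\dots,\lambda^r\in P_n$. Then $$\mathrm{Tor}_i\big(\langle\lambda^1,\dots,\lambda^r\rangle_{\mathfrak S_n},\Bbbk\big)^{\mathfrak S_n}\cong\mathrm{Tor}_i\big((x^{\lambda^1},\dots,x^{\lambda^r}),\Bbbk\big)\quad\text{for all } i$$ (isomorphism of $\Bbbk$-vector spaces).
   Context: $R=\Bbbk[x_1,\dots,x_n]$, with $\mathfrak S_n$ acting by permuting the variables; Tor is over $R$. $P_n=\{(\lambda_1,\dots,\lambda_n)\in\mathbb Z^n\mid\lambda_1\ge\cdots\ge\lambda_n\ge0\}$ and $x^\lambda=x_1^{\lambda_1}\cdots x_n^{\lambda_n}$. The ideal $\langle\lambda^1,\dots,\lambda^r\rangle_{\mathfrak S_n}\subseteq R$ is generated by all monomials $\sigma(x^{\lambda^k})$ with $\sigma\in\mathfrak S_n$, $1\le k\le r$; its Tor groups carry the induced $\mathfrak S_n$-action, and $M^{\mathfrak S_n}$ denotes the subspace of $\mathfrak S_n$-invariants. $(x^{\lambda^1},\dots,x^{\lambda^r})\subseteq R$ is the ordinary monomial ideal generated by the listed monomials. *)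

theory Defs
  imports
    Complex_Main
    "HOL-Library.Cardinality"
    "HOL-Library.Poly_Mapping"
    "HOL-Library.Set_Algebras"
begin

section \<open>Quotients by cosets\<close>

text \<open>
  \<open>quot A B\<close> is the set of cosets of the subgroup \<open>B\<close> in the group \<open>A\<close>. Cosets are added by the
  elementwise sum of sets from \<open>HOL-Library.Set_Algebras\<close>, and the zero of the quotient is \<open>B\<close>
  itself. The type of elements is only required to have an addition, so the construction can be
  iterated: the elements of \<open>A\<close> may be cosets.
\<close>

definition quot :: "'a::plus set \<Rightarrow> 'a set \<Rightarrow> 'a set set" where
  "quot A B = (\<lambda>a. a +o B) ` A"

text \<open>The map \<open>a + B \<mapsto> f a + B'\<close> induced by an additive \<open>f\<close> that maps \<open>B\<close> into \<open>B'\<close>.\<close>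

definition quot_map :: "('a \<Rightarrow> 'b::plus) \<Rightarrow> 'b set \<Rightarrow> 'a set \<Rightarrow> 'b set" where
  "quot_map f B' X = f ` X + B'"


section \<open>Free resolutions\<close>

text \<open>
  A module over a commutative ring type is given by a scalar multiplication satisfying the locale
  \<open>module\<close>; its submodules are sets. All terms \<open>F i\<close> of a complex are submodules of one common
  module. \<open>d i\<close> maps \<open>F (Suc i)\<close> to \<open>F i\<close>, and \<open>e\<close> is the augmentation \<open>F 0 \<rightarrow> M\<close>. Maps only matter
  on the given submodules.
\<close>

definition semilinear_on ::
  "('r \<Rightarrow> 'r) \<Rightarrow> ('r \<Rightarrow> 'a \<Rightarrow> 'a) \<Rightarrow> ('r \<Rightarrow> 'b \<Rightarrow> 'b) \<Rightarrow> 'a::plus set \<Rightarrow> ('a \<Rightarrow> 'b::plus) \<Rightarrow> bool" where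
  "semilinear_on \<tau> s t M f \<longleftrightarrow>
     (\<forall>x\<in>M. \<forall>y\<in>M. f (x + y) = f x + f y) \<and> (\<forall>r. \<forall>x\<in>M. f (s r x) = t (\<tau> r) (f x))"

abbreviation linear_on ::
  "('r \<Rightarrow> 'a \<Rightarrow> 'a) \<Rightarrow> ('r \<Rightarrow> 'b \<Rightarrow> 'b) \<Rightarrow> 'a::plus set \<Rightarrow> ('a \<Rightarrow> 'b::plus) \<Rightarrow> bool" where
  "linear_on \<equiv> semilinear_on id"

definition free_submodule ::
  "('r::comm_ring_1 \<Rightarrow> 'a::ab_group_add \<Rightarrow> 'a) \<Rightarrow> 'a set \<Rightarrow> bool" where
  "free_submodule s F \<longleftrightarrow> (\<exists>B. \<not> module.dependent s B \<and> module.span s B = F)"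

definition free_resolution ::
  "('r::comm_ring_1 \<Rightarrow> 'm::ab_group_add \<Rightarrow> 'm) \<Rightarrow> 'm set \<Rightarrow> ('r \<Rightarrow> 'f::ab_group_add \<Rightarrow> 'f) \<Rightarrow>
   (nat \<Rightarrow> 'f set) \<Rightarrow> (nat \<Rightarrow> 'f \<Rightarrow> 'f) \<Rightarrow> ('f \<Rightarrow> 'm) \<Rightarrow> bool" where
  "free_resolution sM M s F d e \<longleftrightarrow>
     module sM \<and> module s \<and>
     (\<forall>i. free_submodule s (F i)) \<and>
     (\<forall>i. linear_on s s (F (Suc i)) (d i)) \<and>
     linear_on s sM (F 0) e \<and>
     e ` F 0 = M \<and>
     {x \<in> F 0. e x = 0} = d 0 ` F (Suc 0) \<and>
     (\<forall>i. {x \<in> F (Suc i). d i x = 0} = d (Suc i) ` F (Suc (Suc i)))"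


section \<open>Tensor products\<close>

text \<open>
  \<open>M \<otimes>\<^sub>R N\<close> for a submodule \<open>M\<close> and a module \<open>N\<close> that is a whole type with scalar multiplication
  \<open>t\<close>: the free abelian group on the pairs, modulo the subgroup (that is, the \<open>\<int>\<close>-span) generated
  by the bilinearity and balancing relations.
\<close>

lemma module_frag_cmul: "module frag_cmul"
  by unfold_locales (auto simp: frag_cmul_distrib frag_cmul_distrib2)

definition tensor_rel ::
  "('r \<Rightarrow> 'm \<Rightarrow> 'm) \<Rightarrow> 'm::plus set \<Rightarrow> ('r \<Rightarrow> 'p \<Rightarrow> 'p) \<Rightarrow> ('m \<times> 'p::plus \<Rightarrow>\<^sub>0 int) set" where
  "tensor_rel s M t = module.span frag_cmul
     ({frag_of (x + y, n) - frag_of (x, n) - frag_of (y, n) | x y n. x \<in> M \<and> y \<in> M} \<union>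
      {frag_of (x, n + n') - frag_of (x, n) - frag_of (x, n') | x n n'. x \<in> M} \<union>
      {frag_of (s r x, n) - frag_of (x, t r n) | r x n. x \<in> M})"

definition tensor ::
  "('r \<Rightarrow> 'm \<Rightarrow> 'm) \<Rightarrow> 'm::plus set \<Rightarrow> ('r \<Rightarrow> 'p \<Rightarrow> 'p) \<Rightarrow> ('m \<times> 'p::plus \<Rightarrow>\<^sub>0 int) set set" where
  "tensor s M t = quot {u. Poly_Mapping.keys u \<subseteq> M \<times> UNIV} (tensor_rel s M t)"

text \<open>\<open>f \<otimes> g : M \<otimes> N \<rightarrow> M' \<otimes> N\<close>, sending \<open>x \<otimes> n\<close> to \<open>f x \<otimes> g n\<close>.\<close>

definition tensor_map ::
  "('r \<Rightarrow> 'm \<Rightarrow> 'm) \<Rightarrow> 'm::plus set \<Rightarrow> ('r \<Rightarrow> 'p \<Rightarrow> 'p) \<Rightarrow> ('m \<Rightarrow> 'm) \<Rightarrow> ('p \<Rightarrow> 'p) \<Rightarrow>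
   ('m \<times> 'p::plus \<Rightarrow>\<^sub>0 int) set \<Rightarrow> ('m \<times> 'p \<Rightarrow>\<^sub>0 int) set" where
  "tensor_map s M' t f g =
     quot_map (frag_extend (\<lambda>(x, n). frag_of (f x, g n))) (tensor_rel s M' t)"


section \<open>Tor\<close>

text \<open>
  \<open>Tor\<^sub>i(M, N)\<close> is the homology of \<open>F \<otimes>\<^sub>R N\<close>, where \<open>(F, d)\<close> is a free resolution of \<open>M\<close>. The
  resolution is an explicit argument.
\<close>

definition tor_diff ::
  "('r \<Rightarrow> 'f \<Rightarrow> 'f) \<Rightarrow> (nat \<Rightarrow> 'f::plus set) \<Rightarrow> (nat \<Rightarrow> 'f \<Rightarrow> 'f) \<Rightarrow> ('r \<Rightarrow> 'p \<Rightarrow> 'p) \<Rightarrow> nat \<Rightarrow>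
   ('f \<times> 'p::plus \<Rightarrow>\<^sub>0 int) set \<Rightarrow> ('f \<times> 'p \<Rightarrow>\<^sub>0 int) set" where
  "tor_diff s F d t i = tensor_map s (F i) t (d i) id"

fun tor_cycles ::
  "('r \<Rightarrow> 'f \<Rightarrow> 'f) \<Rightarrow> (nat \<Rightarrow> 'f::plus set) \<Rightarrow> (nat \<Rightarrow> 'f \<Rightarrow> 'f) \<Rightarrow> ('r \<Rightarrow> 'p \<Rightarrow> 'p) \<Rightarrow> nat \<Rightarrow>
   ('f \<times> 'p::plus \<Rightarrow>\<^sub>0 int) set set" where
  "tor_cycles s F d t 0 = tensor s (F 0) t"
| "tor_cycles s F d t (Suc i) =
     {u \<in> tensor s (F (Suc i)) t. tor_diff s F d t i u = tensor_rel s (F i) t}"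

definition tor_boundaries ::
  "('r \<Rightarrow> 'f \<Rightarrow> 'f) \<Rightarrow> (nat \<Rightarrow> 'f::plus set) \<Rightarrow> (nat \<Rightarrow> 'f \<Rightarrow> 'f) \<Rightarrow> ('r \<Rightarrow> 'p \<Rightarrow> 'p) \<Rightarrow> nat \<Rightarrow>
   ('f \<times> 'p::plus \<Rightarrow>\<^sub>0 int) set set" where
  "tor_boundaries s F d t i = tor_diff s F d t i ` tensor s (F (Suc i)) t"

definition tor ::
  "('r \<Rightarrow> 'f \<Rightarrow> 'f) \<Rightarrow> (nat \<Rightarrow> 'f::plus set) \<Rightarrow> (nat \<Rightarrow> 'f \<Rightarrow> 'f) \<Rightarrow> ('r \<Rightarrow> 'p \<Rightarrow> 'p) \<Rightarrow> nat \<Rightarrow>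
   ('f \<times> 'p::plus \<Rightarrow>\<^sub>0 int) set set set" where
  "tor s F d t i = quot (tor_cycles s F d t i) (tor_boundaries s F d t i)"

text \<open>
  The endomorphism of \<open>Tor\<^sub>i(M, N)\<close> induced by \<open>f \<otimes> g\<close>, for \<open>f : F i \<rightarrow> F i\<close> the degree \<open>i\<close>
  component of a chain map and \<open>g : N \<rightarrow> N\<close>.
\<close>

definition tor_map ::
  "('r \<Rightarrow> 'f \<Rightarrow> 'f) \<Rightarrow> (nat \<Rightarrow> 'f::plus set) \<Rightarrow> (nat \<Rightarrow> 'f \<Rightarrow> 'f) \<Rightarrow> ('r \<Rightarrow> 'p \<Rightarrow> 'p) \<Rightarrow> nat \<Rightarrow>
   ('f \<Rightarrow> 'f) \<Rightarrow> ('p \<Rightarrow> 'p) \<Rightarrow>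
   ('f \<times> 'p::plus \<Rightarrow>\<^sub>0 int) set set \<Rightarrow> ('f \<times> 'p \<Rightarrow>\<^sub>0 int) set set" where
  "tor_map s F d t i f g =
     quot_map (tensor_map s (F i) t f g) (tor_boundaries s F d t i)"

definition tor_scale ::
  "('r \<Rightarrow> 'f \<Rightarrow> 'f) \<Rightarrow> (nat \<Rightarrow> 'f::plus set) \<Rightarrow> (nat \<Rightarrow> 'f \<Rightarrow> 'f) \<Rightarrow> ('r \<Rightarrow> 'p \<Rightarrow> 'p) \<Rightarrow> nat \<Rightarrow>
   'r \<Rightarrow> ('f \<times> 'p::plus \<Rightarrow>\<^sub>0 int) set set \<Rightarrow> ('f \<times> 'p \<Rightarrow>\<^sub>0 int) set set" where
  "tor_scale s F d t i r = tor_map s F d t i id (t r)"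


section \<open>The polynomial ring and the action of the symmetric group\<close>

text \<open>
  The variables are indexed by a finite linearly ordered type \<open>'n\<close>, in place of \<open>1 < \<dots> < n\<close>.
\<close>

type_synonym ('n, 'k) mpoly = "('n \<Rightarrow>\<^sub>0 nat) \<Rightarrow>\<^sub>0 'k"

definition mmonom :: "('n \<Rightarrow>\<^sub>0 nat) \<Rightarrow> ('n, 'k::zero_neq_one) mpoly" where
  "mmonom a = Poly_Mapping.single a 1"

definition mconst :: "'k::zero \<Rightarrow> ('n, 'k) mpoly" where
  "mconst c = Poly_Mapping.single 0 c"

definition ideal_gen :: "('n, 'k::comm_ring_1) mpoly set \<Rightarrow> ('n, 'k) mpoly set" where
  "ideal_gen G = module.span (*) G"

text \<open>The residue field \<open>k = R / (x\<^sub>1, \<dots>, x\<^sub>n)\<close> as an \<open>R\<close>-module.\<close>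

definition res_scale :: "('n, 'k::mult_zero) mpoly \<Rightarrow> 'k \<Rightarrow> 'k" where
  "res_scale p c = Poly_Mapping.lookup p 0 * c"

lemma module_res_scale: "module (res_scale :: ('n, 'k::comm_ring_1) mpoly \<Rightarrow> 'k \<Rightarrow> 'k)"
proof -
  have "Poly_Mapping.lookup (p * q) 0 = Poly_Mapping.lookup p 0 * Poly_Mapping.lookup q 0"
    for p q :: "('n, 'k) mpoly"
  proof -
    have eq0: "(0 = k + l) = (k = 0 \<and> l = 0)" for k l :: "'n \<Rightarrow>\<^sub>0 nat"
      by (auto simp: poly_mapping_eq_iff fun_eq_iff lookup_add)
    have "Poly_Mapping.lookup (p * q) 0 =
        (\<Sum>l. (Poly_Mapping.lookup p l * Poly_Mapping.lookup q 0) when l = 0)"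
      unfolding times_poly_mapping.rep_eq prod_fun_def
    proof (rule Sum_any.cong)
      fix l :: "'n \<Rightarrow>\<^sub>0 nat"
      have "(\<Sum>m. Poly_Mapping.lookup q m when 0 = l + m)
          = (\<Sum>m. (Poly_Mapping.lookup q m when l = 0) when m = 0)"
        by (rule Sum_any.cong) (auto simp: eq0 when_def)
      then show "Poly_Mapping.lookup p l * (\<Sum>m. Poly_Mapping.lookup q m when 0 = l + m)
          = (Poly_Mapping.lookup p l * Poly_Mapping.lookup q 0 when l = 0)"
        by (simp add: when_def)
    qed
    then show ?thesis by simp
  qed
  then show ?thesis
    by unfold_locales (auto simp: res_scale_def lookup_add algebra_simps)
qed

definition partitions :: "('n::linorder \<Rightarrow>\<^sub>0 nat) set" where
  "partitions = {a. antimono (Poly_Mapping.lookup a)}"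

text \<open>
  A permutation acts by \<open>x\<^sub>i \<mapsto> x\<^bsub>\<sigma> i\<^esub>\<close>: the exponent \<open>a\<close> becomes \<open>a \<circ> \<sigma>\<inverse>\<close>, and the coefficient of
  \<open>x\<^sup>a\<close> in \<open>\<sigma> p\<close> is the one of \<open>x\<^bsup>\<sigma>\<inverse> a\<^esup>\<close> in \<open>p\<close>.
\<close>

definition perm_exp :: "('n \<Rightarrow> 'n) \<Rightarrow> ('n \<Rightarrow>\<^sub>0 nat) \<Rightarrow> ('n \<Rightarrow>\<^sub>0 nat)" where
  "perm_exp \<sigma> a = Poly_Mapping.map_key (inv \<sigma>) a"

definition perm_poly :: "('n \<Rightarrow> 'n) \<Rightarrow> ('n, 'k::zero) mpoly \<Rightarrow> ('n, 'k) mpoly" where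
  "perm_poly \<sigma> p = Poly_Mapping.map_key (perm_exp (inv \<sigma>)) p"

lemma lookup_perm_exp:
  "bij \<sigma> \<Longrightarrow> Poly_Mapping.lookup (perm_exp \<sigma> a) (\<sigma> i) = Poly_Mapping.lookup a i"
  by (simp add: perm_exp_def map_key.rep_eq bij_imp_bij_inv bij_is_inj)

lemma lookup_perm_poly:
  assumes "bij \<sigma>"
  shows "Poly_Mapping.lookup (perm_poly \<sigma> p) (perm_exp \<sigma> a) = Poly_Mapping.lookup p a"
proof -
  have inv: "perm_exp (inv \<tau>) (perm_exp \<tau> a) = a" if "bij \<tau>" for \<tau> :: "'a \<Rightarrow> 'a" and a
    using that
    by (auto simp: poly_mapping_eq_iff fun_eq_iff perm_exp_def map_key.rep_eq bij_imp_bij_inv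
        bij_is_inj inv_inv_eq)
  have "inj (perm_exp (inv \<sigma>))"
    using inv[of "inv \<sigma>"] assms by (metis bij_imp_bij_inv injI)
  then show ?thesis
    by (simp add: perm_poly_def map_key.rep_eq inv assms)
qed

lemma perm_poly_mmonom:
  assumes "bij \<sigma>"
  shows "perm_poly \<sigma> (mmonom a) = mmonom (perm_exp \<sigma> a)"
proof -
  have surj: "\<exists>c. b = perm_exp \<sigma> c" for b
    using assms
    by (intro exI[of _ "perm_exp (inv \<sigma>) b"])
      (auto simp: poly_mapping_eq_iff fun_eq_iff perm_exp_def map_key.rep_eq bij_imp_bij_inv
        bij_is_inj inv_inv_eq bij_is_surj surj_f_inv_f)
  have inj: "perm_exp \<sigma> a = perm_exp \<sigma> c \<longleftrightarrow> a = c" for c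
    using lookup_perm_exp[OF assms] by (metis poly_mapping_eqI)
  have "Poly_Mapping.lookup (perm_poly \<sigma> (mmonom a)) b
      = Poly_Mapping.lookup (mmonom (perm_exp \<sigma> a) :: ('a, 'b) mpoly) b" for b
    using surj[of b]
    by (auto simp: lookup_perm_poly[OF assms] mmonom_def lookup_single when_def inj)
  then show ?thesis by (rule poly_mapping_eqI)
qed

definition sym_ideal :: "('n \<Rightarrow>\<^sub>0 nat) set \<Rightarrow> ('n, 'k::comm_ring_1) mpoly set" where
  "sym_ideal L = ideal_gen {perm_poly \<sigma> (mmonom a) | \<sigma> a. bij \<sigma> \<and> a \<in> L}"

definition mono_ideal :: "('n \<Rightarrow>\<^sub>0 nat) set \<Rightarrow> ('n, 'k::comm_ring_1) mpoly set" where
  "mono_ideal L = ideal_gen (mmonom ` L)"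

text \<open>
  The action of \<open>\<sigma>\<close> on an invariant ideal \<open>I\<close> is semilinear over the ring automorphism \<open>\<sigma>\<close> of \<open>R\<close>.
  It lifts to a semilinear chain map of a free resolution of \<open>I\<close>, uniquely up to homotopy, and
  the action on \<open>Tor\<^sub>i(I, k)\<close> is induced by (any) such lift, together with the trivial
  action on \<open>k\<close>. The lifts themselves need not form a group action.
\<close>

definition perm_lift ::
  "(('n, 'k::zero) mpoly \<Rightarrow> 'f \<Rightarrow> 'f) \<Rightarrow> (nat \<Rightarrow> 'f::plus set) \<Rightarrow> (nat \<Rightarrow> 'f \<Rightarrow> 'f) \<Rightarrow>
   ('f \<Rightarrow> ('n, 'k) mpoly) \<Rightarrow> ('n \<Rightarrow> 'n) \<Rightarrow> (nat \<Rightarrow> 'f \<Rightarrow> 'f) \<Rightarrow> bool" where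
  "perm_lift s F d e \<sigma> f \<longleftrightarrow>
     (\<forall>i. f i ` F i \<subseteq> F i) \<and>
     (\<forall>i. semilinear_on (perm_poly \<sigma>) s s (F i) (f i)) \<and>
     (\<forall>i. \<forall>x\<in>F (Suc i). f i (d i x) = d i (f (Suc i) x)) \<and>
     (\<forall>x\<in>F 0. e (f 0 x) = perm_poly \<sigma> (e x))"

definition tor_invariants ::
  "(('n, 'k::semiring_0) mpoly \<Rightarrow> 'f \<Rightarrow> 'f) \<Rightarrow> (nat \<Rightarrow> 'f::plus set) \<Rightarrow> (nat \<Rightarrow> 'f \<Rightarrow> 'f) \<Rightarrow>
   (('n \<Rightarrow> 'n) \<Rightarrow> nat \<Rightarrow> 'f \<Rightarrow> 'f) \<Rightarrow> nat \<Rightarrow> ('f \<times> 'k \<Rightarrow>\<^sub>0 int) set set set" where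
  "tor_invariants s F d \<phi> i =
     {X \<in> tor s F d res_scale i. \<forall>\<sigma>. bij \<sigma> \<longrightarrow> tor_map s F d res_scale i (\<phi> \<sigma> i) id X = X}"

definition vs_isomorphic ::
  "('k \<Rightarrow> 'a \<Rightarrow> 'a) \<Rightarrow> 'a::plus set \<Rightarrow> ('k \<Rightarrow> 'b \<Rightarrow> 'b) \<Rightarrow> 'b::plus set \<Rightarrow> bool" where
  "vs_isomorphic s A t B \<longleftrightarrow> (\<exists>h. bij_betw h A B \<and> linear_on s t A h)"

end

theory Submission
  imports Defs "HOL-Library.Function_Algebras" "HOL-Combinatorics.Permutations"
begin

text \<open>
  Write \<open>I\<close> for the symmetric ideal and \<open>J\<close> for the ordinary one. Both Tor groups are homology groups of
  Koszul complexes: \<open>Tor\<^sub>l(M, k) = H\<^sub>l(K(M))\<close>, where a chain of degree \<open>l\<close> in \<open>K(M)\<close> assigns an element of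
  \<open>M\<close> to each set of \<open>l\<close> variables. For an arbitrary free resolution \<open>F\<close> of \<open>M\<close> this is proved by
  dimension shifting (\<open>koszul_homology_resolution\<close>): the Koszul complexes of the free modules \<open>F j\<close>
  are exact in positive degrees, so the homology of \<open>K(M)\<close> in degree \<open>l + 1\<close> is that of the syzygy
  module of \<open>M\<close> in degree \<open>l\<close>, and so on down to degree \<open>0\<close>, where the homology of \<open>F \<otimes> k\<close> appears.
  Any family of semilinear lifts of the permutations acts on all modules and chains that occur, and
  the connecting maps commute with it.

  It remains to compare the invariants of \<open>H(K(I))\<close> with \<open>H(K(J))\<close>. As the order of the symmetric group
  is invertible in \<open>k\<close>, the former is the homology of the complex of invariant chains of \<open>K(I)\<close>.
  The complex \<open>K(I)\<close> has a basis of elements \<open>x\<^sup>m e\<^sub>\<tau>\<close>, where \<open>m\<close> is an exponent with \<open>x\<^sup>m \<in> I\<close> and \<open>\<tau>\<close> a set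
  of variables, and permutations permute them up to sign. Each orbit contains an element for which
  \<open>2m + \<tau>\<close> is weakly decreasing (\<open>\<tau>\<close> also denotes its indicator function). For such an element there
  are two possibilities.

    \<^item> Two variables \<open>i, j \<in> \<tau>\<close> have equal exponents in \<open>m\<close>. The transposition of \<open>i\<close> and \<open>j\<close> maps the
      element to its negative, so no invariant chain involves it.
    \<^item> The element is descending: \<open>m\<^sub>j + \<tau>\<^sub>j \<le> m\<^sub>i\<close> for all \<open>i < j\<close>. Then its stabiliser fixes \<open>\<tau>\<close> pointwise,
      hence acts without sign, and there is no other descending element in the orbit.

  So averaging maps the span \<open>D\<close> of the descending elements isomorphically to the invariant chains
  (\<open>average_inject\<close>, \<open>average_surj\<close>), and \<open>D\<close> is a subcomplex because removing a variable \<open>i\<close> from \<open>\<tau>\<close>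
  and multiplying by \<open>x\<^sub>i\<close> preserves descent. In a descending element \<open>m\<close> is a partition, and for
  partitions \<open>x\<^sup>m \<in> I\<close> is equivalent to \<open>x\<^sup>m \<in> J\<close>; therefore \<open>D\<close> is also a subcomplex of \<open>K(J)\<close>. Finally the
  inclusion of \<open>D\<close> in \<open>K(J)\<close> induces an isomorphism in homology (\<open>deformation\<close>). If descent fails at
  \<open>j\<close>, that is \<open>m\<^sub>i < m\<^sub>j + \<tau>\<^sub>j\<close> for some \<open>i < j\<close>, then one may insert \<open>j\<close> into \<open>\<tau>\<close> at the expense of a factor
  \<open>x\<^sub>j\<close> of \<open>x\<^sup>m\<close> without leaving \<open>J\<close>, because \<open>J\<close> is generated by partitions. The elements where descent
  fails at \<open>j\<close> thus come in pairs that cancel, and treating the variables \<open>j\<close> in increasing order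
  leaves \<open>D\<close>.
\<close>

abbreviation (input) lookup where "lookup \<equiv> Poly_Mapping.lookup"

abbreviation (input) keys where "keys \<equiv> Poly_Mapping.keys"

section \<open>Variables, constants and permutations\<close>

definition var :: "'n \<Rightarrow> ('n, 'k::comm_ring_1) mpoly" where
  "var i = mmonom (Poly_Mapping.single i 1)"

lemma lookup_single_mult:
  fixes p :: "('n, 'k::comm_ring_1) mpoly"
  shows "lookup (Poly_Mapping.single a c * p) b =
    (if \<exists>b'. b = a + b' then c * lookup p (b - a) else 0)"
proof -
  have "lookup (Poly_Mapping.single a c * p) b =
      (\<Sum>l. (c * (\<Sum>q. lookup p q when b = l + q)) when l = a)"
    unfolding lookup_mult
    by (intro Sum_any.cong) (auto simp: lookup_single when_def)
  also have "\<dots> = c * (\<Sum>q. lookup p q when b = a + q)"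
    by simp
  also have "(\<Sum>q. lookup p q when b = a + q) =
      (if \<exists>b'. b = a + b' then lookup p (b - a) else 0)"
  proof (cases "\<exists>b'. b = a + b'")
    case True
    then obtain b' where b: "b = a + b'" by blast
    have "(\<Sum>q. lookup p q when b = a + q) =
        (\<Sum>q. lookup p q when q = b')"
      by (intro Sum_any.cong) (auto simp: b when_def)
    then show ?thesis using b by simp
  qed (simp add: when_def)
  finally show ?thesis by (simp add: if_distrib)
qed

lemma exp_add_minus_single:
  "lookup b i > 0 \<Longrightarrow> Poly_Mapping.single i (1::nat) + (b - Poly_Mapping.single i 1) = b"
  by (rule poly_mapping_eqI) (auto simp: lookup_add lookup_minus lookup_single when_def)

lemma lookup_var_mult:
  "lookup (var i * p) b =
    (if lookup b i > 0 then lookup p (b - Poly_Mapping.single i 1) else 0)"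
proof -
  have "(\<exists>b'. b = Poly_Mapping.single i 1 + b') \<longleftrightarrow> lookup b i > 0"
    by (metis exp_add_minus_single lookup_add lookup_single_eq zero_less_one add_gr_0)
  then show ?thesis by (simp add: var_def mmonom_def lookup_single_mult)
qed

lemma lookup_mconst_mult:
  "lookup (mconst c * p) b = c * lookup p (b :: 'n \<Rightarrow>\<^sub>0 nat)"
  for p :: "('n, 'k::comm_ring_1) mpoly"
  by (simp add: mconst_def lookup_single_mult)

lemma mconst_mult: "mconst a * mconst b = (mconst (a * b) :: ('n, 'k::comm_ring_1) mpoly)"
  by (simp add: mconst_def mult_single)

lemma mconst_add: "mconst (a + b) = (mconst a + mconst b :: ('n, 'k::comm_ring_1) mpoly)"
  by (simp add: mconst_def single_add)

lemma mconst_uminus: "mconst (- a) = (- mconst a :: ('n, 'k::comm_ring_1) mpoly)"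
  by (simp add: mconst_def single_uminus)

lemma mconst_0 [simp]: "mconst 0 = (0 :: ('n, 'k::comm_ring_1) mpoly)"
  by (simp add: mconst_def)

lemma mconst_1 [simp]: "mconst 1 = (1 :: ('n, 'k::comm_ring_1) mpoly)"
  by (simp add: mconst_def)

text \<open>
  The \<open>k\<close>-linear left inverse of multiplication by \<open>x\<^sub>i\<close> that kills the monomials without \<open>x\<^sub>i\<close>. It commutes
  with the other variables, so it contracts the Koszul complex in the direction of \<open>i\<close>.
\<close>

definition divide_var :: "'n \<Rightarrow> ('n, 'k::zero) mpoly \<Rightarrow> ('n, 'k) mpoly" where
  "divide_var i = Poly_Mapping.map_key (\<lambda>a. Poly_Mapping.single i 1 + a)"

lemma lookup_divide_var:
  "lookup (divide_var i p) a = lookup p (Poly_Mapping.single i 1 + a)"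
  by (simp add: divide_var_def map_key.rep_eq)

lemma divide_var_diff: "divide_var i (p - q) = divide_var i p - divide_var i (q :: ('n, 'k::comm_ring_1) mpoly)"
  by (rule poly_mapping_eqI) (simp add: lookup_divide_var lookup_minus)

lemma divide_var_var_same: "divide_var i (var i * p) = p"
  by (rule poly_mapping_eqI) (simp add: lookup_divide_var lookup_var_mult lookup_add lookup_single)

lemma divide_var_mconst: "divide_var i (mconst c * p) = mconst c * divide_var i (p :: ('n, 'k::comm_ring_1) mpoly)"
  by (rule poly_mapping_eqI) (simp add: lookup_divide_var lookup_mconst_mult)

lemma divide_var_var_other: "i \<noteq> j \<Longrightarrow> divide_var i (var j * p) = var j * divide_var i p"
proof (rule poly_mapping_eqI)
  fix a :: "'a \<Rightarrow>\<^sub>0 nat" assume "i \<noteq> j"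
  then have "lookup a j > 0 \<Longrightarrow>
      Poly_Mapping.single i 1 + a - Poly_Mapping.single j 1 = Poly_Mapping.single i 1 + (a - Poly_Mapping.single j 1)"
    by (intro poly_mapping_eqI) (auto simp: lookup_add lookup_minus lookup_single when_def)
  then show "lookup (divide_var i (var j * p)) a = lookup (var j * divide_var i p) a"
    using \<open>i \<noteq> j\<close> by (auto simp: lookup_divide_var lookup_var_mult lookup_add lookup_single)
qed

lemma lookup_perm_exp_inv: "bij \<sigma> \<Longrightarrow> lookup (perm_exp \<sigma> a) i = lookup a (inv \<sigma> i)"
  by (metis bij_inv_eq_iff lookup_perm_exp)

lemma perm_exp_comp: "bij \<sigma> \<Longrightarrow> bij \<rho> \<Longrightarrow> perm_exp (\<sigma> \<circ> \<rho>) a = perm_exp \<sigma> (perm_exp \<rho> a)"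
  by (rule poly_mapping_eqI) (simp add: lookup_perm_exp_inv bij_comp o_inv_distrib)

lemma perm_exp_inv [simp]: "bij \<sigma> \<Longrightarrow> perm_exp (inv \<sigma>) (perm_exp \<sigma> a) = a"
  by (rule poly_mapping_eqI) (simp add: lookup_perm_exp_inv bij_imp_bij_inv inv_inv_eq bij_is_inj)

lemma perm_exp_inv_right [simp]: "bij \<sigma> \<Longrightarrow> perm_exp \<sigma> (perm_exp (inv \<sigma>) a) = a"
  by (metis bij_imp_bij_inv inv_inv_eq perm_exp_inv)

lemma perm_exp_add: "bij \<sigma> \<Longrightarrow> perm_exp \<sigma> (a + b) = perm_exp \<sigma> a + perm_exp \<sigma> b"
  by (rule poly_mapping_eqI) (simp add: lookup_perm_exp_inv lookup_add)

lemma perm_exp_single: "bij \<sigma> \<Longrightarrow> perm_exp \<sigma> (Poly_Mapping.single i c) = Poly_Mapping.single (\<sigma> i) c"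
  by (rule poly_mapping_eqI) (auto simp: lookup_perm_exp_inv lookup_single when_def bij_inv_eq_iff)

lemma perm_exp_0 [simp]: "bij \<sigma> \<Longrightarrow> perm_exp \<sigma> 0 = 0"
  by (rule poly_mapping_eqI) (auto simp: lookup_perm_exp_inv)

lemma lookup_perm_poly_inv: "bij \<sigma> \<Longrightarrow> lookup (perm_poly \<sigma> p) a = lookup p (perm_exp (inv \<sigma>) a)"
  by (metis lookup_perm_poly perm_exp_inv_right)

lemma perm_poly_add: "bij \<sigma> \<Longrightarrow> perm_poly \<sigma> (p + q) = perm_poly \<sigma> p + perm_poly \<sigma> (q :: ('n, 'k::comm_ring_1) mpoly)"
  by (rule poly_mapping_eqI) (simp add: lookup_perm_poly_inv lookup_add)

lemma perm_poly_mconst: "bij \<sigma> \<Longrightarrow> perm_poly \<sigma> (mconst c) = mconst c"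
proof (rule poly_mapping_eqI)
  fix a assume "bij \<sigma>"
  then have "perm_exp (inv \<sigma>) a = 0 \<longleftrightarrow> a = 0"
    by (metis perm_exp_0 perm_exp_inv_right bij_imp_bij_inv)
  then show "lookup (perm_poly \<sigma> (mconst c)) a = lookup (mconst c) a"
    using \<open>bij \<sigma>\<close> by (auto simp: mconst_def lookup_perm_poly_inv lookup_single when_def)
qed

lemma perm_poly_var: "bij \<sigma> \<Longrightarrow> perm_poly \<sigma> (var i) = var (\<sigma> i)"
  by (simp add: var_def perm_poly_mmonom perm_exp_single)

lemma perm_poly_mult:
  fixes p q :: "('n, 'k::comm_ring_1) mpoly"
  assumes "bij \<sigma>"
  shows "perm_poly \<sigma> (p * q) = perm_poly \<sigma> p * perm_poly \<sigma> q"
proof (induct p rule: update_induct)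
  case const
  show ?case using perm_poly_add[OF assms, of "0 :: ('n, 'k) mpoly" 0] by simp
next
  case (update p a c)
  have eq: "Poly_Mapping.update a c p = p + Poly_Mapping.single a c"
    using update by (intro poly_mapping_eqI)
      (auto simp: lookup_update lookup_add lookup_single when_def in_keys_iff)
  have ps: "perm_poly \<sigma> (Poly_Mapping.single a c) = Poly_Mapping.single (perm_exp \<sigma> a) c"
    using assms by (intro poly_mapping_eqI)
      (auto simp: lookup_perm_poly_inv lookup_single when_def)
  have *: "(\<exists>b'. perm_exp (inv \<sigma>) b = a + b') \<longleftrightarrow> (\<exists>b'. b = perm_exp \<sigma> a + b')" for b
    using assms by (metis perm_exp_add perm_exp_inv perm_exp_inv_right)
  have m: "perm_exp (inv \<sigma>) b - a = perm_exp (inv \<sigma>) (b - perm_exp \<sigma> a)" for b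
    using assms by (intro poly_mapping_eqI)
      (simp add: lookup_perm_exp_inv lookup_minus bij_imp_bij_inv inv_inv_eq bij_is_inj)
  have "perm_poly \<sigma> (Poly_Mapping.single a c * q) = Poly_Mapping.single (perm_exp \<sigma> a) c * perm_poly \<sigma> q"
    using assms by (intro poly_mapping_eqI) (simp add: lookup_perm_poly_inv lookup_single_mult * m)
  then show ?case
    by (simp add: eq update ps perm_poly_add[OF assms] distrib_right)
qed

section \<open>Signs\<close>

text \<open>
  The sign in \<open>e\<^sub>i \<and> e\<^sub>\<tau> = \<plusminus> e\<^bsub>insert i \<tau>\<^esub>\<close>, where \<open>e\<^sub>\<tau>\<close> is the exterior product of the \<open>e\<^sub>j\<close> for \<open>j \<in> \<tau>\<close> in
  increasing order.
\<close>

definition insert_sign :: "'n::linorder \<Rightarrow> 'n set \<Rightarrow> 'k::comm_ring_1" where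
  "insert_sign i \<tau> = (\<Prod>j\<in>\<tau>. if j < i then - 1 else 1)"

lemma insert_sign_empty [simp]: "insert_sign i {} = 1" by (simp add: insert_sign_def)

lemma insert_sign_insert:
  fixes \<tau> :: "'n::{finite,linorder} set"
  shows "j \<notin> \<tau> \<Longrightarrow> insert_sign i (insert j \<tau>) = (if j < i then - insert_sign i \<tau> else insert_sign i \<tau>)"
  by (simp add: insert_sign_def)

lemma insert_sign_sq [simp]: "insert_sign i \<tau> * insert_sign i \<tau> = 1"
  by (simp add: insert_sign_def flip: prod.distrib) (rule prod.neutral, auto)

lemma insert_sign_sq_left [simp]: "insert_sign i \<tau> * (insert_sign i \<tau> * x) = x"
  by (simp flip: mult.assoc)

lemma insert_sign_swap:
  fixes \<tau> :: "'n::{finite,linorder} set"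
  assumes "i \<noteq> j" "i \<notin> \<tau>" "j \<notin> \<tau>"
  shows "insert_sign i (insert j \<tau>) * insert_sign j \<tau> = - (insert_sign j (insert i \<tau>) * insert_sign i \<tau>)"
  using assms by (auto simp: insert_sign_insert not_less)

lemma insert_sign_swap_both:
  fixes \<tau> :: "'n::{finite,linorder} set"
  assumes "i \<noteq> j" "i \<notin> \<tau>" "j \<notin> \<tau>"
  shows "insert_sign i (insert j \<tau>) * insert_sign j (insert i \<tau>) = - (insert_sign j \<tau> * insert_sign i \<tau>)"
  using assms by (auto simp: insert_sign_insert not_less mult.commute)

text \<open>
  The sign in \<open>\<sigma> e\<^sub>\<tau> = \<plusminus> e\<^bsub>\<sigma> \<tau>\<^esub>\<close>, by counting the inversions of \<open>\<sigma>\<close> on \<open>\<tau>\<close>.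
\<close>

definition perm_sign :: "('n::linorder \<Rightarrow> 'n) \<Rightarrow> 'n set \<Rightarrow> 'k::comm_ring_1" where
  "perm_sign \<sigma> \<tau> = (\<Prod>(i, j)\<in>{(i, j). i \<in> \<tau> \<and> j \<in> \<tau> \<and> i < j}. if \<sigma> i < \<sigma> j then 1 else - 1)"

lemma perm_sign_empty [simp]: "perm_sign \<sigma> {} = 1" by (simp add: perm_sign_def)

text \<open>
  This recursion expresses that \<open>\<sigma>\<close> respects exterior products. It determines \<open>perm_sign\<close>, so the other
  properties follow by induction on \<open>\<tau>\<close>, without counting inversions again.
\<close>

lemma perm_sign_insert:
  fixes \<tau> :: "'n::{finite,linorder} set"
  assumes "bij \<sigma>" "l \<notin> \<tau>"
  shows "perm_sign \<sigma> (insert l \<tau>) = (insert_sign (\<sigma> l) (\<sigma> ` \<tau>) * insert_sign l \<tau> * perm_sign \<sigma> \<tau> :: 'k::comm_ring_1)"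
proof -
  let ?P = "\<lambda>\<tau>. {(i, j). i \<in> \<tau> \<and> j \<in> \<tau> \<and> i < j}"
  let ?f = "\<lambda>j. if l < j then (l, j) else (j, l)"
  have P: "?P (insert l \<tau>) = ?P \<tau> \<union> ?f ` \<tau>"
  proof (intro equalityI subsetI)
    fix x assume "x \<in> ?P (insert l \<tau>)"
    then obtain i j where x: "x = (i, j)" "i \<in> insert l \<tau>" "j \<in> insert l \<tau>" "i < j" by auto
    then show "x \<in> ?P \<tau> \<union> ?f ` \<tau>"
      by (cases "i = l"; cases "j = l") (auto simp: image_iff)
  next
    fix x assume "x \<in> ?P \<tau> \<union> ?f ` \<tau>"
    moreover have "j < l" if "\<not> l < j" "j \<in> \<tau>" for j using that assms(2) by (metis linorder_neqE)
    ultimately show "x \<in> ?P (insert l \<tau>)" by (auto split: if_splits)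
  qed
  have fin: "finite (?P \<tau>)" by simp
  have disj: "?P \<tau> \<inter> ?f ` \<tau> = {}" using assms(2) by (auto split: if_splits)
  have inj: "inj_on ?f \<tau>" using assms(2) by (auto simp: inj_on_def split: if_splits)
  have s: "inj_on \<sigma> \<tau>" using assms(1) by (meson bij_is_inj inj_on_subset subset_UNIV)
  have ne: "j \<in> \<tau> \<Longrightarrow> \<sigma> j \<noteq> \<sigma> l" for j using assms by (metis bij_pointE)
  have "perm_sign \<sigma> (insert l \<tau>) = perm_sign \<sigma> \<tau> * (\<Prod>j\<in>\<tau>. case ?f j of (i, j) \<Rightarrow> if \<sigma> i < \<sigma> j then 1 else (- 1 :: 'k))"
    unfolding perm_sign_def P by (subst prod.union_disjoint[OF fin _ disj]) (simp, simp only: prod.reindex[OF inj] o_def)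
  also have "(\<Prod>j\<in>\<tau>. case ?f j of (i, j) \<Rightarrow> if \<sigma> i < \<sigma> j then 1 else (- 1 :: 'k))
      = insert_sign (\<sigma> l) (\<sigma> ` \<tau>) * insert_sign l \<tau>"
    unfolding insert_sign_def prod.reindex[OF s] prod.distrib[symmetric]
    using assms(2) by (intro prod.cong) (auto simp: not_less le_less dest: ne)
  finally show ?thesis by (simp add: mult.commute)
qed

lemma perm_sign_comp:
  fixes \<tau> :: "'n::{finite,linorder} set"
  assumes "bij \<sigma>" "bij \<rho>"
  shows "perm_sign (\<sigma> \<circ> \<rho>) \<tau> = (perm_sign \<sigma> (\<rho> ` \<tau>) * perm_sign \<rho> \<tau> :: 'k::comm_ring_1)"
  using finite[of \<tau>]
proof (induct \<tau>)
  case (insert l \<tau>)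
  have "\<rho> l \<notin> \<rho> ` \<tau>" using insert assms by (auto simp: bij_is_inj inj_image_mem_iff)
  then have r: "perm_sign \<sigma> (insert (\<rho> l) (\<rho> ` \<tau>)) =
      (insert_sign (\<sigma> (\<rho> l)) (\<sigma> ` \<rho> ` \<tau>) * insert_sign (\<rho> l) (\<rho> ` \<tau>) * perm_sign \<sigma> (\<rho> ` \<tau>) :: 'k)"
    using assms by (intro perm_sign_insert)
  have "perm_sign (\<sigma> \<circ> \<rho>) (insert l \<tau>) =
      (insert_sign (\<sigma> (\<rho> l)) (\<sigma> ` \<rho> ` \<tau>) * insert_sign l \<tau> * perm_sign (\<sigma> \<circ> \<rho>) \<tau> :: 'k)"
    using perm_sign_insert[OF bij_comp[OF assms(2,1)] insert(2), where 'k = 'k] by (simp add: image_comp)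
  also have "\<dots> = perm_sign \<sigma> (\<rho> ` insert l \<tau>) * perm_sign \<rho> (insert l \<tau>)"
    unfolding insert(3) image_insert r perm_sign_insert[OF assms(2) insert(2)] by (simp add: mult_ac)
  finally show ?case .
qed simp

lemma perm_sign_fixed:
  fixes \<tau> :: "'n::{finite,linorder} set"
  assumes "bij \<sigma>" "\<And>i. i \<in> \<tau> \<Longrightarrow> \<sigma> i = i"
  shows "perm_sign \<sigma> \<tau> = 1"
  using finite[of \<tau>] assms(2)
proof (induct \<tau>)
  case (insert l \<tau>)
  have "\<sigma> ` \<tau> = \<tau>" using insert(4) by force
  then show ?case using insert assms(1) by (simp add: perm_sign_insert)
qed simp

lemma perm_sign_transpose:
  fixes \<tau> :: "'n::{finite,linorder} set"
  assumes "i \<in> \<tau>" "j \<in> \<tau>" "i \<noteq> j"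
  shows "perm_sign (transpose i j) \<tau> = (- 1 :: 'k::comm_ring_1)"
proof -
  define \<rho> where "\<rho> = \<tau> - {i, j}"
  have \<tau>: "\<tau> = insert i (insert j \<rho>)" using assms by (auto simp: \<rho>_def)
  have n: "i \<notin> \<rho>" "j \<notin> \<rho>" by (auto simp: \<rho>_def)
  have im: "transpose i j ` \<rho> = \<rho>" using n by (force simp: transpose_def)
  have "perm_sign (transpose i j) \<rho> = (1 :: 'k)"
    using n by (intro perm_sign_fixed) (auto simp: transpose_def)
  then have "perm_sign (transpose i j) \<tau> =
      (insert_sign j (insert i \<rho>) * insert_sign i (insert j \<rho>) * (insert_sign i \<rho> * insert_sign j \<rho>) :: 'k)"
    using assms n by (simp add: \<tau> perm_sign_insert im)
  also have "\<dots> = - (insert_sign i \<rho> * insert_sign j \<rho> * (insert_sign i \<rho> * insert_sign j \<rho>))"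
    using insert_sign_swap_both[of j i \<rho>, where 'a = 'k] assms n by simp
  also have "\<dots> = - 1" by (metis (no_types, lifting) insert_sign_sq mult.assoc mult.commute mult.right_neutral)
  finally show ?thesis .
qed

section \<open>Koszul complexes\<close>

lemma mult_rearrange:
  fixes a b c d x y :: "'a::comm_ring_1"
  shows "a * b = - (c * d) \<Longrightarrow> a * x * (b * y) = - (c * y * (d * x))"
    and "a * b = - (c * d) \<Longrightarrow> a * x * b = - (c * (d * x))"
    and "a * b = c * d \<Longrightarrow> a * (b * x) = c * x * d"
proof -
  show "a * x * (b * y) = - (c * y * (d * x))" if "a * b = - (c * d)"
    using arg_cong[OF that, of "\<lambda>z. z * (x * y)"] by (simp add: mult_ac)
  show "a * x * b = - (c * (d * x))" if "a * b = - (c * d)"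
    using arg_cong[OF that, of "\<lambda>z. z * x"] by (simp add: mult_ac)
  show "a * (b * x) = c * x * d" if "a * b = c * d"
    using arg_cong[OF that, of "\<lambda>z. z * x"] by (simp add: mult_ac)
qed

lemma sum_image_on:
  assumes "\<And>x y. x \<in> M \<Longrightarrow> y \<in> M \<Longrightarrow> f (x + y) = f x + (f y :: 'b::ab_group_add)"
    and "0 \<in> M" "\<And>x y. x \<in> M \<Longrightarrow> y \<in> M \<Longrightarrow> x + y \<in> (M :: 'a::ab_group_add set)"
    and "\<And>i. i \<in> A \<Longrightarrow> g i \<in> M"
  shows "f (\<Sum>i\<in>A. g i) = (\<Sum>i\<in>A. f (g i))"
proof -
  have f0: "f 0 = 0" using assms(1)[OF assms(2,2)] by simp
  have "(\<Sum>i\<in>A. g i) \<in> M \<and> f (\<Sum>i\<in>A. g i) = (\<Sum>i\<in>A. f (g i))"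
    using assms(4) by (induct A rule: infinite_finite_induct) (auto simp: f0 assms(1-3))
  then show ?thesis by simp
qed

text \<open>
  Additive subgroups. Spaces of chains, cycles, boundaries and tensor relations are all only used
  as subgroups, with scalars and permutations as further operators.
\<close>

definition diff_closed :: "'a::ab_group_add set \<Rightarrow> bool" where
  "diff_closed A \<longleftrightarrow> 0 \<in> A \<and> (\<forall>x\<in>A. \<forall>y\<in>A. x - y \<in> A)"

lemma diff_closedD:
  assumes "diff_closed A"
  shows "0 \<in> A" "x \<in> A \<Longrightarrow> y \<in> A \<Longrightarrow> x - y \<in> A" "x \<in> A \<Longrightarrow> - x \<in> A"
    "x \<in> A \<Longrightarrow> y \<in> A \<Longrightarrow> x + y \<in> A"
proof -
  show 0: "0 \<in> A" and d: "\<And>x y. x \<in> A \<Longrightarrow> y \<in> A \<Longrightarrow> x - y \<in> A"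
    using assms by (auto simp: diff_closed_def)
  show m: "\<And>x. x \<in> A \<Longrightarrow> - x \<in> A" using d[OF 0] by simp
  show "x \<in> A \<Longrightarrow> y \<in> A \<Longrightarrow> x + y \<in> A" using d[OF _ m] by fastforce
qed

text \<open>
  A function \<open>c\<close> stands for the Koszul chain \<open>\<Sum>\<tau>. c \<tau> \<otimes> e\<^sub>\<tau>\<close>; the differential is contraction with
  \<open>(x\<^sub>i)\<^sub>i\<close>.
\<close>

definition kdiff :: "(('n::{finite,linorder}, 'k::field) mpoly \<Rightarrow> 'f::ab_group_add \<Rightarrow> 'f) \<Rightarrow>
    ('n set \<Rightarrow> 'f) \<Rightarrow> 'n set \<Rightarrow> 'f" where
  "kdiff s c \<tau> = (\<Sum>i\<in>-\<tau>. s (mconst (insert_sign i \<tau>) * var i) (c (insert i \<tau>)))"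

definition kchains :: "'f::ab_group_add set \<Rightarrow> nat \<Rightarrow> ('n set \<Rightarrow> 'f) set" where
  "kchains M l = {c. \<forall>\<tau>. c \<tau> \<in> M \<and> (card \<tau> \<noteq> l \<longrightarrow> c \<tau> = 0)}"

text \<open>
  Cycles and boundaries are taken in a graded family \<open>C\<close> of chains, not in all chains with values in a
  module, since the complex of descending chains below is not of that form.
\<close>

definition kcycles :: "(('n::{finite,linorder}, 'k::field) mpoly \<Rightarrow> 'f::ab_group_add \<Rightarrow> 'f) \<Rightarrow>
    (nat \<Rightarrow> ('n set \<Rightarrow> 'f) set) \<Rightarrow> nat \<Rightarrow> ('n set \<Rightarrow> 'f) set" where
  "kcycles s C l = {c \<in> C l. kdiff s c = 0}"

definition kbounds :: "(('n::{finite,linorder}, 'k::field) mpoly \<Rightarrow> 'f::ab_group_add \<Rightarrow> 'f) \<Rightarrow>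
    (nat \<Rightarrow> ('n set \<Rightarrow> 'f) set) \<Rightarrow> nat \<Rightarrow> ('n set \<Rightarrow> 'f) set" where
  "kbounds s C l = kdiff s ` C (Suc l)"

definition chain_scale :: "(('n, 'k::field) mpoly \<Rightarrow> 'f::ab_group_add \<Rightarrow> 'f) \<Rightarrow>
    'k \<Rightarrow> ('n set \<Rightarrow> 'f) \<Rightarrow> 'n set \<Rightarrow> 'f" where
  "chain_scale s a c = (\<lambda>\<tau>. s (mconst a) (c \<tau>))"

lemma kchainsI:
  "(\<And>\<tau>. c \<tau> \<in> M) \<Longrightarrow> (\<And>\<tau>. card \<tau> \<noteq> l \<Longrightarrow> c \<tau> = 0) \<Longrightarrow> c \<in> kchains M l"
  by (simp add: kchains_def)

lemma kchainsD:
  assumes "c \<in> kchains M l"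
  shows "c \<tau> \<in> M" "card \<tau> \<noteq> l \<Longrightarrow> c \<tau> = 0"
  using assms by (simp_all add: kchains_def)

locale poly_module = module s
  for s :: "('n::{finite,linorder}, 'k::field) mpoly \<Rightarrow> 'f::ab_group_add \<Rightarrow> 'f"
begin

lemma kdiff_diff: "kdiff s (c - c') = kdiff s c - kdiff s c'"
  by (rule ext) (simp add: kdiff_def scale_right_diff_distrib sum_subtractf)

lemma kdiff_0 [simp]: "kdiff s 0 = 0"
  using kdiff_diff[of 0 0] by simp

lemma kdiff_add: "kdiff s (c + c') = kdiff s c + kdiff s c'"
  using kdiff_diff[of "c + c'" c'] by simp

lemma kdiff_chain_scale: "kdiff s (chain_scale s a c) = chain_scale s a (kdiff s c)"
  by (rule ext) (simp add: kdiff_def chain_scale_def scale_sum_right mult_ac)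

lemma chain_scale_diff: "chain_scale s a (c - c') = chain_scale s a c - chain_scale s a c'"
  by (rule ext) (simp add: chain_scale_def scale_right_diff_distrib)

lemma chain_scale_chain_scale: "chain_scale s a (chain_scale s b c) = chain_scale s (a * b) c"
  by (rule ext) (simp add: chain_scale_def mconst_mult)

lemma chain_scale_1 [simp]: "chain_scale s 1 c = c"
  by (rule ext) (simp add: chain_scale_def)

lemma kdiff_kdiff: "kdiff s (kdiff s c) = 0"
proof (rule ext)
  fix \<tau>
  define g where "g i j = s (mconst (insert_sign i \<tau>) * var i * (mconst (insert_sign j (insert i \<tau>)) * var j))
    (c (insert i (insert j \<tau>)))" for i j
  have anti: "g j i = - g i j" if "i \<noteq> j" "i \<notin> \<tau>" "j \<notin> \<tau>" for i j
  proof -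
    have "insert_sign j \<tau> * insert_sign i (insert j \<tau>) = - (insert_sign i \<tau> * insert_sign j (insert i \<tau>) :: 'k)"
      using insert_sign_swap[OF that, where 'a = 'k] by (simp add: mult.commute)
    then have "mconst (insert_sign j \<tau>) * mconst (insert_sign i (insert j \<tau>)) =
        - (mconst (insert_sign i \<tau>) * mconst (insert_sign j (insert i \<tau>)) :: ('n, 'k) mpoly)"
      by (simp add: mconst_mult mconst_uminus)
    then have "mconst (insert_sign j \<tau>) * var j * (mconst (insert_sign i (insert j \<tau>)) * var i) =
        - (mconst (insert_sign i \<tau>) * var i * (mconst (insert_sign j (insert i \<tau>)) * var j) :: ('n, 'k) mpoly)"
      by (rule mult_rearrange)
    then show ?thesis by (simp add: g_def insert_commute)
  qed
  have "kdiff s (kdiff s c) \<tau> = (\<Sum>i\<in>-\<tau>. \<Sum>j\<in>-insert i \<tau>. g i j)"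
    unfolding kdiff_def g_def by (intro sum.cong refl) (simp add: scale_sum_right insert_commute)
  also have "\<dots> = (\<Sum>i\<in>-\<tau>. \<Sum>j\<in>-\<tau>. (if i < j then g i j else 0) + (if j < i then g i j else 0))"
  proof (rule sum.cong[OF refl])
    fix i assume "i \<in> - \<tau>"
    then have ci: "- \<tau> = insert i (- insert i \<tau>)" by auto
    have "(\<Sum>j\<in>-\<tau>. (if i < j then g i j else 0) + (if j < i then g i j else 0)) =
        (\<Sum>j\<in>- insert i \<tau>. (if i < j then g i j else 0) + (if j < i then g i j else 0))"
      by (subst ci) simp
    also have "\<dots> = (\<Sum>j\<in>- insert i \<tau>. g i j)"
      by (intro sum.cong) auto
    finally show "(\<Sum>j\<in>- insert i \<tau>. g i j) =
       (\<Sum>j\<in>-\<tau>. (if i < j then g i j else 0) + (if j < i then g i j else 0))" by simp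
  qed
  also have "\<dots> = (\<Sum>i\<in>-\<tau>. \<Sum>j\<in>-\<tau>. if i < j then g i j else 0) + (\<Sum>j\<in>-\<tau>. \<Sum>i\<in>-\<tau>. if j < i then g i j else 0)"
    by (simp add: sum.distrib) (rule sum.swap)
  also have "\<dots> = 0"
    unfolding sum.distrib[symmetric]
  proof (intro sum.neutral ballI)
    fix i j assume "i \<in> - \<tau>" "j \<in> - \<tau>"
    then show "(if i < j then g i j else 0) + (if i < j then g j i else 0) = 0"
      using anti[of i j] by simp
  qed
  finally show "kdiff s (kdiff s c) \<tau> = 0 \<tau>" by simp
qed

lemma kdiff_kchains:
  assumes M: "subspace M" and c: "c \<in> kchains M (Suc l)"
  shows "kdiff s c \<in> kchains M l"
proof (rule kchainsI)
  fix \<tau>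
  show "kdiff s c \<tau> \<in> M"
    unfolding kdiff_def by (rule subspace_sum[OF M]) (rule subspace_scale[OF M kchainsD(1)[OF c]])
  assume "card \<tau> \<noteq> l"
  then have "c (insert i \<tau>) = 0" if "i \<in> - \<tau>" for i
    using that by (intro kchainsD(2)[OF c]) simp
  then show "kdiff s c \<tau> = 0"
    unfolding kdiff_def by (intro sum.neutral) simp
qed

lemma kdiff_kchains_0: "c \<in> kchains M 0 \<Longrightarrow> kdiff s c = 0"
  by (rule ext) (simp add: kdiff_def kchains_def)

lemma diff_closed_kchains: "subspace M \<Longrightarrow> diff_closed (kchains M l)"
  by (auto simp: kchains_def diff_closed_def subspace_0 subspace_diff)

lemma chain_scale_kchains: "subspace M \<Longrightarrow> c \<in> kchains M l \<Longrightarrow> chain_scale s a c \<in> kchains M l"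
  by (auto simp: kchains_def chain_scale_def subspace_scale)

lemma diff_closed_kcycles: "diff_closed (C l) \<Longrightarrow> diff_closed (kcycles s C l)"
  by (auto simp: kcycles_def diff_closed_def kdiff_diff)

lemma diff_closed_kbounds: "diff_closed (C (Suc l)) \<Longrightarrow> diff_closed (kbounds s C l)"
  unfolding kbounds_def diff_closed_def
proof safe
  assume *: "0 \<in> C (Suc l)" "\<forall>x\<in>C (Suc l). \<forall>y\<in>C (Suc l). x - y \<in> C (Suc l)"
  show "0 \<in> kdiff s ` C (Suc l)" using *(1) by (intro image_eqI[of _ _ 0]) simp_all
  fix x y assume "x \<in> C (Suc l)" "y \<in> C (Suc l)"
  then show "kdiff s x - kdiff s y \<in> kdiff s ` C (Suc l)"
    using * by (intro image_eqI[of _ _ "x - y"]) (simp_all only: kdiff_diff)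
qed

lemma kbounds_subset_kcycles:
  assumes "\<And>c. c \<in> C (Suc l) \<Longrightarrow> kdiff s c \<in> C l"
  shows "kbounds s C l \<subseteq> kcycles s C l"
  using assms by (auto simp: kbounds_def kcycles_def kdiff_kdiff)

text \<open>
  The properties of \<open>divide_var v\<close> that make the Koszul complex contract.
\<close>

definition division :: "'f set \<Rightarrow> 'n \<Rightarrow> ('f \<Rightarrow> 'f) \<Rightarrow> bool" where
  "division M v \<delta> \<longleftrightarrow> (\<forall>x\<in>M. \<delta> x \<in> M) \<and> (\<forall>x\<in>M. \<forall>y\<in>M. \<delta> (x + y) = \<delta> x + \<delta> y) \<and>
     (\<forall>x\<in>M. \<forall>a. \<delta> (s (mconst a) x) = s (mconst a) (\<delta> x)) \<and>
     (\<forall>x\<in>M. \<delta> (s (var v) x) = x) \<and>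
     (\<forall>x\<in>M. \<forall>j. j \<noteq> v \<longrightarrow> \<delta> (s (var j) x) = s (var j) (\<delta> x))"

text \<open>
  On a free module, divide the coordinates with respect to a basis.
\<close>

lemma division_free:
  assumes "free_submodule s M"
  shows "\<exists>\<delta>. division M v \<delta>"
proof -
  obtain B where B: "independent B" "span B = M"
    using assms by (auto simp: free_submodule_def)
  let ?R = "representation B"
  define \<delta> where "\<delta> x = (\<Sum>b | ?R x b \<noteq> 0. s (divide_var v (?R x b)) b)" for x
  have fin: "finite {b. ?R x b \<noteq> 0}" for x by (rule finite_representation)
  have sh0 [simp]: "divide_var v 0 = (0 :: ('n, 'k) mpoly)" using divide_var_diff[of v 0 "0 :: ('n, 'k) mpoly"] by simp
  have \<delta>: "\<delta> x = (\<Sum>b\<in>A. s (divide_var v (?R x b)) b)" if "finite A" "{b. ?R x b \<noteq> 0} \<subseteq> A" for x A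
    unfolding \<delta>_def using that by (intro sum.mono_neutral_left) auto
  have Rs: "?R (s r x) b = r * ?R x b" if x: "x \<in> M" for r x b
  proof -
    have "?R (s r x) = (\<lambda>b. r * ?R x b)"
    proof (rule representation_eqI[OF B(1)])
      show "s r x \<in> span B" using x B by (metis span_scale)
      show "r * ?R x b \<noteq> 0 \<Longrightarrow> b \<in> B" for b by (metis mult_zero_right representation_ne_zero)
      show f: "finite {b. r * ?R x b \<noteq> 0}" by (rule finite_subset[OF _ fin[of x]]) auto
      have "(\<Sum>b | r * ?R x b \<noteq> 0. s (r * ?R x b) b) = (\<Sum>b | ?R x b \<noteq> 0. s (r * ?R x b) b)"
        by (rule sum.mono_neutral_left[OF fin]) auto
      also have "\<dots> = s r (\<Sum>b | ?R x b \<noteq> 0. s (?R x b) b)" by (simp add: scale_sum_right)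
      also have "\<dots> = s r x" using x B by (simp add: sum_nonzero_representation_eq)
      finally show "(\<Sum>b | r * ?R x b \<noteq> 0. s (r * ?R x b) b) = s r x" .
    qed
    then show ?thesis by simp
  qed
  have sub: "{b. ?R (s r x) b \<noteq> 0} \<subseteq> {b. ?R x b \<noteq> 0}" if "x \<in> M" for r x
    using Rs[OF that] by auto
  have "\<delta> x \<in> M" for x
    unfolding \<delta>_def B(2)[symmetric]
    by (intro span_sum span_scale span_base) (auto intro: representation_ne_zero)
  moreover have "\<delta> (x + y) = \<delta> x + \<delta> y" if "x \<in> M" "y \<in> M" for x y
  proof -
    let ?A = "{b. ?R x b \<noteq> 0} \<union> {b. ?R y b \<noteq> 0}"
    have R: "?R (x + y) = (\<lambda>b. ?R x b + ?R y b)"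
      using that B representation_add[of B y x] by simp
    have sha: "divide_var v (p + q) = divide_var v p + divide_var v q" for p q :: "('n, 'k) mpoly"
      using divide_var_diff[of v "p + q" q] by (simp add: algebra_simps)
    show ?thesis
      using fin[of x] fin[of y] by (subst (1 2 3) \<delta>[of ?A]) (auto simp: R sha scale_left_distrib sum.distrib)
  qed
  moreover have "\<delta> (s (mconst a) x) = s (mconst a) (\<delta> x)" if "x \<in> M" for x a
    unfolding \<delta>[OF fin sub[OF that]] by (simp add: \<delta>_def Rs[OF that] divide_var_mconst scale_sum_right)
  moreover have "\<delta> (s (var v) x) = x" if "x \<in> M" for x
    unfolding \<delta>[OF fin sub[OF that]] using that B
    by (simp add: Rs[OF that] divide_var_var_same sum_nonzero_representation_eq)
  moreover have "\<delta> (s (var j) x) = s (var j) (\<delta> x)" if "x \<in> M" "j \<noteq> v" for x j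
    unfolding \<delta>[OF fin sub[OF that(1)]] using that(2)
    by (simp add: \<delta>_def Rs[OF that(1)] divide_var_var_other scale_sum_right)
  ultimately have "division M v \<delta>" unfolding division_def by blast
  then show ?thesis by blast
qed

text \<open>
  Exterior multiplication by \<open>e\<^sub>v\<close>, combined with division by \<open>x\<^sub>v\<close>.
\<close>

definition contract :: "'n \<Rightarrow> ('f \<Rightarrow> 'f) \<Rightarrow> ('n set \<Rightarrow> 'f) \<Rightarrow> 'n set \<Rightarrow> 'f" where
  "contract v \<delta> c \<tau> = (if v \<in> \<tau> then s (mconst (insert_sign v (\<tau> - {v}))) (\<delta> (c (\<tau> - {v}))) else 0)"

text \<open>
  Exterior multiplication by \<open>e\<^sub>v\<close> anticommutes with contraction by the other variables, so only the direction
  \<open>v\<close> contributes. There a value is replaced by its remainder under division by \<open>x\<^sub>v\<close> if \<open>v \<notin> \<tau>\<close>, and by \<open>0\<close>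
  if \<open>v \<in> \<tau>\<close>.
\<close>

lemma contract_homotopy:
  assumes M: "subspace M" and \<delta>: "division M v \<delta>" and c: "\<And>\<tau>. c \<tau> \<in> M"
  shows "kdiff s (contract v \<delta> c) + contract v \<delta> (kdiff s c) =
    c - (\<lambda>\<tau>. if v \<in> \<tau> then 0 else c \<tau> - s (var v) (\<delta> (c \<tau>)))"
proof (rule ext)
  fix \<tau>
  show "(kdiff s (contract v \<delta> c) + contract v \<delta> (kdiff s c)) \<tau> =
    (c - (\<lambda>\<tau>. if v \<in> \<tau> then 0 else c \<tau> - s (var v) (\<delta> (c \<tau>)))) \<tau>"
  proof (cases "v \<in> \<tau>")
    case False
    have "kdiff s (contract v \<delta> c) \<tau> =
        (\<Sum>i\<in>{v}. s (mconst (insert_sign i \<tau>) * var i) (contract v \<delta> c (insert i \<tau>)))"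
      unfolding kdiff_def using False by (intro sum.mono_neutral_right) (auto simp: contract_def)
    also have "\<dots> = s (var v) (\<delta> (c \<tau>))"
      using False by (simp add: contract_def mult.commute mult.left_commute mconst_mult flip: mult.assoc)
    finally show ?thesis using False by (simp add: contract_def)
  next
    case True
    define \<rho> where "\<rho> = \<tau> - {v}"
    have \<tau>: "\<tau> = insert v \<rho>" and v: "v \<notin> \<rho>" using True by (auto simp: \<rho>_def)
    let ?g = "\<lambda>i. s (mconst (insert_sign i \<rho>) * var i) (c (insert i \<rho>))"
    have compl: "- \<rho> = insert v (- \<tau>)" "v \<notin> - \<tau>" using \<tau> v by auto
    \<comment> \<open>The summand for \<open>v\<close> is \<open>c \<tau>\<close> up to sign; the others occur in \<open>kdiff s (contract v \<delta> c) \<tau>\<close> with the opposite sign.\<close>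
    have "\<delta> (kdiff s c \<rho>) = (\<Sum>i\<in>- \<rho>. \<delta> (?g i))"
      unfolding kdiff_def using \<delta> M c
      by (intro sum_image_on[of M]) (auto simp: division_def subspace_def)
    also have "\<dots> = \<delta> (?g v) + (\<Sum>i\<in>- \<tau>. \<delta> (?g i))"
      unfolding compl(1) using compl(2) by simp
    also have "\<delta> (?g v) = s (mconst (insert_sign v \<rho>)) (c \<tau>)"
      using \<delta> M c by (simp add: division_def \<tau> subspace_scale flip: scale_scale)
    also have "(\<Sum>i\<in>- \<tau>. \<delta> (?g i)) = (\<Sum>i\<in>- \<tau>. s (mconst (insert_sign i \<rho>) * var i) (\<delta> (c (insert i \<rho>))))"
    proof (intro sum.cong refl)
      fix i assume "i \<in> - \<tau>"
      then have "i \<noteq> v" using True by auto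
      then show "\<delta> (?g i) = s (mconst (insert_sign i \<rho>) * var i) (\<delta> (c (insert i \<rho>)))"
        using \<delta> M c by (simp add: division_def subspace_scale flip: scale_scale)
    qed
    finally have "s (mconst (insert_sign v \<rho>)) (\<delta> (kdiff s c \<rho>)) = c \<tau> +
        (\<Sum>i\<in>- \<tau>. s (mconst (insert_sign v \<rho>) * (mconst (insert_sign i \<rho>) * var i)) (\<delta> (c (insert i \<rho>))))"
      by (simp add: scale_right_distrib scale_sum_right mconst_mult)
    moreover have "kdiff s (contract v \<delta> c) \<tau> =
        (\<Sum>i\<in>- \<tau>. - s (mconst (insert_sign v \<rho>) * (mconst (insert_sign i \<rho>) * var i)) (\<delta> (c (insert i \<rho>))))"
      unfolding kdiff_def
    proof (intro sum.cong refl)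
      fix i assume "i \<in> - \<tau>"
      then have i: "i \<noteq> v" "i \<notin> \<rho>" "insert i \<tau> - {v} = insert i \<rho>" using \<tau> v by auto
      have "insert_sign i \<tau> * insert_sign v (insert i \<rho>) = - (insert_sign v \<rho> * insert_sign i \<rho> :: 'k)"
        using insert_sign_swap_both[OF i(1,2) v] by (simp add: \<tau> mult.commute)
      then have "mconst (insert_sign i \<tau>) * mconst (insert_sign v (insert i \<rho>)) =
          - (mconst (insert_sign v \<rho>) * mconst (insert_sign i \<rho>) :: ('n, 'k) mpoly)"
        by (simp add: mconst_mult mconst_uminus)
      then have "mconst (insert_sign i \<tau>) * var i * mconst (insert_sign v (insert i \<rho>)) =
          - (mconst (insert_sign v \<rho>) * (mconst (insert_sign i \<rho>) * var i) :: ('n, 'k) mpoly)"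
        by (rule mult_rearrange)
      then show "s (mconst (insert_sign i \<tau>) * var i) (contract v \<delta> c (insert i \<tau>)) =
          - s (mconst (insert_sign v \<rho>) * (mconst (insert_sign i \<rho>) * var i)) (\<delta> (c (insert i \<rho>)))"
        using True by (simp add: contract_def i(3))
    qed
    ultimately show ?thesis
      using True by (simp add: contract_def \<rho>_def[symmetric] sum_negf)
  qed
qed

lemma division_0:
  assumes "subspace M" "division M v \<delta>"
  shows "\<delta> 0 = 0"
proof -
  have "\<delta> (0 + 0) = \<delta> 0 + \<delta> 0"
    using assms unfolding division_def by (blast intro: subspace_0)
  then show ?thesis by simp
qed

lemma contract_kchains:
  assumes M: "subspace M" and \<delta>: "division M v \<delta>" and c: "c \<in> kchains M l"
  shows "contract v \<delta> c \<in> kchains M (Suc l)"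
proof (rule kchainsI)
  fix \<tau>
  have "\<delta> (c \<rho>) \<in> M" for \<rho> using \<delta> kchainsD(1)[OF c] by (simp add: division_def)
  then show "contract v \<delta> c \<tau> \<in> M"
    using M by (simp add: contract_def subspace_scale subspace_0)
  assume "card \<tau> \<noteq> Suc l"
  then have "v \<in> \<tau> \<Longrightarrow> card (\<tau> - {v}) \<noteq> l" by (metis card_Suc_Diff1 finite)
  then show "contract v \<delta> c \<tau> = 0"
    by (simp add: contract_def kchainsD(2)[OF c] division_0[OF M \<delta>])
qed

text \<open>
  The homotopies for the variables are applied one after the other. A cycle is replaced by homologous
  cycles that vanish on more and more sets: on each \<open>\<tau>\<close> that contains one of the variables treated so
  far. At the end only \<open>\<tau> = {}\<close> could contribute, and this set has degree \<open>0\<close>.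
\<close>

proposition koszul_exact:
  assumes M: "subspace M" and free: "free_submodule s M"
  shows "kcycles s (kchains M) (Suc l) = kbounds s (kchains M) (Suc l)"
proof
  show "kbounds s (kchains M) (Suc l) \<subseteq> kcycles s (kchains M) (Suc l)"
    using M by (intro kbounds_subset_kcycles kdiff_kchains)
next
  have dz: "diff_closed (kcycles s (kchains M) m)" and db: "diff_closed (kbounds s (kchains M) m)" for m
    using M by (auto intro: diff_closed_kcycles diff_closed_kbounds diff_closed_kchains)
  have bz: "kbounds s (kchains M) m \<subseteq> kcycles s (kchains M) m" for m
    using M by (intro kbounds_subset_kcycles kdiff_kchains)
  show "kcycles s (kchains M) (Suc l) \<subseteq> kbounds s (kchains M) (Suc l)"
  proof
    fix c assume c: "c \<in> kcycles s (kchains M) (Suc l)"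
    have "\<exists>c'\<in>kcycles s (kchains M) (Suc l). c - c' \<in> kbounds s (kchains M) (Suc l) \<and>
        (\<forall>\<tau>. \<tau> \<inter> V \<noteq> {} \<longrightarrow> c' \<tau> = 0)" for V :: "'n set"
      using finite[of V]
    proof (induct V)
      case empty
      have "c - c \<in> kbounds s (kchains M) (Suc l)" unfolding diff_self by (rule diff_closedD(1)[OF db])
      then show ?case using c by blast
    next
      case (insert v V)
      then obtain c' where c': "c' \<in> kcycles s (kchains M) (Suc l)"
        "c - c' \<in> kbounds s (kchains M) (Suc l)" "\<And>\<tau>. \<tau> \<inter> V \<noteq> {} \<Longrightarrow> c' \<tau> = 0" by blast
      obtain \<delta> where \<delta>: "division M v \<delta>" using division_free[OF free] by blast
      define p where "p = (\<lambda>\<tau>. if v \<in> \<tau> then 0 else c' \<tau> - s (var v) (\<delta> (c' \<tau>)))"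
      note \<delta>0 = division_0[OF M \<delta>]
      have ch: "c' \<in> kchains M (Suc l)" "kdiff s c' = 0" using c'(1) by (auto simp: kcycles_def)
      have cz: "contract v \<delta> 0 = 0" by (rule ext) (simp add: contract_def \<delta>0)
      have "kdiff s (contract v \<delta> c') = c' - p"
        using contract_homotopy[OF M \<delta>, of c'] ch by (simp add: cz p_def kchains_def)
      moreover have "contract v \<delta> c' \<in> kchains M (Suc (Suc l))"
        using contract_kchains[OF M \<delta> ch(1)] .
      ultimately have b: "c' - p \<in> kbounds s (kchains M) (Suc l)"
        unfolding kbounds_def by (metis image_eqI)
      have "p \<in> kcycles s (kchains M) (Suc l)"
        using diff_closedD(2)[OF dz c'(1) subsetD[OF bz b]] by simp
      moreover have "c - p \<in> kbounds s (kchains M) (Suc l)"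
        using diff_closedD(4)[OF db c'(2) b] by simp
      moreover have "p \<tau> = 0" if "\<tau> \<inter> insert v V \<noteq> {}" for \<tau>
        using that c'(3)[of \<tau>] by (cases "v \<in> \<tau>") (simp_all add: p_def \<delta>0)
      ultimately show ?case by blast
    qed
    then obtain c' where c': "c' \<in> kcycles s (kchains M) (Suc l)"
        "c - c' \<in> kbounds s (kchains M) (Suc l)" "\<forall>\<tau>. \<tau> \<inter> UNIV \<noteq> {} \<longrightarrow> c' \<tau> = 0" by blast
    have "c' \<tau> = 0" for \<tau>
      using c'(1,3) by (cases "\<tau> = {}") (auto simp: kcycles_def kchains_def)
    then have "c' = 0" by (simp add: fun_eq_iff)
    then show "c \<in> kbounds s (kchains M) (Suc l)" using c'(2) by simp
  qed
qed

end

section \<open>Permutations acting on Koszul chains\<close>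

text \<open>
  The map \<open>\<phi> \<otimes> \<sigma>\<close> on the tensor product of a module with the exterior algebra, where \<open>\<phi>\<close> is the action of
  \<open>\<sigma>\<close> on the module.
\<close>

definition chain_perm :: "(('n::{finite,linorder}, 'k::field) mpoly \<Rightarrow> 'f::ab_group_add \<Rightarrow> 'f) \<Rightarrow>
    ('n \<Rightarrow> 'n) \<Rightarrow> ('f \<Rightarrow> 'f) \<Rightarrow> ('n set \<Rightarrow> 'f) \<Rightarrow> 'n set \<Rightarrow> 'f" where
  "chain_perm s \<sigma> \<phi> c \<tau> = s (mconst (perm_sign \<sigma> (inv \<sigma> ` \<tau>))) (\<phi> (c (inv \<sigma> ` \<tau>)))"

lemma (in poly_module) kdiff_chain_perm:
  assumes M: "subspace M" and \<sigma>: "bij \<sigma>" and \<phi>: "semilinear_on (perm_poly \<sigma>) s s M \<phi>"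
    and c: "\<And>\<tau>. c \<tau> \<in> M"
  shows "kdiff s (chain_perm s \<sigma> \<phi> c) = chain_perm s \<sigma> \<phi> (kdiff s c)"
proof (rule ext)
  fix \<rho>
  define \<tau> where "\<tau> = inv \<sigma> ` \<rho>"
  have \<rho>: "\<rho> = \<sigma> ` \<tau>" using \<sigma> by (simp add: \<tau>_def image_f_inv_f bij_is_surj)
  have im: "inv \<sigma> ` insert (\<sigma> i) \<rho> = insert i \<tau>" for i
    using \<sigma> by (simp add: \<tau>_def bij_is_inj)
  have cr: "- \<rho> = \<sigma> ` (- \<tau>)" using \<sigma> by (simp add: \<rho> bij_image_Compl_eq)
  have inj: "inj_on \<sigma> (- \<tau>)" using \<sigma> by (meson bij_is_inj inj_on_subset subset_UNIV)
  have \<phi>s: "\<phi> (s r x) = s (perm_poly \<sigma> r) (\<phi> x)" if "x \<in> M" for r x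
    using \<phi> that by (simp add: semilinear_on_def)
  have "chain_perm s \<sigma> \<phi> (kdiff s c) \<rho> = s (mconst (perm_sign \<sigma> \<tau>)) (\<phi> (\<Sum>i\<in>-\<tau>. s (mconst (insert_sign i \<tau>) * var i) (c (insert i \<tau>))))"
    by (simp add: chain_perm_def \<tau>_def kdiff_def)
  also have "\<phi> (\<Sum>i\<in>-\<tau>. s (mconst (insert_sign i \<tau>) * var i) (c (insert i \<tau>))) =
      (\<Sum>i\<in>-\<tau>. \<phi> (s (mconst (insert_sign i \<tau>) * var i) (c (insert i \<tau>))))"
    using \<phi> M c by (intro sum_image_on[of M]) (auto simp: semilinear_on_def subspace_def)
  also have "\<dots> = (\<Sum>i\<in>-\<tau>. s (mconst (insert_sign i \<tau>) * var (\<sigma> i)) (\<phi> (c (insert i \<tau>))))"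
    using c \<sigma> by (simp add: \<phi>s perm_poly_mult perm_poly_mconst perm_poly_var)
  also have "s (mconst (perm_sign \<sigma> \<tau>)) \<dots> =
      (\<Sum>i\<in>-\<tau>. s (mconst (insert_sign (\<sigma> i) \<rho>) * var (\<sigma> i)) (chain_perm s \<sigma> \<phi> c (insert (\<sigma> i) \<rho>)))"
    unfolding scale_sum_right
  proof (intro sum.cong refl)
    fix i assume i: "i \<in> - \<tau>"
    have "perm_sign \<sigma> \<tau> * insert_sign i \<tau> = (insert_sign (\<sigma> i) \<rho> * perm_sign \<sigma> (insert i \<tau>) :: 'k)"
      using i \<sigma> by (simp add: perm_sign_insert \<rho> mult_ac)
    then have "mconst (perm_sign \<sigma> \<tau>) * mconst (insert_sign i \<tau>) =
        (mconst (insert_sign (\<sigma> i) \<rho>) * mconst (perm_sign \<sigma> (insert i \<tau>)) :: ('n, 'k) mpoly)"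
      by (simp add: mconst_mult)
    then have "mconst (perm_sign \<sigma> \<tau>) * (mconst (insert_sign i \<tau>) * var (\<sigma> i)) =
        (mconst (insert_sign (\<sigma> i) \<rho>) * var (\<sigma> i) * mconst (perm_sign \<sigma> (insert i \<tau>)) :: ('n, 'k) mpoly)"
      by (rule mult_rearrange)
    then show "s (mconst (perm_sign \<sigma> \<tau>)) (s (mconst (insert_sign i \<tau>) * var (\<sigma> i)) (\<phi> (c (insert i \<tau>)))) =
        s (mconst (insert_sign (\<sigma> i) \<rho>) * var (\<sigma> i)) (chain_perm s \<sigma> \<phi> c (insert (\<sigma> i) \<rho>))"
      unfolding chain_perm_def im scale_scale by (rule arg_cong)
  qed
  also have "\<dots> = kdiff s (chain_perm s \<sigma> \<phi> c) \<rho>"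
    by (simp add: kdiff_def cr sum.reindex[OF inj])
  finally show "kdiff s (chain_perm s \<sigma> \<phi> c) \<rho> = chain_perm s \<sigma> \<phi> (kdiff s c) \<rho>" by simp
qed

lemma (in poly_module) chain_perm_kchains:
  assumes M: "subspace M" and \<sigma>: "bij \<sigma>" and \<phi>: "\<phi> ` M \<subseteq> M" "\<phi> 0 = 0" and c: "c \<in> kchains M l"
  shows "chain_perm s \<sigma> \<phi> c \<in> kchains M l"
proof -
  have "card (inv \<sigma> ` \<tau>) = card \<tau>" for \<tau>
    using \<sigma> by (meson bij_imp_bij_inv bij_is_inj card_image inj_on_subset subset_UNIV)
  then show ?thesis
    using assms by (auto simp: kchains_def chain_perm_def intro!: subspace_scale)
qed

section \<open>Correspondences between subquotients\<close>

text \<open>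
  An isomorphism \<open>Z/B \<cong> Z'/B'\<close> that commutes with operators \<open>A\<close> and \<open>A'\<close> indexed by \<open>\<Omega>\<close>, given as an
  additive relation between representatives. Connecting homomorphisms are relations of this kind by
  nature, and composition and inversion need no choice of representatives. Differences suffice for
  additivity, as sums are obtained from them; injectivity and well-definedness are the equivalence
  in the last clause.
\<close>

definition subquot_corr ::
  "'o set \<Rightarrow> ('o \<Rightarrow> 'a \<Rightarrow> 'a) \<Rightarrow> 'a::ab_group_add set \<Rightarrow> 'a set \<Rightarrow>
   ('o \<Rightarrow> 'b \<Rightarrow> 'b) \<Rightarrow> 'b::ab_group_add set \<Rightarrow> 'b set \<Rightarrow> ('a \<times> 'b) set \<Rightarrow> bool" where
  "subquot_corr \<Omega> A Z B A' Z' B' \<rho> \<longleftrightarrow>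
     Domain \<rho> = Z \<and> Range \<rho> = Z' \<and>
     (\<forall>(x, x')\<in>\<rho>. \<forall>(y, y')\<in>\<rho>. (x - y, x' - y') \<in> \<rho>) \<and>
     (\<forall>a\<in>\<Omega>. \<forall>(x, x')\<in>\<rho>. (A a x, A' a x') \<in> \<rho>) \<and>
     (\<forall>(x, x')\<in>\<rho>. x \<in> B \<longleftrightarrow> x' \<in> B')"

definition subquot_iso ::
  "'o set \<Rightarrow> ('o \<Rightarrow> 'a \<Rightarrow> 'a) \<Rightarrow> 'a::ab_group_add set \<Rightarrow> 'a set \<Rightarrow>
   ('o \<Rightarrow> 'b \<Rightarrow> 'b) \<Rightarrow> 'b::ab_group_add set \<Rightarrow> 'b set \<Rightarrow> bool" where
  "subquot_iso \<Omega> A Z B A' Z' B' \<longleftrightarrow> (\<exists>\<rho>. subquot_corr \<Omega> A Z B A' Z' B' \<rho>)"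

lemma subquot_isoI:
  assumes "\<And>x x'. (x, x') \<in> \<rho> \<Longrightarrow> x \<in> Z \<and> x' \<in> Z'"
    and "\<And>x. x \<in> Z \<Longrightarrow> \<exists>x'. (x, x') \<in> \<rho>" "\<And>x'. x' \<in> Z' \<Longrightarrow> \<exists>x. (x, x') \<in> \<rho>"
    and "\<And>x x' y y'. (x, x') \<in> \<rho> \<Longrightarrow> (y, y') \<in> \<rho> \<Longrightarrow> (x - y, x' - y') \<in> \<rho>"
    and "\<And>a x x'. a \<in> \<Omega> \<Longrightarrow> (x, x') \<in> \<rho> \<Longrightarrow> (A a x, A' a x') \<in> \<rho>"
    and "\<And>x x'. (x, x') \<in> \<rho> \<Longrightarrow> x \<in> B \<longleftrightarrow> x' \<in> B'"
  shows "subquot_iso \<Omega> A Z B A' Z' B'"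
  unfolding subquot_iso_def subquot_corr_def
proof (intro exI[of _ \<rho>] conjI)
  show "Domain \<rho> = Z" "Range \<rho> = Z'" using assms(1-3) by blast+
qed (use assms(4-6) in blast)+

lemma subquot_corrD:
  assumes "subquot_corr \<Omega> A Z B A' Z' B' \<rho>"
  shows "(x, x') \<in> \<rho> \<Longrightarrow> x \<in> Z" "(x, x') \<in> \<rho> \<Longrightarrow> x' \<in> Z'"
    and "x \<in> Z \<Longrightarrow> \<exists>x'. (x, x') \<in> \<rho>" "x' \<in> Z' \<Longrightarrow> \<exists>x. (x, x') \<in> \<rho>"
    and "(x, x') \<in> \<rho> \<Longrightarrow> (y, y') \<in> \<rho> \<Longrightarrow> (x - y, x' - y') \<in> \<rho>"
    and "a \<in> \<Omega> \<Longrightarrow> (x, x') \<in> \<rho> \<Longrightarrow> (A a x, A' a x') \<in> \<rho>"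
    and "(x, x') \<in> \<rho> \<Longrightarrow> x \<in> B \<longleftrightarrow> x' \<in> B'"
  using assms unfolding subquot_corr_def by blast+

lemma subquot_iso_sym:
  assumes "subquot_iso \<Omega> A Z B A' Z' B'"
  shows "subquot_iso \<Omega> A' Z' B' A Z B"
proof -
  from assms obtain \<rho> where "subquot_corr \<Omega> A Z B A' Z' B' \<rho>" by (auto simp: subquot_iso_def)
  note \<rho> = subquot_corrD[OF this]
  show ?thesis by (rule subquot_isoI[of "\<rho>\<inverse>"]) (simp_all add: \<rho>)
qed

lemma subquot_iso_trans:
  assumes "subquot_iso \<Omega> A Z B A' Z' B'" "subquot_iso \<Omega> A' Z' B' A'' Z'' B''"
  shows "subquot_iso \<Omega> A Z B A'' Z'' B''"
proof -
  from assms obtain \<rho> \<rho>' where "subquot_corr \<Omega> A Z B A' Z' B' \<rho>" "subquot_corr \<Omega> A' Z' B' A'' Z'' B'' \<rho>'"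
    by (auto simp: subquot_iso_def)
  note \<rho> = subquot_corrD[OF this(1)] and \<rho>' = subquot_corrD[OF this(2)]
  show ?thesis
  proof (rule subquot_isoI[of "\<rho> O \<rho>'"])
    fix x x' assume "(x, x') \<in> \<rho> O \<rho>'"
    then show "x \<in> Z \<and> x' \<in> Z''" "x \<in> B \<longleftrightarrow> x' \<in> B''" using \<rho>(1,7) \<rho>'(2,7) by blast+
  next
    fix x assume "x \<in> Z" then show "\<exists>x'. (x, x') \<in> \<rho> O \<rho>'" using \<rho>(2,3) \<rho>'(3) by blast
  next
    fix x' assume "x' \<in> Z''" then show "\<exists>x. (x, x') \<in> \<rho> O \<rho>'" using \<rho>(4) \<rho>'(1,4) by blast
  next
    fix x x' y y' assume "(x, x') \<in> \<rho> O \<rho>'" "(y, y') \<in> \<rho> O \<rho>'"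
    then show "(x - y, x' - y') \<in> \<rho> O \<rho>'" using \<rho>(5) \<rho>'(5) by blast
  next
    fix a x x' assume "a \<in> \<Omega>" "(x, x') \<in> \<rho> O \<rho>'"
    then show "(A a x, A'' a x') \<in> \<rho> O \<rho>'" using \<rho>(6) \<rho>'(6) by blast
  qed
qed

lemma subquot_iso_refl:
  assumes "\<And>x y. x \<in> Z \<Longrightarrow> y \<in> Z \<Longrightarrow> x - y \<in> Z" "\<And>a x. a \<in> \<Omega> \<Longrightarrow> x \<in> Z \<Longrightarrow> A a x \<in> Z"
  shows "subquot_iso \<Omega> A Z B A Z B"
  using assms by (intro subquot_isoI[of "Id_on Z"]) auto

lemma subquot_iso_closed:
  assumes "subquot_iso \<Omega> A Z B A' Z' B'"
  shows "x \<in> Z \<Longrightarrow> y \<in> Z \<Longrightarrow> x - y \<in> Z" and "a \<in> \<Omega> \<Longrightarrow> x \<in> Z \<Longrightarrow> A a x \<in> Z"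
proof -
  from assms obtain \<rho> where "subquot_corr \<Omega> A Z B A' Z' B' \<rho>" by (auto simp: subquot_iso_def)
  note \<rho> = subquot_corrD[OF this]
  show "x \<in> Z \<Longrightarrow> y \<in> Z \<Longrightarrow> x - y \<in> Z" using \<rho>(1,3,5) by metis
  show "a \<in> \<Omega> \<Longrightarrow> x \<in> Z \<Longrightarrow> A a x \<in> Z" using \<rho>(1,3,6) by metis
qed

text \<open>
  The class of \<open>z\<close> is fixed by the operator \<open>a\<close> iff \<open>A a z - z \<in> B\<close>, which holds for both or for none of two
  corresponding elements. The closure hypotheses make the classes fixed by \<open>S\<close> a subquotient again.
\<close>

lemma subquot_iso_invariants:
  assumes iso: "subquot_iso \<Omega> A Z B A' Z' B'" and sub: "\<Theta> \<subseteq> \<Omega>" "S \<subseteq> \<Omega>"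
  defines "W \<equiv> {z \<in> Z. \<forall>a\<in>S. A a z - z \<in> B}" and "W' \<equiv> {z \<in> Z'. \<forall>a\<in>S. A' a z - z \<in> B'}"
  assumes closed: "\<And>x y. x \<in> W \<Longrightarrow> y \<in> W \<Longrightarrow> x - y \<in> W" "\<And>a x. a \<in> \<Theta> \<Longrightarrow> x \<in> W \<Longrightarrow> A a x \<in> W"
  shows "subquot_iso \<Theta> A W B A' W' B'"
proof -
  from iso obtain \<rho> where "subquot_corr \<Omega> A Z B A' Z' B' \<rho>" by (auto simp: subquot_iso_def)
  note \<rho> = subquot_corrD[OF this]
  have W: "x \<in> W \<longleftrightarrow> x' \<in> W'" if "(x, x') \<in> \<rho>" for x x'
  proof -
    have "A a x - x \<in> B \<longleftrightarrow> A' a x' - x' \<in> B'" if "a \<in> S" for a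
      using \<rho>(7)[OF \<rho>(5)[OF \<rho>(6)[of a x x'] \<open>(x, x') \<in> \<rho>\<close>]] \<open>(x, x') \<in> \<rho>\<close> sub(2) that by blast
    then show ?thesis using \<rho>(1,2)[OF that] by (auto simp: W_def W'_def)
  qed
  show ?thesis
  proof (rule subquot_isoI[of "{(x, x') \<in> \<rho>. x \<in> W}"])
    fix x assume "x \<in> W"
    then show "\<exists>x'. (x, x') \<in> {(x, x') \<in> \<rho>. x \<in> W}" using \<rho>(3) by (auto simp: W_def)
  next
    fix x' assume x': "x' \<in> W'"
    then obtain x where "(x, x') \<in> \<rho>" using \<rho>(4) by (auto simp: W'_def)
    then show "\<exists>x. (x, x') \<in> {(x, x') \<in> \<rho>. x \<in> W}" using W x' by blast
  qed (use W closed \<rho>(5,6,7) sub(1) in auto)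
qed

section \<open>Dimension shifting\<close>

text \<open>
  Scalars (\<open>Inl\<close>) and permutations (\<open>Inr\<close>) are operators of one family, so that one notion of equivariance
  serves for both. The families \<open>range Inl\<close> and \<open>range Inl \<union> Inr ` {\<sigma>. bij \<sigma>}\<close> distinguish
  isomorphisms of vector spaces from isomorphisms of representations.
\<close>

definition module_op :: "(('n, 'k::field) mpoly \<Rightarrow> 'f \<Rightarrow> 'f) \<Rightarrow> (('n \<Rightarrow> 'n) \<Rightarrow> 'f \<Rightarrow> 'f) \<Rightarrow> 'k + ('n \<Rightarrow> 'n) \<Rightarrow> 'f \<Rightarrow> 'f" where
  "module_op s \<phi> = case_sum (\<lambda>a. s (mconst a)) \<phi>"

definition chain_op :: "(('n::{finite,linorder}, 'k::field) mpoly \<Rightarrow> 'f::ab_group_add \<Rightarrow> 'f) \<Rightarrow>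
    (('n \<Rightarrow> 'n) \<Rightarrow> 'f \<Rightarrow> 'f) \<Rightarrow> 'k + ('n \<Rightarrow> 'n) \<Rightarrow> ('n set \<Rightarrow> 'f) \<Rightarrow> 'n set \<Rightarrow> 'f" where
  "chain_op s \<phi> = case_sum (chain_scale s) (\<lambda>\<sigma>. chain_perm s \<sigma> (\<phi> \<sigma>))"

lemma additive_on_diff:
  assumes "diff_closed M" "\<And>x y. x \<in> M \<Longrightarrow> y \<in> M \<Longrightarrow> f (x + y) = f x + (f y :: 'b::ab_group_add)"
  shows "x \<in> M \<Longrightarrow> y \<in> M \<Longrightarrow> f (x - y) = f x - f y"
    and "f 0 = 0"
proof -
  show "f (x - y) = f x - f y" if "x \<in> M" "y \<in> M"
    using assms(2)[of "x - y" y] diff_closedD(2)[OF assms(1) that] that(2) by simp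
  show "f 0 = 0" using assms(2)[of 0 0] diff_closedD(1)[OF assms(1)] by simp
qed

lemma (in module) diff_closed_subspace: "subspace M \<Longrightarrow> diff_closed M"
  by (simp add: diff_closed_def subspace_0 subspace_diff)

lemma (in poly_module) kdiff_compose:
  assumes t: "poly_module t" and M: "subspace M" and p: "linear_on s t M p" and c: "\<And>\<tau>. c \<tau> \<in> M"
  shows "kdiff t (p \<circ> c) = p \<circ> kdiff s c"
proof (rule ext)
  fix \<tau>
  have "(p \<circ> kdiff s c) \<tau> = (\<Sum>i\<in>-\<tau>. p (s (mconst (insert_sign i \<tau>) * var i) (c (insert i \<tau>))))"
    unfolding kdiff_def o_apply using p M c
    by (intro sum_image_on[of M]) (auto simp: semilinear_on_def subspace_def)
  also have "\<dots> = kdiff t (p \<circ> c) \<tau>"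
    using p c by (simp add: kdiff_def semilinear_on_def)
  finally show "kdiff t (p \<circ> c) \<tau> = (p \<circ> kdiff s c) \<tau>" by simp
qed

lemma kchains_lift:
  assumes y: "y \<in> kchains (p ` M) l" and "0 \<in> M" "p 0 = 0"
  shows "\<exists>c\<in>kchains M l. p \<circ> c = y"
proof -
  have "\<forall>\<tau>. \<exists>x\<in>M. p x = y \<tau> \<and> (y \<tau> = 0 \<longrightarrow> x = 0)"
    using assms kchainsD(1)[OF y] by (metis imageE)
  then obtain c where c: "\<And>\<tau>. c \<tau> \<in> M \<and> p (c \<tau>) = y \<tau> \<and> (y \<tau> = 0 \<longrightarrow> c \<tau> = 0)" by metis
  then have "c \<in> kchains M l" using kchainsD(2)[OF y] by (intro kchainsI) auto
  then show ?thesis using c by (intro bexI[of _ c]) auto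
qed

text \<open>
  The connecting isomorphism of \<open>0 \<rightarrow> N \<rightarrow> M \<rightarrow> p M \<rightarrow> 0\<close>: lift a cycle of \<open>p M\<close> to a chain \<open>c\<close> of \<open>M\<close> and take
  the boundary of \<open>c\<close>. By exactness of the Koszul complex of \<open>M\<close>, the intersection on the right is all of
  the cycles for \<open>l > 0\<close>; for \<open>l = 0\<close> it describes the kernel of \<open>N \<otimes> k \<rightarrow> M \<otimes> k\<close>.
\<close>

proposition dimension_shift:
  fixes s :: "('n::{finite,linorder}, 'k::field) mpoly \<Rightarrow> 'f::ab_group_add \<Rightarrow> 'f"
    and t :: "('n, 'k) mpoly \<Rightarrow> 'g::ab_group_add \<Rightarrow> 'g"
  assumes "poly_module s" "poly_module t"
    and M: "module.subspace s M" and free: "free_submodule s M" and p: "linear_on s t M p"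
    and \<Omega>: "\<And>\<sigma>. Inr \<sigma> \<in> \<Omega> \<Longrightarrow> bij \<sigma> \<and> semilinear_on (perm_poly \<sigma>) s s M (\<phi> \<sigma>) \<and>
      \<phi> \<sigma> ` M \<subseteq> M \<and> (\<forall>x\<in>M. p (\<phi> \<sigma> x) = \<psi> \<sigma> (p x))"
  defines "N \<equiv> {x \<in> M. p x = 0}"
  shows "subquot_iso \<Omega> (chain_op t \<psi>) (kcycles t (kchains (p ` M)) (Suc l)) (kbounds t (kchains (p ` M)) (Suc l))
    (chain_op s \<phi>) (kcycles s (kchains N) l \<inter> kbounds s (kchains M) l) (kbounds s (kchains N) l)"
proof -
  interpret s: poly_module s by fact
  interpret t: poly_module t by fact
  note Md = s.diff_closed_subspace[OF M]
  have padd: "\<And>x y. x \<in> M \<Longrightarrow> y \<in> M \<Longrightarrow> p (x + y) = p x + p y"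
    and psc: "\<And>r x. x \<in> M \<Longrightarrow> p (s r x) = t r (p x)"
    using p by (auto simp: semilinear_on_def)
  note pdiff = additive_on_diff(1)[OF Md padd] and p0 = additive_on_diff(2)[OF Md padd]
  have kp: "kdiff t (p \<circ> c) = p \<circ> kdiff s c" if "c \<in> kchains M m" for c m
    using s.kdiff_compose[OF \<open>poly_module t\<close> M p] kchainsD(1)[OF that] by blast
  have kM: "kdiff s c \<in> kchains M m" if "c \<in> kchains M (Suc m)" for c m
    using s.kdiff_kchains[OF M that] .
  have kN: "c \<in> kchains N m \<longleftrightarrow> c \<in> kchains M m \<and> p \<circ> c = 0" for c m
    by (auto simp: kchains_def N_def fun_eq_iff)
  have pk: "p \<circ> c \<in> kchains (p ` M) m" if "c \<in> kchains M m" for c m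
    using that by (auto simp: kchains_def p0)
  have pd: "p \<circ> (c - c') = (p \<circ> c) - (p \<circ> c')" if "c \<in> kchains M m" "c' \<in> kchains M m" for c c' m
    using kchainsD(1)[OF that(1)] kchainsD(1)[OF that(2)] by (auto simp: fun_eq_iff pdiff)
  have kd: "c - c' \<in> kchains M m" if "c \<in> kchains M m" "c' \<in> kchains M m" for c c' m
    using diff_closedD(2)[OF s.diff_closed_kchains[OF M] that] .
  have ops: "chain_op s \<phi> a c \<in> kchains M m \<and> p \<circ> chain_op s \<phi> a c = chain_op t \<psi> a (p \<circ> c) \<and>
      kdiff s (chain_op s \<phi> a c) = chain_op s \<phi> a (kdiff s c)" if a: "a \<in> \<Omega>" and c: "c \<in> kchains M m" for a c m
  proof (cases a)
    case (Inl b)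
    then show ?thesis
      using s.chain_scale_kchains[OF M c] kchainsD(1)[OF c]
      by (auto simp: chain_op_def s.kdiff_chain_scale[unfolded chain_scale_def] chain_scale_def psc fun_eq_iff)
  next
    case (Inr \<sigma>)
    note \<sigma> = \<Omega>[OF a[unfolded Inr]]
    have "\<phi> \<sigma> 0 = 0"
      using \<sigma> by (intro additive_on_diff(2)[OF Md]) (auto simp: semilinear_on_def)
    moreover have "\<And>\<tau>. \<phi> \<sigma> (c \<tau>) \<in> M" using \<sigma> kchainsD(1)[OF c] by blast
    ultimately show ?thesis
      using \<sigma> s.chain_perm_kchains[OF M _ _ _ c, of \<sigma> "\<phi> \<sigma>"] s.kdiff_chain_perm[OF M _ _ kchainsD(1)[OF c], of \<sigma> "\<phi> \<sigma>"]
        kchainsD(1)[OF c]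
      by (auto simp: chain_op_def Inr chain_perm_def psc fun_eq_iff)
  qed
  \<comment> \<open>A chain \<open>c\<close> of \<open>M\<close> relates its image in \<open>p M\<close> to its boundary in \<open>N\<close>.\<close>
  let ?\<rho> = "{(p \<circ> c, kdiff s c) | c. c \<in> kchains M (Suc l) \<and> p \<circ> kdiff s c = 0}"
  show ?thesis
  proof (rule subquot_isoI[of ?\<rho>])
    fix y w assume "(y, w) \<in> ?\<rho>"
    then obtain c where c: "c \<in> kchains M (Suc l)" "p \<circ> kdiff s c = 0" "y = p \<circ> c" "w = kdiff s c" by blast
    show "y \<in> kcycles t (kchains (p ` M)) (Suc l) \<and> w \<in> kcycles s (kchains N) l \<inter> kbounds s (kchains M) l"
      using c pk[OF c(1)] kp[OF c(1)] kM[OF c(1)] s.kdiff_kdiff[of c]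
      by (simp add: kcycles_def kbounds_def kN)
    show "y \<in> kbounds t (kchains (p ` M)) (Suc l) \<longleftrightarrow> w \<in> kbounds s (kchains N) l"
    proof
      assume "y \<in> kbounds t (kchains (p ` M)) (Suc l)"
      then obtain y' where y': "y' \<in> kchains (p ` M) (Suc (Suc l))" "y = kdiff t y'"
        by (auto simp: kbounds_def)
      obtain b where b: "b \<in> kchains M (Suc (Suc l))" "p \<circ> b = y'"
        using kchains_lift[OF y'(1) diff_closedD(1)[OF Md] p0] by blast
      have "p \<circ> (c - kdiff s b) = 0"
        using pd[OF c(1) kM[OF b(1)]] kp[OF b(1)] b y' c(3) by simp
      then have "c - kdiff s b \<in> kchains N (Suc l)"
        using kd[OF c(1) kM[OF b(1)]] by (simp add: kN)
      moreover have "kdiff s (c - kdiff s b) = w" using c by (simp add: s.kdiff_diff s.kdiff_kdiff)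
      ultimately show "w \<in> kbounds s (kchains N) l" unfolding kbounds_def by blast
    next
      assume "w \<in> kbounds s (kchains N) l"
      then obtain n where n: "n \<in> kchains M (Suc l)" "p \<circ> n = 0" "w = kdiff s n"
        by (auto simp: kbounds_def kN)
      have "c - n \<in> kcycles s (kchains M) (Suc l)"
        using kd[OF c(1) n(1)] c n by (simp add: kcycles_def s.kdiff_diff)
      then obtain b where b: "b \<in> kchains M (Suc (Suc l))" "c - n = kdiff s b"
        unfolding s.koszul_exact[OF M free] by (auto simp: kbounds_def)
      have "y = kdiff t (p \<circ> b)"
        unfolding kp[OF b(1)] b(2)[symmetric] using pd[OF c(1) n(1)] c n by simp
      then show "y \<in> kbounds t (kchains (p ` M)) (Suc l)" unfolding kbounds_def using pk[OF b(1)] by blast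
    qed
  next
    fix y assume "y \<in> kcycles t (kchains (p ` M)) (Suc l)"
    then have y: "y \<in> kchains (p ` M) (Suc l)" "kdiff t y = 0" by (auto simp: kcycles_def)
    obtain c where c: "c \<in> kchains M (Suc l)" "p \<circ> c = y"
      using kchains_lift[OF y(1) diff_closedD(1)[OF Md] p0] by blast
    then show "\<exists>w. (y, w) \<in> ?\<rho>" using y(2) kp[OF c(1)] by auto
  next
    fix w assume "w \<in> kcycles s (kchains N) l \<inter> kbounds s (kchains M) l"
    then show "\<exists>y. (y, w) \<in> ?\<rho>" by (auto simp: kcycles_def kbounds_def kN)
  next
    fix y w y' w' assume "(y, w) \<in> ?\<rho>" "(y', w') \<in> ?\<rho>"
    then obtain c c' where c: "c \<in> kchains M (Suc l)" "p \<circ> kdiff s c = 0" "y = p \<circ> c" "w = kdiff s c"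
      and c': "c' \<in> kchains M (Suc l)" "p \<circ> kdiff s c' = 0" "y' = p \<circ> c'" "w' = kdiff s c'" by blast
    have "p \<circ> kdiff s (c - c') = 0"
      unfolding s.kdiff_diff pd[OF kM[OF c(1)] kM[OF c'(1)]] using c c' by simp
    moreover have "y - y' = p \<circ> (c - c')" "w - w' = kdiff s (c - c')"
      using c c' pd[OF c(1) c'(1)] by (simp_all add: s.kdiff_diff)
    ultimately show "(y - y', w - w') \<in> ?\<rho>" using kd[OF c(1) c'(1)] by blast
  next
    fix a y w assume a: "a \<in> \<Omega>" and "(y, w) \<in> ?\<rho>"
    then obtain c where c: "c \<in> kchains M (Suc l)" "p \<circ> kdiff s c = 0" "y = p \<circ> c" "w = kdiff s c" by blast
    have "chain_op t \<psi> a 0 = 0"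
      using ops[OF a c(1)] ops[OF a diff_closedD(1)[OF s.diff_closed_kchains[OF M]], of l]
    proof (cases a)
      case (Inl b) then show ?thesis by (simp add: chain_op_def chain_scale_def fun_eq_iff)
    next
      case (Inr \<sigma>)
      note \<sigma> = \<Omega>[OF a[unfolded Inr]]
      have "\<phi> \<sigma> 0 = 0"
        using \<sigma> by (intro additive_on_diff(2)[OF Md]) (auto simp: semilinear_on_def)
      then have "\<psi> \<sigma> 0 = 0" using \<sigma> p0 diff_closedD(1)[OF Md] by metis
      then show ?thesis by (simp add: chain_op_def Inr chain_perm_def fun_eq_iff)
    qed
    then have "p \<circ> kdiff s (chain_op s \<phi> a c) = 0"
      using ops[OF a c(1)] ops[OF a kM[OF c(1)]] c(2) by simp
    then show "(chain_op t \<psi> a y, chain_op s \<phi> a w) \<in> ?\<rho>"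
      using ops[OF a c(1)] c by (intro CollectI exI[of _ "chain_op s \<phi> a c"]) simp
  qed
qed

section \<open>Koszul homology from a free resolution\<close>

text \<open>
  The submodule generated by the multiples \<open>x\<^sub>i m\<close>, if \<open>M\<close> is a submodule: \<open>M \<otimes> k\<close> is the quotient of \<open>M\<close> by it.
\<close>

definition max_ideal_times :: "(('n::{finite,linorder}, 'k::field) mpoly \<Rightarrow> 'f::ab_group_add \<Rightarrow> 'f) \<Rightarrow> 'f set \<Rightarrow> 'f set" where
  "max_ideal_times s M = {\<Sum>i\<in>UNIV. s (var i) (f i) | f. range f \<subseteq> M}"

lemma poly_module_mult: "poly_module ((*) :: ('n::{finite,linorder}, 'k::field) mpoly \<Rightarrow> _)"
  by unfold_locales (simp_all add: algebra_simps)

context poly_module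
begin

lemma max_ideal_timesI: "range f \<subseteq> M \<Longrightarrow> (\<Sum>i\<in>UNIV. s (var i) (f i)) \<in> max_ideal_times s M"
  by (auto simp: max_ideal_times_def)

lemma max_ideal_timesE:
  assumes "x \<in> max_ideal_times s M" obtains f where "range f \<subseteq> M" "x = (\<Sum>i\<in>UNIV. s (var i) (f i))"
  using assms by (auto simp: max_ideal_times_def)

lemma var_max_ideal_times:
  assumes "subspace M" "x \<in> M"
  shows "s (var i) x \<in> max_ideal_times s M"
proof -
  have "s (var j) (if j = i then x else 0) = (if j = i then s (var i) x else 0)" for j by simp
  then have "s (var i) x = (\<Sum>j\<in>UNIV. s (var j) (if j = i then x else 0))"
    by simp
  also have "\<dots> \<in> max_ideal_times s M" using assms by (intro max_ideal_timesI) (auto simp: subspace_0)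
  finally show ?thesis .
qed

lemma max_ideal_times_subset: "subspace M \<Longrightarrow> max_ideal_times s M \<subseteq> M"
  by (auto simp: max_ideal_times_def intro!: subspace_sum subspace_scale)

lemma subspace_max_ideal_times:
  assumes M: "subspace M"
  shows "subspace (max_ideal_times s M)"
proof (rule subspaceI)
  show "0 \<in> max_ideal_times s M" using max_ideal_timesI[of "\<lambda>_. 0" M] subspace_0[OF M] by simp
next
  fix x y assume "x \<in> max_ideal_times s M" "y \<in> max_ideal_times s M"
  then obtain f g where "range f \<subseteq> M" "x = (\<Sum>i\<in>UNIV. s (var i) (f i))"
    "range g \<subseteq> M" "y = (\<Sum>i\<in>UNIV. s (var i) (g i))" by (auto elim!: max_ideal_timesE)
  then show "x + y \<in> max_ideal_times s M"
    using max_ideal_timesI[of "\<lambda>i. f i + g i" M] subspace_add[OF M]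
    by (auto simp: scale_right_distrib sum.distrib image_subset_iff)
next
  fix c x assume "x \<in> max_ideal_times s M"
  then obtain f where "range f \<subseteq> M" "x = (\<Sum>i\<in>UNIV. s (var i) (f i))" by (auto elim!: max_ideal_timesE)
  then show "s c x \<in> max_ideal_times s M"
    using max_ideal_timesI[of "\<lambda>i. s c (f i)" M] subspace_scale[OF M]
    by (auto simp: scale_sum_right image_subset_iff mult.commute)
qed

lemma subspace_linear_image:
  assumes t: "module t" and M: "subspace M" and p: "linear_on s t M p"
  shows "module.subspace t (p ` M)"
proof -
  interpret t: module t by fact
  have padd: "\<And>x y. x \<in> M \<Longrightarrow> y \<in> M \<Longrightarrow> p (x + y) = p x + p y"
    and psc: "\<And>r x. x \<in> M \<Longrightarrow> p (s r x) = t r (p x)"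
    using p by (auto simp: semilinear_on_def)
  show ?thesis
  proof (rule t.subspaceI)
    have "p 0 = 0" using psc[OF subspace_0[OF M], of 0] by simp
    then show "0 \<in> p ` M" using subspace_0[OF M] by force
  next
    fix x y assume "x \<in> p ` M" "y \<in> p ` M"
    then show "x + y \<in> p ` M" using subspace_add[OF M] by (auto simp flip: padd)
  next
    fix c x assume "x \<in> p ` M"
    then show "t c x \<in> p ` M" using subspace_scale[OF M] by (auto simp flip: psc)
  qed
qed

lemma max_ideal_times_image:
  assumes t: "poly_module t" and M: "subspace M" and p: "linear_on s t M p"
  shows "max_ideal_times t (p ` M) = p ` max_ideal_times s M"
proof -
  interpret t: poly_module t by fact
  have psum: "p (\<Sum>i\<in>UNIV. s (var i) (f i)) = (\<Sum>i\<in>UNIV. t (var i) (p (f i)))" if f: "range f \<subseteq> M" for f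
  proof -
    have fM: "f i \<in> M" for i using f by auto
    have "p (\<Sum>i\<in>UNIV. s (var i) (f i)) = (\<Sum>i\<in>UNIV. p (s (var i) (f i)))"
      using p M fM by (intro sum_image_on[of M]) (auto simp: semilinear_on_def subspace_def)
    then show ?thesis using p fM by (simp add: semilinear_on_def)
  qed
  show ?thesis
  proof (intro equalityI subsetI)
    fix x assume "x \<in> max_ideal_times t (p ` M)"
    then obtain g where g: "range g \<subseteq> p ` M" "x = (\<Sum>i\<in>UNIV. t (var i) (g i))" by (rule t.max_ideal_timesE)
    have "\<forall>i. \<exists>y\<in>M. p y = g i" using g(1) by (metis imageE rangeI subsetD)
    then obtain f where f: "\<And>i. f i \<in> M \<and> p (f i) = g i" by metis
    then have fM: "range f \<subseteq> M" by blast
    then have "x = p (\<Sum>i\<in>UNIV. s (var i) (f i))" using g(2) psum f by simp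
    then show "x \<in> p ` max_ideal_times s M" using max_ideal_timesI[OF fM] by blast
  next
    fix x assume "x \<in> p ` max_ideal_times s M"
    then obtain f where "range f \<subseteq> M" "x = p (\<Sum>i\<in>UNIV. s (var i) (f i))" by (auto elim!: max_ideal_timesE)
    then show "x \<in> max_ideal_times t (p ` M)" using psum[of f] by (auto simp: image_subset_iff intro!: t.max_ideal_timesI)
  qed
qed

lemma max_ideal_times_semilinear:
  assumes M: "subspace M" and \<sigma>: "bij \<sigma>" and \<phi>: "semilinear_on (perm_poly \<sigma>) s s M \<phi>" "\<phi> ` M \<subseteq> M"
    and x: "x \<in> max_ideal_times s M"
  shows "\<phi> x \<in> max_ideal_times s M"
proof -
  obtain f where f: "range f \<subseteq> M" "x = (\<Sum>i\<in>UNIV. s (var i) (f i))" using x by (rule max_ideal_timesE)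
  have fM: "f i \<in> M" for i using f by auto
  have "\<phi> x = (\<Sum>i\<in>UNIV. \<phi> (s (var i) (f i)))"
    unfolding f(2) using \<phi> M fM by (intro sum_image_on[of M]) (auto simp: semilinear_on_def subspace_def)
  also have "\<dots> = (\<Sum>i\<in>UNIV. s (var (\<sigma> i)) (\<phi> (f i)))"
    using \<phi> fM \<sigma> by (simp add: semilinear_on_def perm_poly_var)
  also have "\<dots> = (\<Sum>i\<in>UNIV. s (var i) (\<phi> (f (inv \<sigma> i))))"
    by (rule sum.reindex_bij_witness[of _ "inv \<sigma>" \<sigma>]) (use \<sigma> in \<open>auto simp: bij_is_inj bij_is_surj surj_f_inv_f\<close>)
  also have "\<dots> \<in> max_ideal_times s M" using \<phi>(2) fM by (intro max_ideal_timesI) auto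
  finally show ?thesis .
qed

lemma kbounds_0_iff:
  assumes M: "subspace M" and c: "c \<in> kchains M 0"
  shows "c \<in> kbounds s (kchains M) 0 \<longleftrightarrow> c {} \<in> max_ideal_times s M"
proof
  assume "c \<in> kbounds s (kchains M) 0"
  then obtain b where b: "b \<in> kchains M (Suc 0)" "c = kdiff s b" by (auto simp: kbounds_def)
  then have "c {} = (\<Sum>i\<in>UNIV. s (var i) (b {i}))" by (simp add: kdiff_def)
  also have "\<dots> \<in> max_ideal_times s M" using kchainsD(1)[OF b(1)] by (intro max_ideal_timesI) auto
  finally show "c {} \<in> max_ideal_times s M" .
next
  assume "c {} \<in> max_ideal_times s M"
  then obtain f where f: "range f \<subseteq> M" "c {} = (\<Sum>i\<in>UNIV. s (var i) (f i))" by (rule max_ideal_timesE)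
  define b where "b \<tau> = (if card \<tau> = 1 then f (the_elem \<tau>) else 0)" for \<tau>
  have b: "b \<in> kchains M (Suc 0)" using f(1) subspace_0[OF M] by (intro kchainsI) (auto simp: b_def)
  have "kdiff s b \<tau> = c \<tau>" for \<tau>
  proof (cases "\<tau> = {}")
    case True then show ?thesis using f(2) by (simp add: kdiff_def b_def)
  next
    case False
    then have "card \<tau> \<noteq> 0" by simp
    then show ?thesis using kchainsD(2)[OF c] kchainsD(2)[OF kdiff_kchains[OF M b]] by metis
  qed
  then have "kdiff s b = c" by (simp add: fun_eq_iff)
  then show "c \<in> kbounds s (kchains M) 0" using b unfolding kbounds_def by blast
qed

end

text \<open>
  Relates \<open>p M \<otimes> k\<close>, which is the Koszul homology of \<open>p M\<close> in degree \<open>0\<close>, to \<open>M \<otimes> k\<close> modulo the kernel of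
  \<open>p\<close>. The choice \<open>T = UNIV\<close> gives Tor in degree \<open>0\<close>. In the last dimension shift, \<open>T\<close> is \<open>max_ideal_times\<close> of
  the module in which \<open>p M\<close> lies, and the elements in question are the cycles of \<open>F \<otimes> k\<close>.
\<close>

lemma degree_zero_iso:
  fixes s :: "('n::{finite,linorder}, 'k::field) mpoly \<Rightarrow> 'f::ab_group_add \<Rightarrow> 'f"
    and t :: "('n, 'k) mpoly \<Rightarrow> 'g::ab_group_add \<Rightarrow> 'g"
  assumes "poly_module s" "poly_module t"
    and M: "module.subspace s M" and p: "linear_on s t M p"
    and \<Omega>: "\<And>\<sigma>. Inr \<sigma> \<in> \<Omega> \<Longrightarrow> bij \<sigma> \<and> semilinear_on (perm_poly \<sigma>) s s M (\<phi> \<sigma>) \<and>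
      \<phi> \<sigma> ` M \<subseteq> M \<and> (\<forall>x\<in>M. p (\<phi> \<sigma> x) = \<psi> \<sigma> (p x))"
    and T: "diff_closed T" "\<And>a x. a \<in> \<Omega> \<Longrightarrow> x \<in> T \<Longrightarrow> module_op t \<psi> a x \<in> T"
  shows "subquot_iso \<Omega> (chain_op t \<psi>) {w \<in> kchains (p ` M) 0. w {} \<in> T} (kbounds t (kchains (p ` M)) 0)
    (module_op s \<phi>) {x \<in> M. p x \<in> T} {k + m | k m. k \<in> M \<and> p k = 0 \<and> m \<in> max_ideal_times s M}"
proof -
  interpret s: poly_module s by fact
  interpret t: poly_module t by fact
  note Md = s.diff_closed_subspace[OF M]
  have padd: "\<And>x y. x \<in> M \<Longrightarrow> y \<in> M \<Longrightarrow> p (x + y) = p x + p y"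
    and psc: "\<And>r x. x \<in> M \<Longrightarrow> p (s r x) = t r (p x)"
    using p by (auto simp: semilinear_on_def)
  note pdiff = additive_on_diff(1)[OF Md padd] and p0 = additive_on_diff(2)[OF Md padd]
  have pM: "t.subspace (p ` M)" using s.subspace_linear_image[OF t.module_axioms M p] .
  let ?\<rho> = "{(w :: 'n set \<Rightarrow> 'g, x). w \<in> kchains (p ` M) 0 \<and> x \<in> M \<and> p x = w {} \<and> p x \<in> T}"
  show ?thesis
  proof (rule subquot_isoI[of ?\<rho>])
    fix w :: "'n set \<Rightarrow> 'g" assume "w \<in> {w \<in> kchains (p ` M) 0. w {} \<in> T}"
    then show "\<exists>x. (w, x) \<in> ?\<rho>" using kchainsD(1)[of w "p ` M" 0 "{}"] by force
  next
    fix x assume x: "x \<in> {x \<in> M. p x \<in> T}"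
    have "(\<lambda>\<tau>. if \<tau> = {} then p x else 0) \<in> kchains (p ` M) 0"
      using x t.subspace_0[OF pM] by (intro kchainsI) auto
    then show "\<exists>w. (w, x) \<in> ?\<rho>" using x by (intro exI[of _ "\<lambda>\<tau>. if \<tau> = {} then p x else 0"]) auto
  next
    fix w x w' x' assume "(w, x) \<in> ?\<rho>" "(w', x') \<in> ?\<rho>"
    then show "(w - w', x - x') \<in> ?\<rho>"
      using diff_closedD(2)[OF t.diff_closed_kchains[OF pM]] diff_closedD(2)[OF Md] diff_closedD(2)[OF T(1)]
      by (auto simp: pdiff)
  next
    fix a w x assume a: "a \<in> \<Omega>" and wx: "(w, x) \<in> ?\<rho>"
    show "(chain_op t \<psi> a w, module_op s \<phi> a x) \<in> ?\<rho>"
    proof (cases a)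
      case (Inl b)
      then show ?thesis using wx T(2)[OF a] t.chain_scale_kchains[OF pM] s.subspace_scale[OF M]
        by (auto simp: chain_op_def module_op_def psc chain_scale_def)
    next
      case (Inr \<sigma>)
      note \<sigma> = \<Omega>[OF a[unfolded Inr]]
      have img: "\<psi> \<sigma> ` p ` M \<subseteq> p ` M"
      proof
        fix y assume "y \<in> \<psi> \<sigma> ` p ` M"
        then obtain x where "x \<in> M" "y = \<psi> \<sigma> (p x)" by blast
        then show "y \<in> p ` M" using \<sigma> by (metis image_subset_iff imageI)
      qed
      have "\<phi> \<sigma> 0 = 0"
        using \<sigma> by (intro additive_on_diff(2)[OF Md]) (auto simp: semilinear_on_def)
      then have "\<psi> \<sigma> 0 = 0" using \<sigma> p0 diff_closedD(1)[OF Md] by metis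
      then have "chain_perm t \<sigma> (\<psi> \<sigma>) w \<in> kchains (p ` M) 0"
        using t.chain_perm_kchains[OF pM _ img] \<sigma> wx by blast
      moreover have "\<psi> \<sigma> (p x) \<in> T" using T(2)[OF a, of "p x"] wx by (auto simp: module_op_def Inr)
      moreover have "chain_perm t \<sigma> (\<psi> \<sigma>) w {} = \<psi> \<sigma> (w {})" by (simp add: chain_perm_def)
      ultimately show ?thesis using wx \<sigma> by (auto simp: chain_op_def module_op_def Inr)
    qed
  next
    fix w x assume wx: "(w, x) \<in> ?\<rho>"
    then have "w \<in> kbounds t (kchains (p ` M)) 0 \<longleftrightarrow> p x \<in> p ` max_ideal_times s M"
      using t.kbounds_0_iff[OF pM, of w] s.max_ideal_times_image[OF \<open>poly_module t\<close> M p] by auto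
    also have "\<dots> \<longleftrightarrow> x \<in> {k + m | k m. k \<in> M \<and> p k = 0 \<and> m \<in> max_ideal_times s M}"
    proof
      assume "p x \<in> p ` max_ideal_times s M"
      then obtain m where m: "m \<in> max_ideal_times s M" "p x = p m" by blast
      then have "m \<in> M" using s.max_ideal_times_subset[OF M] by blast
      then show "x \<in> {k + m | k m. k \<in> M \<and> p k = 0 \<and> m \<in> max_ideal_times s M}"
        using wx m diff_closedD(2)[OF Md, of x m] pdiff[of x m]
        by (intro CollectI exI[of _ "x - m"] exI[of _ m]) auto
    next
      assume "x \<in> {k + m | k m. k \<in> M \<and> p k = 0 \<and> m \<in> max_ideal_times s M}"
      then show "p x \<in> p ` max_ideal_times s M" using s.max_ideal_times_subset[OF M] by (auto simp: padd subset_iff)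
    qed
    finally show "w \<in> kbounds t (kchains (p ` M)) 0 \<longleftrightarrow>
      x \<in> {k + m | k m. k \<in> M \<and> p k = 0 \<and> m \<in> max_ideal_times s M}" .
  qed (auto simp: module_op_def)
qed

text \<open>
  Cycles and boundaries of \<open>F \<otimes> k\<close>, described by representatives in \<open>F\<close>.
\<close>

definition res_cycles :: "(('n::{finite,linorder}, 'k::field) mpoly \<Rightarrow> 'f::ab_group_add \<Rightarrow> 'f) \<Rightarrow>
    (nat \<Rightarrow> 'f set) \<Rightarrow> (nat \<Rightarrow> 'f \<Rightarrow> 'f) \<Rightarrow> nat \<Rightarrow> 'f set" where
  "res_cycles s F d i = {x \<in> F i. case i of 0 \<Rightarrow> True | Suc j \<Rightarrow> d j x \<in> max_ideal_times s (F j)}"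

definition res_boundaries :: "(('n::{finite,linorder}, 'k::field) mpoly \<Rightarrow> 'f::ab_group_add \<Rightarrow> 'f) \<Rightarrow>
    (nat \<Rightarrow> 'f set) \<Rightarrow> (nat \<Rightarrow> 'f \<Rightarrow> 'f) \<Rightarrow> nat \<Rightarrow> 'f set" where
  "res_boundaries s F d i = {k + m | k m. k \<in> d i ` F (Suc i) \<and> m \<in> max_ideal_times s (F i)}"

text \<open>
  Degree \<open>l + 1\<close> of the ideal is shifted to degree \<open>l\<close> of the first syzygy module, then along the
  resolution to degree \<open>0\<close> of the \<open>(l + 1)\<close>-st one, and there it is homology of \<open>F \<otimes> k\<close>. The lifts \<open>\<phi> \<sigma>\<close>
  commute with the differentials, hence with every shift.
\<close>

theorem koszul_homology_resolution:
  fixes s :: "('n::{finite,linorder}, 'k::field) mpoly \<Rightarrow> 'f::ab_group_add \<Rightarrow> 'f"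
  assumes res: "free_resolution (*) I s F d e"
    and \<Omega>: "\<And>\<sigma>. Inr \<sigma> \<in> \<Omega> \<Longrightarrow> bij \<sigma> \<and> perm_lift s F d e \<sigma> (\<phi> \<sigma>)"
  shows "subquot_iso \<Omega> (chain_op (*) perm_poly) (kcycles (*) (kchains I) i) (kbounds (*) (kchains I) i)
    (module_op s (\<lambda>\<sigma>. \<phi> \<sigma> i)) (res_cycles s F d i) (res_boundaries s F d i)"
proof -
  have pm: "poly_module s" using res by (simp add: poly_module_def free_resolution_def)
  interpret s: poly_module s by fact
  interpret R: poly_module "(*) :: ('n, 'k) mpoly \<Rightarrow> _" by (rule poly_module_mult)
  have free: "free_submodule s (F j)" and d: "linear_on s s (F (Suc j)) (d j)"
    and e: "linear_on s (*) (F 0) e" "e ` F 0 = I"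
    and ker: "{x \<in> F 0. e x = 0} = d 0 ` F (Suc 0)"
    "{x \<in> F (Suc j). d j x = 0} = d (Suc j) ` F (Suc (Suc j))" for j
    using res by (auto simp: free_resolution_def)
  have sub: "s.subspace (F j)" for j
    using free[of j] unfolding free_submodule_def by (metis s.subspace_span)
  have \<Omega>': "bij \<sigma> \<and> semilinear_on (perm_poly \<sigma>) s s (F j) (\<phi> \<sigma> j) \<and> \<phi> \<sigma> j ` F j \<subseteq> F j"
    "\<forall>x\<in>F (Suc j). d j (\<phi> \<sigma> (Suc j) x) = \<phi> \<sigma> j (d j x)"
    "\<forall>x\<in>F 0. e (\<phi> \<sigma> 0 x) = perm_poly \<sigma> (e x)" if "Inr \<sigma> \<in> \<Omega>" for j \<sigma>
    using \<Omega>[OF that] by (auto simp: perm_lift_def)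
  let ?N = "\<lambda>j. d j ` F (Suc j)"
  have subN: "s.subspace (?N j)" "?N j \<subseteq> F j" for j
  proof -
    have "?N j = {x \<in> F j. (case j of 0 \<Rightarrow> e x = 0 | Suc k \<Rightarrow> d k x = 0)}"
      by (cases j) (use ker in auto)
    then show "?N j \<subseteq> F j" by blast
    show "s.subspace (?N j)"
      using s.subspace_linear_image[OF s.module_axioms sub d] .
  qed
  let ?W = "\<lambda>j l. kcycles s (kchains (?N j)) l \<inter> kbounds s (kchains (F j)) l"
  let ?B = "\<lambda>j l. kbounds s (kchains (?N j)) l"
  \<comment> \<open>For positive degree, every Koszul cycle of a syzygy module is a boundary in the free module around it.\<close>
  have step: "subquot_iso \<Omega> (chain_op s (\<lambda>\<sigma>. \<phi> \<sigma> j)) (?W j (Suc l)) (?B j (Suc l))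
      (chain_op s (\<lambda>\<sigma>. \<phi> \<sigma> (Suc j))) (?W (Suc j) l) (?B (Suc j) l)" for j l
  proof -
    have "kcycles s (kchains (?N j)) (Suc l) \<subseteq> kcycles s (kchains (F j)) (Suc l)"
      using subN(2)[of j] by (auto simp: kcycles_def kchains_def)
    then have "?W j (Suc l) = kcycles s (kchains (?N j)) (Suc l)"
      using s.koszul_exact[OF sub free, of j l] by blast
    then show ?thesis
      using dimension_shift[OF pm pm sub free d[of j], of \<Omega> "\<lambda>\<sigma>. \<phi> \<sigma> (Suc j)" "\<lambda>\<sigma>. \<phi> \<sigma> j" l] \<Omega>'
      by (simp add: ker)
  qed
  have last: "subquot_iso \<Omega> (chain_op s (\<lambda>\<sigma>. \<phi> \<sigma> j)) (?W j 0) (?B j 0)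
      (module_op s (\<lambda>\<sigma>. \<phi> \<sigma> (Suc j))) (res_cycles s F d (Suc j)) (res_boundaries s F d (Suc j))" for j
  proof -
    have "?W j 0 = {w \<in> kchains (?N j) 0. w {} \<in> max_ideal_times s (F j)}"
    proof -
      have "w \<in> kchains (F j) 0" if "w \<in> kchains (?N j) 0" for w
        using that subN(2)[of j] by (auto simp: kchains_def)
      then show ?thesis
        using s.kbounds_0_iff[OF sub] s.kdiff_kchains_0 by (auto simp: kcycles_def)
    qed
    moreover have "module_op s (\<lambda>\<sigma>. \<phi> \<sigma> j) a x \<in> max_ideal_times s (F j)" if a: "a \<in> \<Omega>" and x: "x \<in> max_ideal_times s (F j)" for a x
    proof (cases a)
      case (Inl b) then show ?thesis using s.subspace_scale[OF s.subspace_max_ideal_times[OF sub] x] by (simp add: module_op_def)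
    next
      case (Inr \<sigma>)
      then show ?thesis using s.max_ideal_times_semilinear[OF sub _ _ _ x, of \<sigma> "\<phi> \<sigma> j"] \<Omega>'(1)[of \<sigma> j] a by (simp add: module_op_def)
    qed
    ultimately show ?thesis
      using degree_zero_iso[OF pm pm sub d[of j] _ s.diff_closed_subspace[OF s.subspace_max_ideal_times[OF sub[of j]]],
          of \<Omega> "\<lambda>\<sigma>. \<phi> \<sigma> (Suc j)" "\<lambda>\<sigma>. \<phi> \<sigma> j"] \<Omega>'
      by (simp add: res_cycles_def res_boundaries_def ker[symmetric] conj_ac)
  qed
  show ?thesis
  proof (cases i)
    case 0
    have "kcycles (*) (kchains I) 0 = kchains I 0" by (auto simp: kcycles_def R.kdiff_kchains_0)
    then show ?thesis
      using degree_zero_iso[OF pm poly_module_mult sub e(1), of \<Omega> "\<lambda>\<sigma>. \<phi> \<sigma> 0" perm_poly UNIV] \<Omega>'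
      by (simp add: res_cycles_def res_boundaries_def ker[symmetric] conj_ac e(2) 0 diff_closed_def)
  next
    case (Suc l)
    have "subquot_iso \<Omega> (chain_op s (\<lambda>\<sigma>. \<phi> \<sigma> j)) (?W j l) (?B j l)
      (module_op s (\<lambda>\<sigma>. \<phi> \<sigma> (Suc (j + l)))) (res_cycles s F d (Suc (j + l))) (res_boundaries s F d (Suc (j + l)))" for j
    proof (induct l arbitrary: j)
      case 0 then show ?case using last by simp
    next
      case (Suc l) show ?case using subquot_iso_trans[OF step Suc[of "Suc j"]] by simp
    qed
    from subquot_iso_trans[OF _ this[of 0]] show ?thesis
      using dimension_shift[OF pm poly_module_mult sub free e(1), of \<Omega> "\<lambda>\<sigma>. \<phi> \<sigma> 0" perm_poly l] \<Omega>'
      by (simp add: ker e Suc)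
  qed
qed

section \<open>Tor as a subquotient of the resolution\<close>

lemma coset_eq_iff:
  assumes B: "diff_closed B"
  shows "a +o B = b +o B \<longleftrightarrow> a - b \<in> B"
proof
  assume eq: "a +o B = b +o B"
  have "a + 0 \<in> a +o B" using diff_closedD(1)[OF B] by (rule set_plus_intro2)
  then obtain c where "c \<in> B" "a = b + c" unfolding eq by (auto simp: elt_set_plus_def)
  then show "a - b \<in> B" by simp
next
  assume ab: "a - b \<in> B"
  have "x +o B \<subseteq> y +o B" if xy: "x - y \<in> B" for x y
  proof
    fix z assume "z \<in> x +o B"
    then obtain c where c: "c \<in> B" "z = x + c" by (auto simp: elt_set_plus_def)
    then have "z = y + ((x - y) + c)" by simp
    then show "z \<in> y +o B" using diff_closedD(4)[OF B xy c(1)] unfolding elt_set_plus_def by blast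
  qed
  from this[OF ab] this[of b a] show "a +o B = b +o B"
    using diff_closedD(3)[OF B ab] by simp
qed

lemma diff_closed_cong:
  assumes A: "diff_closed A" and ab: "a - b \<in> A"
  shows "a \<in> A \<longleftrightarrow> b \<in> A"
  using diff_closedD(4)[OF A ab, of b] diff_closedD(2)[OF A _ ab, of a] by auto

lemma set_plus_diff_closed:
  assumes B: "diff_closed B"
  shows "B + B = B"
proof (intro equalityI subsetI)
  fix x assume "x \<in> B + B" then show "x \<in> B" using diff_closedD(4)[OF B] by (auto simp: set_plus_def)
next
  fix x assume "x \<in> B"
  then have "x + 0 \<in> B + B" using diff_closedD(1)[OF B] by (rule set_plus_intro)
  then show "x \<in> B + B" by simp
qed

lemma coset_plus: "diff_closed B \<Longrightarrow> (a +o B) + (b +o B) = (a + b) +o (B :: 'a::ab_group_add set)"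
  by (simp add: set_plus_rearrange set_plus_diff_closed)

lemma quot_map_coset:
  assumes B: "0 \<in> B" and B': "diff_closed B'" and f: "\<And>x. f (a + x) = f a + f x" "f 0 = 0" "f ` B \<subseteq> B'"
  shows "quot_map f B' (a +o B) = f a +o (B' :: 'a::ab_group_add set)"
proof (intro equalityI subsetI)
  fix z assume "z \<in> quot_map f B' (a +o B)"
  then obtain b c where "b \<in> B" "c \<in> B'" "z = f a + (f b + c)"
    by (auto simp: quot_map_def elt_set_plus_def set_plus_def f add.assoc)
  then show "z \<in> f a +o B'" using f(3) diff_closedD(4)[OF B', of "f b" c] by (auto simp: elt_set_plus_def)
next
  fix z assume "z \<in> f a +o B'"
  then obtain c where c: "c \<in> B'" "z = f a + c" by (auto simp: elt_set_plus_def)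
  have "a + 0 \<in> a +o B" using B by (rule set_plus_intro2)
  then have "f a \<in> f ` (a +o B)" using f(1)[of 0] by (metis add.right_neutral f(2) imageI)
  then show "z \<in> quot_map f B' (a +o B)" unfolding quot_map_def c(2) using c(1) by (rule set_plus_intro)
qed

interpretation frag: module "frag_cmul :: int \<Rightarrow> ('a \<Rightarrow>\<^sub>0 int) \<Rightarrow> _" by (rule module_frag_cmul)

lemma poly_mapping_sum_single: "p = (\<Sum>a\<in>keys p. Poly_Mapping.single a (lookup p a))"
proof (rule poly_mapping_eqI)
  fix b
  have "(\<Sum>a\<in>keys p. lookup p a when a = b) = lookup p b"
    by (cases "b \<in> keys p") (auto simp: when_def not_in_keys_iff_lookup_eq_zero)
  then show "lookup p b =
    lookup (\<Sum>a\<in>keys p. Poly_Mapping.single a (lookup p a)) b"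
    by (simp add: lookup_sum lookup_single)
qed

context poly_module
begin

text \<open>
  A polynomial without constant term is a combination of monomials, each divisible by a variable.
\<close>

lemma scale_max_ideal_times:
  assumes M: "subspace M" and x: "x \<in> M" and q: "lookup q 0 = 0"
  shows "s q x \<in> max_ideal_times s M"
proof -
  have "s (Poly_Mapping.single a (lookup q a)) x \<in> max_ideal_times s M" if "a \<in> keys q" for a
  proof -
    have "a \<noteq> 0" using that q by auto
    then obtain i where i: "lookup a i > 0"
      by (metis gr0I lookup_zero poly_mapping_eqI)
    have "var i * Poly_Mapping.single (a - Poly_Mapping.single i 1) (lookup q a) =
        Poly_Mapping.single a (lookup q a)"
      using exp_add_minus_single[OF i] by (simp add: var_def mmonom_def mult_single)
    then show ?thesis using var_max_ideal_times[OF M subspace_scale[OF M x]] by (metis scale_scale)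
  qed
  then have "(\<Sum>a\<in>keys q. s (Poly_Mapping.single a (lookup q a)) x) \<in> max_ideal_times s M"
    by (rule subspace_sum[OF subspace_max_ideal_times[OF M]])
  then show ?thesis using poly_mapping_sum_single[of q] by (simp flip: scale_sum_left)
qed

abbreviation rel :: "'f set \<Rightarrow> ('f \<times> 'k \<Rightarrow>\<^sub>0 int) set" where
  "rel M \<equiv> tensor_rel s M (res_scale :: _ \<Rightarrow> 'k \<Rightarrow> 'k)"

text \<open>
  The element \<open>x \<otimes> 1\<close>.
\<close>

definition tensor_class :: "'f set \<Rightarrow> 'f \<Rightarrow> ('f \<times> 'k \<Rightarrow>\<^sub>0 int) set" where
  "tensor_class M x = frag_of (x, 1) +o rel M"

lemma diff_closed_rel: "diff_closed (rel M)"
  unfolding tensor_rel_def by (rule frag.diff_closed_subspace) simp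

lemma rel_add: "x \<in> M \<Longrightarrow> y \<in> M \<Longrightarrow> frag_of (x + y, n) - frag_of (x, n) - frag_of (y, n) \<in> rel M"
  unfolding tensor_rel_def by (intro frag.span_base) blast

lemma rel_add_right: "x \<in> M \<Longrightarrow> frag_of (x, n + n') - frag_of (x, n) - frag_of (x, n') \<in> rel M"
  unfolding tensor_rel_def by (intro frag.span_base) blast

lemma rel_scale: "x \<in> M \<Longrightarrow> frag_of (s r x, n) - frag_of (x, res_scale r n) \<in> rel M"
  unfolding tensor_rel_def by (intro frag.span_base) blast

lemma rel_mconst: "x \<in> M \<Longrightarrow> frag_of (x, c) - frag_of (s (mconst c) x, 1) \<in> rel M"
  using rel_scale[of x M "mconst c" 1] diff_closedD(3)[OF diff_closed_rel]
  by (fastforce simp: res_scale_def mconst_def)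

lemma rel_diff:
  assumes M: "subspace M" and "x \<in> M" "y \<in> M"
  shows "frag_of (x, n) - frag_of (y, n) - frag_of (x - y, n) \<in> rel M"
  using rel_add[of y M "x - y" n] assms subspace_diff[OF M] by simp

lemma rel_zero:
  shows "0 \<in> M \<Longrightarrow> frag_of (0, n) \<in> rel M" and "x \<in> M \<Longrightarrow> frag_of (x, 0) \<in> rel M"
  using rel_add[of 0 M 0 n] rel_add_right[of x M 0 0] diff_closedD(3)[OF diff_closed_rel, of _ M] by fastforce+

text \<open>
  The module \<open>k\<close> is generated by \<open>1\<close>, so every tensor has the form \<open>x \<otimes> 1\<close>.
\<close>

lemma tensor_reduce:
  assumes M: "subspace M" and u: "keys u \<subseteq> M \<times> UNIV"
  shows "\<exists>x\<in>M. u - frag_of (x, 1) \<in> rel M"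
  using u
proof (induct u rule: frag_induction)
  case zero
  show ?case using rel_zero(1)[of M 1] subspace_0[OF M] diff_closedD(3)[OF diff_closed_rel]
    by (intro bexI[of _ 0]) auto
next
  case (one q)
  then obtain x c where q: "q = (x, c)" "x \<in> M" by auto
  then show ?case using rel_mconst[of x M c] subspace_scale[OF M] by blast
next
  case (diff a b)
  then obtain x y where xy: "x \<in> M" "a - frag_of (x, 1) \<in> rel M" "y \<in> M" "b - frag_of (y, 1) \<in> rel M" by blast
  have "a - b - frag_of (x - y, 1) =
      (a - frag_of (x, 1)) - (b - frag_of (y, 1)) + (frag_of (x, 1) - frag_of (y, 1) - frag_of (x - y, 1))"
    by simp
  also have "\<dots> \<in> rel M"
    using diff_closedD(2,4)[OF diff_closed_rel] rel_diff[OF M xy(1,3)] xy by metis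
  finally show ?case using subspace_diff[OF M xy(1,3)] by blast
qed

text \<open>
  The sum of the \<open>c x\<close> over the terms \<open>x \<otimes> c\<close>. It maps the tensor relations into \<open>max_ideal_times s M\<close>, which
  shows that no other element \<open>x \<otimes> 1\<close> vanishes.
\<close>

definition evaluate :: "('f \<times> 'k \<Rightarrow>\<^sub>0 int) \<Rightarrow> 'f" where
  "evaluate u = (\<Sum>q\<in>keys u. s (of_int (lookup u q)) (s (mconst (snd q)) (fst q)))"

lemma evaluate_superset:
  assumes "finite A" "keys u \<subseteq> A"
  shows "evaluate u = (\<Sum>q\<in>A. s (of_int (lookup u q)) (s (mconst (snd q)) (fst q)))"
  unfolding evaluate_def using assms
  by (intro sum.mono_neutral_left) (auto simp: not_in_keys_iff_lookup_eq_zero)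

lemma evaluate_add: "evaluate (u + v) = evaluate u + evaluate v"
proof -
  let ?A = "keys u \<union> keys v"
  have "keys (u + v) \<subseteq> ?A" by (rule keys_add)
  then show ?thesis
    by (subst (1 2 3) evaluate_superset[of ?A]) (auto simp: lookup_add distrib_right scale_left_distrib sum.distrib)
qed

lemma evaluate_cmul: "evaluate (frag_cmul c u) = s (of_int c) (evaluate u)"
proof -
  have "keys (frag_cmul c u) \<subseteq> keys u" by (rule keys_cmul)
  then show ?thesis
    by (subst evaluate_superset[of "keys u"])
      (auto simp: evaluate_def scale_sum_right mult.assoc)
qed

lemma evaluate_diff: "evaluate (u - v) = evaluate u - evaluate v"
  using evaluate_add[of "u - v" v] by simp

lemma evaluate_of: "evaluate (frag_of (x, c)) = s (mconst c) x"
  by (simp add: evaluate_def)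

lemma evaluate_rel:
  assumes M: "subspace M" and u: "u \<in> rel M"
  shows "evaluate u \<in> max_ideal_times s M"
proof -
  note max_ideal_times = subspace_max_ideal_times[OF M]
  have "rel M \<subseteq> {u. evaluate u \<in> max_ideal_times s M}"
    unfolding tensor_rel_def
  proof (rule frag.span_minimal)
    have "evaluate 0 = 0" by (simp add: evaluate_def)
    then show "frag.subspace {u. evaluate u \<in> max_ideal_times s M}"
      using max_ideal_times by (auto simp: frag.subspace_def evaluate_add evaluate_cmul subspace_def)
  next
    have "s (mconst n) (s r x) - s (mconst (res_scale r n)) x \<in> max_ideal_times s M" if "x \<in> M" for r n x
    proof -
      have "mconst n * (r - mconst (lookup r 0)) = mconst n * r - mconst (res_scale r n)"
        by (simp add: right_diff_distrib mconst_mult res_scale_def mult.commute)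
      then have "s (mconst n) (s r x) - s (mconst (res_scale r n)) x =
          s (mconst n) (s (r - mconst (lookup r 0)) x)"
        by (simp flip: scale_left_diff_distrib)
      also have "\<dots> \<in> max_ideal_times s M"
        by (intro subspace_scale[OF max_ideal_times] scale_max_ideal_times[OF M that]) (simp add: lookup_minus mconst_def)
      finally show ?thesis .
    qed
    then show "{frag_of (x + y, n) - frag_of (x, n) - frag_of (y, n) | x y n. x \<in> M \<and> y \<in> M} \<union>
      {frag_of (x, n + n') - frag_of (x, n) - frag_of (x, n') | x n n'. x \<in> M} \<union>
      {frag_of (s r x, n) - frag_of (x, res_scale r n) | r x n. x \<in> M} \<subseteq> {u. evaluate u \<in> max_ideal_times s M}"
      using subspace_0[OF max_ideal_times]
      by (auto simp: evaluate_diff evaluate_of scale_right_distrib mconst_add scale_left_distrib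
          simp del: scale_scale)
  qed
  then show ?thesis using u by blast
qed

lemma frag_of_rel_iff:
  assumes M: "subspace M" and x: "x \<in> M"
  shows "frag_of (x, 1) \<in> rel M \<longleftrightarrow> x \<in> max_ideal_times s M"
proof
  assume "frag_of (x, 1) \<in> rel M"
  then show "x \<in> max_ideal_times s M" using evaluate_rel[OF M] by (fastforce simp: evaluate_of)
next
  assume "x \<in> max_ideal_times s M"
  then obtain f where f: "range f \<subseteq> M" "x = (\<Sum>i\<in>UNIV. s (var i) (f i))" by (rule max_ideal_timesE)
  have "(\<Sum>i\<in>A. s (var i) (f i)) \<in> M \<and> frag_of (\<Sum>i\<in>A. s (var i) (f i), 1) \<in> rel M" for A
    using finite[of A]
  proof (induct A)
    case empty then show ?case using rel_zero(1)[of M 1] subspace_0[OF M] by simp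
  next
    case (insert i A)
    have fi: "f i \<in> M" and sfi: "s (var i) (f i) \<in> M" using f(1) subspace_scale[OF M] by auto
    have "res_scale (var i) 1 = (0 :: 'k)"
      by (simp add: res_scale_def var_def mmonom_def lookup_single when_def)
        (metis lookup_single_eq lookup_zero zero_neq_one One_nat_def)
    then have "frag_of (s (var i) (f i), 1) \<in> rel M"
      using diff_closedD(4)[OF diff_closed_rel rel_scale[OF fi, of "var i" 1] rel_zero(2)[OF fi]] by simp
    moreover define y where "y = (\<Sum>i\<in>A. s (var i) (f i))"
    moreover have y: "y \<in> M" "frag_of (y, 1) \<in> rel M" using insert(3) by (auto simp: y_def)
    moreover have "frag_of (s (var i) (f i) + y, 1) - frag_of (s (var i) (f i), 1) - frag_of (y, 1) \<in> rel M"
      by (rule rel_add[OF sfi y(1)])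
    ultimately have "frag_of (s (var i) (f i) + y, 1) \<in> rel M"
      using diff_closedD(4)[OF diff_closed_rel diff_closedD(4)[OF diff_closed_rel]] by fastforce
    then have "frag_of (\<Sum>i\<in>insert i A. s (var i) (f i), 1) \<in> rel M" using insert by (simp add: y_def)
    then show ?case using insert sfi subspace_add[OF M] by simp
  qed
  then show "frag_of (x, 1) \<in> rel M" unfolding f(2) by blast
qed

lemma tensor_class_eq_iff:
  assumes M: "subspace M" and "x \<in> M" "y \<in> M"
  shows "tensor_class M x = tensor_class M y \<longleftrightarrow> x - y \<in> max_ideal_times s M"
proof -
  have "frag_of (x, 1) - frag_of (y, 1) \<in> rel M \<longleftrightarrow> frag_of (x - y, 1) \<in> rel M"
    by (rule diff_closed_cong[OF diff_closed_rel rel_diff[OF assms]])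
  then show ?thesis
    unfolding tensor_class_def coset_eq_iff[OF diff_closed_rel] using frag_of_rel_iff[OF M] subspace_diff[OF assms] by simp
qed

lemma tensor_class_add:
  assumes M: "subspace M" and "x \<in> M" "y \<in> M"
  shows "tensor_class M x + tensor_class M y = tensor_class M (x + y)"
  unfolding tensor_class_def coset_plus[OF diff_closed_rel] coset_eq_iff[OF diff_closed_rel]
  using diff_closedD(3)[OF diff_closed_rel rel_add[OF assms(2,3), of 1]] by (simp add: algebra_simps)

lemma tensor_eq: "subspace M \<Longrightarrow> tensor s M res_scale = tensor_class M ` M"
proof (intro equalityI subsetI)
  fix X assume M: "subspace M" and "X \<in> tensor s M res_scale"
  then obtain u where u: "keys u \<subseteq> M \<times> UNIV" "X = u +o rel M"
    by (auto simp: tensor_def quot_def)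
  obtain x where "x \<in> M" "u - frag_of (x, 1) \<in> rel M" using tensor_reduce[OF M u(1)] by blast
  then show "X \<in> tensor_class M ` M"
    using u(2) coset_eq_iff[OF diff_closed_rel, of u M "frag_of (x, 1)"] by (auto simp: tensor_class_def)
next
  fix X assume "X \<in> tensor_class M ` M"
  then obtain x where "x \<in> M" "X = frag_of (x, 1) +o rel M" by (auto simp: tensor_class_def)
  then show "X \<in> tensor s M res_scale"
    unfolding tensor_def quot_def by (intro image_eqI[of _ _ "frag_of (x, 1)"]) auto
qed

lemma tensor_map_tensor_class:
  assumes M: "subspace M" and f: "\<And>x y. x \<in> M \<Longrightarrow> y \<in> M \<Longrightarrow> f (x + y) = f x + f y"
    "\<And>r x. x \<in> M \<Longrightarrow> f (s r x) = s (\<tau> r) (f x)" "f ` M \<subseteq> M'"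
    and g: "\<And>n n'. g (n + n') = g n + g n'" "\<And>r n. g (res_scale r n) = res_scale (\<tau> r) (g n)"
  shows "tensor_map s M' res_scale f g (frag_of (x, c) +o rel M) = frag_of (f x, g c) +o rel M'"
proof -
  let ?E = "frag_extend (\<lambda>(x, n). frag_of (f x, g n))"
  have "frag.subspace {u. ?E u \<in> rel M'}"
    by (auto simp: frag.subspace_def frag_extend_add frag_extend_cmul tensor_rel_def
        intro: frag.span_add frag.span_scale frag.span_zero)
  then have "rel M \<subseteq> {u. ?E u \<in> rel M'}"
    unfolding tensor_rel_def[of s M]
  proof (rule frag.span_minimal[rotated])
    show "{frag_of (x + y, n) - frag_of (x, n) - frag_of (y, n) | x y n. x \<in> M \<and> y \<in> M} \<union>
      {frag_of (x, n + n') - frag_of (x, n) - frag_of (x, n') | x n n'. x \<in> M} \<union>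
      {frag_of (s r x, n) - frag_of (x, res_scale r n) | r x n. x \<in> M} \<subseteq> {u. ?E u \<in> rel M'}"
      by (auto simp: frag_extend_diff f(1,2) g intro!: rel_add rel_add_right rel_scale subsetD[OF f(3)])
  qed
  then show ?thesis
    unfolding tensor_map_def
    using quot_map_coset[of "rel M" "rel M'" ?E "frag_of (x, c)"] diff_closedD(1)[OF diff_closed_rel] diff_closed_rel
    by (auto simp: frag_extend_add)
qed

lemma tensor_map_semilinear:
  assumes M: "subspace M" and f: "semilinear_on \<tau> s s M f" "f ` M \<subseteq> M'"
    and \<tau>: "\<And>r. lookup (\<tau> r) 0 = lookup r 0"
  shows "tensor_map s M' res_scale f id (tensor_class M x) = tensor_class M' (f x)"
  unfolding tensor_class_def
  using f \<tau> by (subst tensor_map_tensor_class[OF M, of f \<tau>]) (auto simp: semilinear_on_def res_scale_def)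

lemma tensor_map_scale:
  assumes M: "subspace M" and x: "x \<in> M"
  shows "tensor_map s M res_scale id (res_scale (mconst c)) (tensor_class M x) = tensor_class M (s (mconst c) x)"
proof -
  have "tensor_map s M res_scale id (res_scale (mconst c)) (tensor_class M x) = frag_of (x, c) +o rel M"
    unfolding tensor_class_def
    by (subst tensor_map_tensor_class[OF M, of id "\<lambda>r. r"]) (auto simp: res_scale_def mconst_def distrib_left)
  then show ?thesis
    using rel_mconst[OF x, of c] coset_eq_iff[OF diff_closed_rel] unfolding tensor_class_def by metis
qed

end

text \<open>
  The part of the structure of a resolution on which the formation of Tor depends.
\<close>

locale module_sequence = poly_module s
  for s :: "('n::{finite,linorder}, 'k::field) mpoly \<Rightarrow> 'f::ab_group_add \<Rightarrow> 'f" +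
  fixes F :: "nat \<Rightarrow> 'f set" and d :: "nat \<Rightarrow> 'f \<Rightarrow> 'f"
  assumes subF: "\<And>i. subspace (F i)" and lin: "\<And>i. linear_on s s (F (Suc i)) (d i)"
    and into: "\<And>i. d i ` F (Suc i) \<subseteq> F i"
begin

text \<open>
  The class of \<open>x \<otimes> 1\<close> modulo boundaries, spelled out as a set of cosets.
\<close>

definition tor_class :: "nat \<Rightarrow> 'f \<Rightarrow> ('f \<times> 'k \<Rightarrow>\<^sub>0 int) set set" where
  "tor_class i x = {tensor_class (F i) (x + d i b) | b. b \<in> F (Suc i)}"

lemma tor_diff_tensor_class: "x \<in> F (Suc i) \<Longrightarrow> tor_diff s F d res_scale i (tensor_class (F (Suc i)) x) = tensor_class (F i) (d i x)"
  unfolding tor_diff_def by (rule tensor_map_semilinear[OF subF lin into]) simp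

lemma tor_boundaries_eq: "tor_boundaries s F d res_scale i = {tensor_class (F i) (d i b) | b. b \<in> F (Suc i)}"
  unfolding tor_boundaries_def tensor_eq[OF subF] by (auto simp: tor_diff_tensor_class image_iff)

lemma differential_into: "b \<in> F (Suc i) \<Longrightarrow> d i b \<in> F i" using into by blast

lemma d_add: "x \<in> F (Suc i) \<Longrightarrow> y \<in> F (Suc i) \<Longrightarrow> d i (x + y) = d i x + d i y"
  using lin by (auto simp: semilinear_on_def)

lemma tor_class_coset: "x \<in> F i \<Longrightarrow> tensor_class (F i) x +o tor_boundaries s F d res_scale i = tor_class i x"
  unfolding tor_boundaries_eq tor_class_def elt_set_plus_def using tensor_class_add[OF subF] differential_into by blast

lemma tor_cycles_eq: "tor_cycles s F d res_scale i = tensor_class (F i) ` res_cycles s F d i"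
proof (cases i)
  case 0 then show ?thesis by (simp add: tensor_eq[OF subF] res_cycles_def)
next
  case (Suc j)
  have "tor_diff s F d res_scale j (tensor_class (F (Suc j)) x) = rel (F j) \<longleftrightarrow> d j x \<in> max_ideal_times s (F j)"
    if x: "x \<in> F (Suc j)" for x
  proof -
    have "rel (F j) = 0 +o rel (F j)" by simp
    then show ?thesis
      using frag_of_rel_iff[OF subF differential_into[OF x]] coset_eq_iff[OF diff_closed_rel, of _ "F j" 0]
      unfolding tor_diff_tensor_class[OF x] unfolding tensor_class_def by simp
  qed
  then show ?thesis by (auto simp: Suc tensor_eq[OF subF] res_cycles_def)
qed

lemma tor_eq: "tor s F d res_scale i = tor_class i ` res_cycles s F d i"
  unfolding tor_def quot_def tor_cycles_eq image_image
  by (intro image_cong refl tor_class_coset) (simp add: res_cycles_def)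

lemma tor_class_eq_iff:
  assumes "x \<in> F i" "y \<in> F i"
  shows "tor_class i x = tor_class i y \<longleftrightarrow> x - y \<in> res_boundaries s F d i"
proof
  assume eq: "tor_class i x = tor_class i y"
  have d0: "d i 0 = 0" using d_add[OF subspace_0[OF subF] subspace_0[OF subF]] by simp
  then have "tensor_class (F i) x \<in> tor_class i x"
    unfolding tor_class_def using subspace_0[OF subF] by (intro CollectI exI[of _ 0]) simp
  then obtain b where b: "b \<in> F (Suc i)" "tensor_class (F i) x = tensor_class (F i) (y + d i b)"
    unfolding eq by (auto simp: tor_class_def)
  then have "x - (y + d i b) \<in> max_ideal_times s (F i)"
    using tensor_class_eq_iff[OF subF assms(1)] subspace_add[OF subF assms(2) differential_into[OF b(1)]] by blast
  then show "x - y \<in> res_boundaries s F d i"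
    unfolding res_boundaries_def using b(1)
    by (intro CollectI exI[of _ "d i b"] exI[of _ "x - (y + d i b)"]) auto
next
  have *: "tor_class i x \<subseteq> tor_class i y" if xy: "x - y \<in> res_boundaries s F d i" "x \<in> F i" "y \<in> F i" for x y
  proof
    fix X assume "X \<in> tor_class i x"
    then obtain b where b: "b \<in> F (Suc i)" "X = tensor_class (F i) (x + d i b)" by (auto simp: tor_class_def)
    obtain c m where c: "c \<in> F (Suc i)" "m \<in> max_ideal_times s (F i)" "x - y = d i c + m"
      using xy(1) by (auto simp: res_boundaries_def)
    have "X = tensor_class (F i) (y + d i (c + b))"
      unfolding b(2)
    proof (subst tensor_class_eq_iff[OF subF])
      show "x + d i b \<in> F i" "y + d i (c + b) \<in> F i"
        using xy b c subspace_add[OF subF] differential_into by auto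
      have "x + d i b - (y + d i (c + b)) = m" using c b by (simp add: d_add algebra_simps)
      then show "x + d i b - (y + d i (c + b)) \<in> max_ideal_times s (F i)" using c by simp
    qed
    then show "X \<in> tor_class i y" using subspace_add[OF subF c(1) b(1)] by (auto simp: tor_class_def)
  qed
  assume xy: "x - y \<in> res_boundaries s F d i"
  then obtain c m where c: "c \<in> F (Suc i)" "m \<in> max_ideal_times s (F i)" "x - y = d i c + m"
    by (auto simp: res_boundaries_def)
  have "d i (- c) = - d i c" using d_add[of c i "- c"] subspace_neg[OF subF c(1)] c(1)
      d_add[OF subspace_0[OF subF] subspace_0[OF subF], of i] by (simp add: eq_neg_iff_add_eq_0 add.commute)
  then have "y - x = d i (- c) + - m" using c(3) by (simp add: algebra_simps)
  then have "y - x \<in> res_boundaries s F d i"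
    using subspace_neg[OF subF c(1)] subspace_neg[OF subspace_max_ideal_times[OF subF] c(2)] unfolding res_boundaries_def by blast
  then show "tor_class i x = tor_class i y" using * xy assms by blast
qed

lemma tor_class_add:
  assumes x: "x \<in> F i" and y: "y \<in> F i"
  shows "tor_class i x + tor_class i y = tor_class i (x + y)"
proof (intro equalityI subsetI)
  fix X assume "X \<in> tor_class i x + tor_class i y"
  then obtain b c where b: "b \<in> F (Suc i)" "c \<in> F (Suc i)" "X = tensor_class (F i) (x + d i b) + tensor_class (F i) (y + d i c)"
    by (auto simp: tor_class_def set_plus_def)
  then have "X = tensor_class (F i) (x + y + d i (b + c))"
    using tensor_class_add[OF subF subspace_add[OF subF x differential_into] subspace_add[OF subF y differential_into]] by (simp add: d_add algebra_simps)
  then show "X \<in> tor_class i (x + y)" using subspace_add[OF subF b(1,2)] by (auto simp: tor_class_def)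
next
  fix X assume "X \<in> tor_class i (x + y)"
  then obtain b where b: "b \<in> F (Suc i)" "X = tensor_class (F i) (x + y + d i b)" by (auto simp: tor_class_def)
  have d0: "d i 0 = 0" using d_add[OF subspace_0[OF subF] subspace_0[OF subF]] by simp
  have "X = tensor_class (F i) (x + d i b) + tensor_class (F i) (y + d i 0)"
    using tensor_class_add[OF subF subspace_add[OF subF x differential_into[OF b(1)]] y] b(2) by (simp add: d0 algebra_simps)
  then show "X \<in> tor_class i x + tor_class i y"
    using b(1) subspace_0[OF subF, of "Suc i"] unfolding tor_class_def set_plus_def by blast
qed

text \<open>
  Scalars act through the second tensor factor and permutations through the first. Both amount to
  a map \<open>h\<close> of representatives \<open>x \<otimes> 1\<close> that preserves the image of the differential.
\<close>

lemma tor_map_tor_class: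
  assumes f: "\<And>y. y \<in> F i \<Longrightarrow> tensor_map s (F i) res_scale f g (tensor_class (F i) y) = tensor_class (F i) (h y)"
    and h: "\<And>x y. x \<in> F i \<Longrightarrow> y \<in> F i \<Longrightarrow> h (x + y) = h x + h y" "h ` F i \<subseteq> F i"
      "\<And>b. b \<in> F (Suc i) \<Longrightarrow> h (d i b) \<in> d i ` F (Suc i)"
    and x: "x \<in> F i"
  shows "tor_map s F d res_scale i f g (tor_class i x) = tor_class i (h x)"
proof (intro equalityI subsetI)
  have hx: "h x \<in> F i" using h(2) x by blast
  fix X
  {
    assume "X \<in> tor_map s F d res_scale i f g (tor_class i x)"
    then obtain b c where b: "b \<in> F (Suc i)" "c \<in> F (Suc i)"
      "X = tensor_map s (F i) res_scale f g (tensor_class (F i) (x + d i b)) + tensor_class (F i) (d i c)"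
      unfolding tor_map_def quot_map_def tor_boundaries_eq tor_class_def set_plus_def by blast
    obtain b' where b': "b' \<in> F (Suc i)" "h (d i b) = d i b'" using h(3)[OF b(1)] by blast
    have "X = tensor_class (F i) (h x + d i b') + tensor_class (F i) (d i c)"
      unfolding b(3) f[OF subspace_add[OF subF x differential_into[OF b(1)]]] using h(1)[OF x differential_into[OF b(1)]] b' by simp
    then have "X = tensor_class (F i) (h x + d i (b' + c))"
      using tensor_class_add[OF subF subspace_add[OF subF hx differential_into[OF b'(1)]] differential_into[OF b(2)]] b(2) b'(1)
      by (simp add: d_add add.assoc)
    then show "X \<in> tor_class i (h x)" using subspace_add[OF subF b'(1) b(2)] by (auto simp: tor_class_def)
  next
    assume "X \<in> tor_class i (h x)"
    then obtain b where b: "b \<in> F (Suc i)" "X = tensor_class (F i) (h x + d i b)" by (auto simp: tor_class_def)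
    have d0: "d i 0 = 0" using d_add[OF subspace_0[OF subF] subspace_0[OF subF]] by simp
    have "X = tensor_map s (F i) res_scale f g (tensor_class (F i) (x + d i 0)) + tensor_class (F i) (d i b)"
      using f[OF x] tensor_class_add[OF subF hx differential_into[OF b(1)]] b by (simp add: d0)
    then show "X \<in> tor_map s F d res_scale i f g (tor_class i x)"
      unfolding tor_map_def quot_map_def tor_boundaries_eq tor_class_def set_plus_def
      using b(1) subspace_0[OF subF, of "Suc i"] by blast
  }
qed

lemma tor_scale_tor_class:
  assumes x: "x \<in> F i"
  shows "tor_scale s F d res_scale i (mconst c) (tor_class i x) = tor_class i (s (mconst c) x)"
  unfolding tor_scale_def
proof (rule tor_map_tor_class[OF _ _ _ _ x])
  show "s (mconst c) (d i b) \<in> d i ` F (Suc i)" if "b \<in> F (Suc i)" for b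
    using lin[of i] that subspace_scale[OF subF that, of "mconst c"] by (auto simp: semilinear_on_def image_iff) metis
  show "tensor_map s (F i) res_scale id (res_scale (mconst c)) (tensor_class (F i) y) =
      tensor_class (F i) (s (mconst c) y)" if "y \<in> F i" for y
    by (rule tensor_map_scale[OF subF that])
qed (auto simp: scale_right_distrib subspace_scale[OF subF])

lemma tor_map_perm_tor_class:
  assumes \<sigma>: "bij \<sigma>" and \<phi>: "perm_lift s F d e \<sigma> \<phi>" and x: "x \<in> F i"
  shows "tor_map s F d res_scale i (\<phi> i) id (tor_class i x) = tor_class i (\<phi> i x)"
proof (rule tor_map_tor_class[OF _ _ _ _ x])
  have c: "lookup (perm_poly \<sigma> r) 0 = lookup r 0" for r :: "('n, 'k) mpoly"
    using \<sigma> by (simp add: lookup_perm_poly_inv bij_imp_bij_inv)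
  show "tensor_map s (F i) res_scale (\<phi> i) id (tensor_class (F i) y) = tensor_class (F i) (\<phi> i y)" for y
    using \<phi> by (intro tensor_map_semilinear[OF subF _ _ c]) (auto simp: perm_lift_def)
qed (use \<phi> in \<open>auto simp: perm_lift_def semilinear_on_def\<close>)

end

lemma module_sequence_free_resolution:
  assumes "free_resolution (*) I s F d e"
  shows "module_sequence s F d"
proof -
  have pm: "poly_module s" using assms by (simp add: poly_module_def free_resolution_def)
  interpret poly_module s by fact
  show ?thesis
  proof
    show "subspace (F i)" for i
      using assms unfolding free_resolution_def free_submodule_def by (metis subspace_span)
    show "linear_on s s (F (Suc i)) (d i)" for i using assms by (simp add: free_resolution_def)
    show "d i ` F (Suc i) \<subseteq> F i" for i
      using assms unfolding free_resolution_def by (cases i) blast+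
  qed
qed

lemma tor_invariants_eq:
  assumes res: "free_resolution (*) I s F d e" and lift: "\<And>\<sigma>. bij \<sigma> \<Longrightarrow> perm_lift s F d e \<sigma> (\<phi> \<sigma>)"
  shows "tor_invariants s F d \<phi> i = module_sequence.tor_class s F d i `
    {x \<in> res_cycles s F d i. \<forall>\<sigma>. bij \<sigma> \<longrightarrow> \<phi> \<sigma> i x - x \<in> res_boundaries s F d i}"
proof -
  interpret module_sequence s F d by (rule module_sequence_free_resolution[OF res])
  have "tor_map s F d res_scale i (\<phi> \<sigma> i) id (tor_class i x) = tor_class i x \<longleftrightarrow> \<phi> \<sigma> i x - x \<in> res_boundaries s F d i"
    if \<sigma>: "bij \<sigma>" and x: "x \<in> res_cycles s F d i" for \<sigma> x
  proof -
    have xF: "x \<in> F i" using x by (simp add: res_cycles_def)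
    moreover have "\<phi> \<sigma> i x \<in> F i" using lift[OF \<sigma>] xF by (auto simp: perm_lift_def)
    ultimately show ?thesis
      using tor_map_perm_tor_class[OF \<sigma> lift[OF \<sigma>] xF] tor_class_eq_iff by simp
  qed
  then show ?thesis unfolding tor_invariants_def tor_eq by auto
qed

text \<open>
  Passage from relations between representatives to a map between the sets that define Tor.
\<close>

lemma vs_isomorphic_tor:
  fixes sF :: "('n::{finite,linorder}, 'k::field) mpoly \<Rightarrow> 'f::ab_group_add \<Rightarrow> 'f"
    and sG :: "('n, 'k) mpoly \<Rightarrow> 'g::ab_group_add \<Rightarrow> 'g"
  assumes "module_sequence sF F dF" "module_sequence sG G dG" and W: "W \<subseteq> F i"
    and iso: "subquot_iso (range Inl) (module_op sF \<phi>) W (res_boundaries sF F dF i) (module_op sG \<psi>) (res_cycles sG G dG i) (res_boundaries sG G dG i)"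
  shows "vs_isomorphic (\<lambda>c. tor_scale sF F dF res_scale i (mconst c)) (module_sequence.tor_class sF F dF i ` W)
     (\<lambda>c. tor_scale sG G dG res_scale i (mconst c)) (tor sG G dG res_scale i)"
proof -
  interpret F: module_sequence sF F dF by fact
  interpret G: module_sequence sG G dG by fact
  obtain \<rho> where "subquot_corr (range Inl) (module_op sF \<phi>) W (res_boundaries sF F dF i) (module_op sG \<psi>) (res_cycles sG G dG i) (res_boundaries sG G dG i) \<rho>"
    using iso by (auto simp: subquot_iso_def)
  note \<rho> = subquot_corrD[OF this]
  have inF: "x \<in> F i" and inG: "x' \<in> G i" if "(x, x') \<in> \<rho>" for x x'
    using that \<rho>(1,2) W by (auto simp: res_cycles_def)
  have same: "F.tor_class i x = F.tor_class i y \<longleftrightarrow> G.tor_class i x' = G.tor_class i y'" if "(x, x') \<in> \<rho>" "(y, y') \<in> \<rho>" for x x' y y'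
    using F.tor_class_eq_iff[OF inF inF] G.tor_class_eq_iff[OF inG inG] that \<rho>(7)[OF \<rho>(5)[OF that]] by blast
  define h where "h X = (SOME Y. \<exists>(x, x')\<in>\<rho>. X = F.tor_class i x \<and> Y = G.tor_class i x')" for X
  have h: "h (F.tor_class i x) = G.tor_class i x'" if "(x, x') \<in> \<rho>" for x x'
    unfolding h_def by (rule some_equality) (use that same in blast)+
  have "bij_betw h (F.tor_class i ` W) (tor sG G dG res_scale i)"
    unfolding bij_betw_def
  proof
    show "inj_on h (F.tor_class i ` W)"
    proof (rule inj_onI)
      fix X Y assume XY: "X \<in> F.tor_class i ` W" "Y \<in> F.tor_class i ` W" and eq: "h X = h Y"
      obtain x y where xy: "x \<in> W" "X = F.tor_class i x" "y \<in> W" "Y = F.tor_class i y" using XY by blast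
      then obtain x' y' where "(x, x') \<in> \<rho>" "(y, y') \<in> \<rho>"
        using \<rho>(3) by blast
      then show "X = Y" using eq h same xy by metis
    qed
    show "h ` F.tor_class i ` W = tor sG G dG res_scale i"
      unfolding G.tor_eq
    proof (intro equalityI subsetI)
      fix Y assume "Y \<in> h ` F.tor_class i ` W"
      then obtain x where x: "x \<in> W" "Y = h (F.tor_class i x)" by blast
      then obtain x' where "(x, x') \<in> \<rho>" using \<rho>(3) by blast
      then show "Y \<in> G.tor_class i ` res_cycles sG G dG i" using h x \<rho>(2) by blast
    next
      fix Y assume "Y \<in> G.tor_class i ` res_cycles sG G dG i"
      then obtain x' where x': "x' \<in> res_cycles sG G dG i" "Y = G.tor_class i x'" by blast
      then obtain x where "(x, x') \<in> \<rho>" using \<rho>(4) by blast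
      then show "Y \<in> h ` F.tor_class i ` W" using h[of x x'] x' \<rho>(1) by (metis imageI)
    qed
  qed
  moreover have "h (X + Y) = h X + h Y" if XY: "X \<in> F.tor_class i ` W" "Y \<in> F.tor_class i ` W" for X Y
  proof -
    obtain x x' y y' where xy: "(x, x') \<in> \<rho>" "X = F.tor_class i x" "(y, y') \<in> \<rho>" "Y = F.tor_class i y"
      using XY \<rho>(3) by blast
    have "(0 - y, 0 - y') \<in> \<rho>" using \<rho>(5)[OF \<rho>(5)[OF xy(3,3)] xy(3)] by simp
    from \<rho>(5)[OF xy(1) this] have "(x + y, x' + y') \<in> \<rho>" by simp
    then show ?thesis
      using xy h F.tor_class_add[OF inF inF] G.tor_class_add[OF inG inG] by metis
  qed
  moreover have "h (tor_scale sF F dF res_scale i (mconst c) X) = tor_scale sG G dG res_scale i (mconst c) (h X)"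
    if X: "X \<in> F.tor_class i ` W" for c X
  proof -
    obtain x x' where x: "(x, x') \<in> \<rho>" "X = F.tor_class i x" using X \<rho>(3) by blast
    have "(sF (mconst c) x, sG (mconst c) x') \<in> \<rho>"
      using \<rho>(6)[OF _ x(1), of "Inl c"] by (simp add: module_op_def)
    then show ?thesis
      using F.tor_scale_tor_class[OF inF[OF x(1)]] G.tor_scale_tor_class[OF inG[OF x(1)]] h x by metis
  qed
  ultimately show ?thesis
    unfolding vs_isomorphic_def semilinear_on_def by (intro exI[of _ h]) simp
qed

section \<open>Monomial ideals\<close>

interpretation R: poly_module "(*) :: ('n::{finite,linorder}, 'k::field) mpoly \<Rightarrow> _"
  by (rule poly_module_mult)

abbreviation (input) unit_exp :: "'n \<Rightarrow> ('n \<Rightarrow>\<^sub>0 nat)" where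
  "unit_exp i \<equiv> Poly_Mapping.single i 1"

text \<open>
  The exponents of the monomials in the ideal generated by the \<open>x\<^sup>a\<close> for \<open>a \<in> L\<close>.
\<close>

definition exp_ideal :: "('n \<Rightarrow>\<^sub>0 nat) set \<Rightarrow> ('n \<Rightarrow>\<^sub>0 nat) set" where
  "exp_ideal L = {m. \<exists>a\<in>L. \<forall>i. lookup a i \<le> lookup m i}"

lemma mono_ideal_eq: "mono_ideal L = {p :: ('n::{finite,linorder}, 'k::field) mpoly. keys p \<subseteq> exp_ideal L}"
proof (intro equalityI subsetI)
  fix p :: "('n, 'k) mpoly" assume "p \<in> mono_ideal L"
  moreover have "R.span (mmonom ` L) \<subseteq> {p :: ('n, 'k) mpoly. keys p \<subseteq> exp_ideal L}"
  proof (rule R.span_minimal)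
    show "mmonom ` L \<subseteq> {p :: ('n, 'k) mpoly. keys p \<subseteq> exp_ideal L}"
      by (auto simp: mmonom_def exp_ideal_def)
    show "R.subspace {p :: ('n, 'k) mpoly. keys p \<subseteq> exp_ideal L}"
    proof (rule R.subspaceI)
      fix p q :: "('n, 'k) mpoly"
      assume *: "p \<in> {p. keys p \<subseteq> exp_ideal L}"
      show "q * p \<in> {p. keys p \<subseteq> exp_ideal L}"
      proof (intro CollectI subsetI)
        fix m assume "m \<in> keys (q * p)"
        then obtain b a where "m = b + a" "a \<in> keys p" using keys_mult[of q p] by auto
        moreover from this obtain l where "l \<in> L" "\<forall>i. lookup l i \<le> lookup a i"
          using * by (auto simp: exp_ideal_def)
        ultimately show "m \<in> exp_ideal L"
          by (auto simp: exp_ideal_def lookup_add intro!: bexI[of _ l] trans_le_add2)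
      qed
    next
      fix p q :: "('n, 'k) mpoly"
      assume "p \<in> {p. keys p \<subseteq> exp_ideal L}" "q \<in> {p. keys p \<subseteq> exp_ideal L}"
      then show "p + q \<in> {p. keys p \<subseteq> exp_ideal L}" using keys_add[of p q] by auto
    qed simp
  qed
  ultimately show "p \<in> {p. keys p \<subseteq> exp_ideal L}" by (auto simp: mono_ideal_def ideal_gen_def)
next
  fix p :: "('n, 'k) mpoly" assume "p \<in> {p. keys p \<subseteq> exp_ideal L}"
  then have p: "keys p \<subseteq> exp_ideal L" by simp
  have "Poly_Mapping.single m c \<in> R.span (mmonom ` L :: ('n, 'k) mpoly set)" if m: "m \<in> keys p" for m and c :: 'k
  proof -
    obtain a where a: "a \<in> L" "\<forall>i. lookup a i \<le> lookup m i"
      using p m by (auto simp: exp_ideal_def)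
    have "(m - a) + a = m" using a(2) by (intro poly_mapping_eqI) (simp add: lookup_add lookup_minus)
    then have "Poly_Mapping.single m c = Poly_Mapping.single (m - a) c * mmonom a"
      by (simp add: mmonom_def mult_single)
    then show ?thesis using a(1) by (metis R.span_base R.span_scale imageI)
  qed
  then have "(\<Sum>a\<in>keys p. Poly_Mapping.single a (lookup p a)) \<in> R.span (mmonom ` L)"
    by (intro R.span_sum)
  then show "p \<in> mono_ideal L"
    using poly_mapping_sum_single[of p] by (simp add: mono_ideal_def ideal_gen_def)
qed

lemma sym_ideal_eq_mono_ideal:
  "(sym_ideal L :: ('n::{finite,linorder}, 'k::field) mpoly set) = mono_ideal {perm_exp \<sigma> a | \<sigma> a. bij \<sigma> \<and> a \<in> L}"
proof -
  have "({perm_poly \<sigma> (mmonom a) | \<sigma> a. bij \<sigma> \<and> a \<in> L} :: ('n, 'k) mpoly set) = {mmonom (perm_exp \<sigma> a) | \<sigma> a. bij \<sigma> \<and> a \<in> L}"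
    using perm_poly_mmonom by metis
  also have "\<dots> = mmonom ` {perm_exp \<sigma> a | \<sigma> a. bij \<sigma> \<and> a \<in> L}" by blast
  finally have "({perm_poly \<sigma> (mmonom a) | \<sigma> a. bij \<sigma> \<and> a \<in> L} :: ('n, 'k) mpoly set) = mmonom ` {perm_exp \<sigma> a | \<sigma> a. bij \<sigma> \<and> a \<in> L}" .
  then show ?thesis unfolding sym_ideal_def mono_ideal_def by simp
qed

lemma exp_ideal_add: "m \<in> exp_ideal L \<Longrightarrow> b + m \<in> exp_ideal L"
  by (auto simp: exp_ideal_def lookup_add intro!: trans_le_add2)

text \<open>
  If a partition \<open>a\<close> lies below \<open>e\<^sub>j + m\<close>, then \<open>a\<^sub>j \<le> a\<^sub>i \<le> m\<^sub>i \<le> m\<^sub>j\<close>, so \<open>a\<close> lies below \<open>m\<close> already. This is where the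
  generators of the ordinary monomial ideal have to be partitions.
\<close>

lemma exp_ideal_down:
  fixes L :: "('n::{finite,linorder} \<Rightarrow>\<^sub>0 nat) set"
  assumes L: "L \<subseteq> partitions" and ij: "i < j" and m: "unit_exp j + m \<in> exp_ideal L"
    and le: "lookup m i \<le> lookup m j"
  shows "m \<in> exp_ideal L"
proof -
  obtain a where a: "a \<in> L" "\<And>k. lookup a k \<le> lookup (unit_exp j + m) k"
    using m by (auto simp: exp_ideal_def)
  have "lookup a k \<le> lookup m k" for k
  proof (cases "k = j")
    case True
    have "lookup a j \<le> lookup a i"
      using L a(1) ij by (auto simp: partitions_def antimono_def)
    also have "\<dots> \<le> lookup m i" using a(2)[of i] ij by (simp add: lookup_add lookup_single)
    finally show ?thesis using le True by simp
  next
    case False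
    then show ?thesis using a(2)[of k] by (simp add: lookup_add lookup_single)
  qed
  then show ?thesis using a(1) by (auto simp: exp_ideal_def)
qed

section \<open>Koszul chains with prescribed support\<close>

text \<open>
  Chains spanned by the basis elements \<open>x\<^sup>m e\<^sub>\<tau>\<close> with \<open>Q m \<tau>\<close>.
\<close>

definition supp_chains :: "(('n \<Rightarrow>\<^sub>0 nat) \<Rightarrow> 'n set \<Rightarrow> bool) \<Rightarrow> nat \<Rightarrow> ('n set \<Rightarrow> ('n, 'k::zero) mpoly) set" where
  "supp_chains Q l = {c. \<forall>\<tau>. (card \<tau> \<noteq> l \<longrightarrow> c \<tau> = 0) \<and> (\<forall>m\<in>keys (c \<tau>). Q m \<tau>)}"

lemma supp_chainsI:
  "(\<And>\<tau>. card \<tau> \<noteq> l \<Longrightarrow> c \<tau> = 0) \<Longrightarrow> (\<And>\<tau> m. lookup (c \<tau>) m \<noteq> 0 \<Longrightarrow> Q m \<tau>) \<Longrightarrow> c \<in> supp_chains Q l"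
  by (simp add: supp_chains_def in_keys_iff)

lemma supp_chainsD:
  assumes "c \<in> supp_chains Q l"
  shows "card \<tau> \<noteq> l \<Longrightarrow> c \<tau> = 0" "lookup (c \<tau>) m \<noteq> 0 \<Longrightarrow> Q m \<tau>"
  using assms by (auto simp: supp_chains_def in_keys_iff)

lemma supp_chains_mono: "(\<And>m \<tau>. Q m \<tau> \<Longrightarrow> Q' m \<tau>) \<Longrightarrow> supp_chains Q l \<subseteq> supp_chains Q' l"
  by (auto simp: supp_chains_def)

lemma diff_closed_supp_chains: "diff_closed (supp_chains Q l :: ('n set \<Rightarrow> ('n, 'k::comm_ring_1) mpoly) set)"
  unfolding diff_closed_def
proof (intro conjI ballI)
  show "0 \<in> supp_chains Q l" by (rule supp_chainsI) auto
  fix c c' :: "'n set \<Rightarrow> ('n, 'k) mpoly" assume "c \<in> supp_chains Q l" "c' \<in> supp_chains Q l"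
  note c = supp_chainsD[OF this(1)] and c' = supp_chainsD[OF this(2)]
  show "c - c' \<in> supp_chains Q l"
  proof (rule supp_chainsI)
    fix \<tau> m assume "lookup ((c - c') \<tau>) m \<noteq> 0"
    then have "lookup (c \<tau>) m \<noteq> 0 \<or> lookup (c' \<tau>) m \<noteq> 0" by (auto simp: lookup_minus)
    then show "Q m \<tau>" using c(2) c'(2) by blast
  qed (simp add: c c')
qed

lemma chain_scale_supp_chains:
  fixes c :: "'n set \<Rightarrow> ('n, 'k::field) mpoly"
  assumes c: "c \<in> supp_chains Q l" shows "chain_scale (*) a c \<in> supp_chains Q l"
  by (rule supp_chainsI) (auto simp: chain_scale_def lookup_mconst_mult supp_chainsD[OF c])

lemma chain_scale_kcycles:
  fixes c :: "'n::{finite,linorder} set \<Rightarrow> ('n, 'k::field) mpoly"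
  assumes "c \<in> kcycles (*) (supp_chains Q) l"
  shows "chain_scale (*) a c \<in> kcycles (*) (supp_chains Q) l"
proof -
  have "chain_scale (*) a 0 = (0 :: 'n set \<Rightarrow> ('n, 'k) mpoly)" by (rule ext) (simp add: chain_scale_def)
  then show ?thesis using assms chain_scale_supp_chains[of c Q l a] by (simp add: kcycles_def R.kdiff_chain_scale)
qed

lemma lookup_kdiff:
  fixes c :: "'n::{finite,linorder} set \<Rightarrow> ('n, 'k::field) mpoly"
  shows "lookup (kdiff (*) c \<tau>) m = (\<Sum>i\<in>-\<tau>. insert_sign i \<tau> *
    (if lookup m i > 0 then lookup (c (insert i \<tau>)) (m - unit_exp i) else 0))"
  unfolding kdiff_def by (simp only: lookup_sum mult.assoc lookup_mconst_mult lookup_var_mult)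

lemma kdiff_supp_chains:
  fixes c :: "'n::{finite,linorder} set \<Rightarrow> ('n, 'k::field) mpoly"
  assumes c: "c \<in> supp_chains Q (Suc l)" and Q: "\<And>m i \<tau>. i \<notin> \<tau> \<Longrightarrow> Q m (insert i \<tau>) \<Longrightarrow> Q (unit_exp i + m) \<tau>"
  shows "kdiff (*) c \<in> supp_chains Q l"
proof (rule supp_chainsI)
  fix \<tau> :: "'n set" assume "card \<tau> \<noteq> l"
  then have "c (insert i \<tau>) = 0" if "i \<in> - \<tau>" for i using that by (intro supp_chainsD(1)[OF c]) simp
  then show "kdiff (*) c \<tau> = 0" unfolding kdiff_def by (intro sum.neutral) simp
next
  fix \<tau> m assume "lookup (kdiff (*) c \<tau>) m \<noteq> 0"
  then obtain i where i: "i \<notin> \<tau>" "lookup m i > 0"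
      "lookup (c (insert i \<tau>)) (m - unit_exp i) \<noteq> 0"
    unfolding lookup_kdiff by (auto elim!: sum.not_neutral_contains_not_neutral split: if_splits)
  then have "Q (unit_exp i + (m - unit_exp i)) \<tau>" using Q supp_chainsD(2)[OF c i(3)] by blast
  then show "Q m \<tau>" unfolding exp_add_minus_single[OF i(2)] .
qed

lemma kchains_monomial: "kchains {p. keys p \<subseteq> U} = supp_chains (\<lambda>m \<tau>. m \<in> U)"
  by (auto simp: kchains_def supp_chains_def fun_eq_iff)

section \<open>Deformation onto multidegrees with strict descents\<close>

text \<open>
  The number \<open>m\<^sub>j + [j \<in> \<tau>]\<close> is the component at \<open>j\<close> of the multidegree of \<open>x\<^sup>m e\<^sub>\<tau>\<close>, which the differential
  preserves.
\<close>

definition descent_fails :: "'n::linorder \<Rightarrow> ('n \<Rightarrow>\<^sub>0 nat) \<Rightarrow> 'n set \<Rightarrow> bool" where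
  "descent_fails j m \<tau> \<longleftrightarrow> (\<exists>i<j. lookup m i < lookup m j + of_bool (j \<in> \<tau>))"

text \<open>
  Inserts \<open>j\<close> into \<open>\<tau>\<close> and divides by \<open>x\<^sub>j\<close>, that is, keeps the multidegree, but only on basis elements where
  descent fails at \<open>j\<close>.
\<close>

definition descent_contract :: "'n::linorder \<Rightarrow> ('n set \<Rightarrow> ('n, 'k::comm_ring_1) mpoly) \<Rightarrow> 'n set \<Rightarrow> ('n, 'k) mpoly" where
  "descent_contract j c \<tau> = (if j \<in> \<tau> then Poly_Mapping.mapp (\<lambda>m v. if descent_fails j m \<tau> then insert_sign j (\<tau> - {j}) * v else 0)
     (divide_var j (c (\<tau> - {j}))) else 0)"

lemma lookup_descent_contract:
  "lookup (descent_contract j c \<tau>) m = (if j \<in> \<tau> \<and> descent_fails j m \<tau>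
     then insert_sign j (\<tau> - {j}) * lookup (c (\<tau> - {j})) (unit_exp j + m) else 0)"
  by (auto simp: descent_contract_def lookup_mapp lookup_divide_var when_def in_keys_iff)

text \<open>
  Moving a factor between \<open>x\<^sub>j\<close> and \<open>e\<^sub>j\<close> changes neither multidegrees nor exponents below \<open>j\<close>. In particular
  variables \<open>v < j\<close> that were treated before \<open>j\<close> are not affected.
\<close>

lemma descent_fails_move:
  assumes v: "v \<le> j" and j: "j \<notin> \<tau>"
  shows "descent_fails v m (insert j \<tau>) \<longleftrightarrow> descent_fails v (unit_exp j + m) \<tau>"
proof -
  have "lookup (unit_exp j + m) v + of_bool (v \<in> \<tau>) =
      lookup m v + of_bool (v \<in> insert j \<tau>)"
    using j by (auto simp: lookup_add lookup_single when_def)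
  moreover have "lookup (unit_exp j + m) k = lookup m k" if "k < v" for k
    using that v by (auto simp: lookup_add lookup_single when_def)
  ultimately show ?thesis unfolding descent_fails_def by (simp cong: conj_cong)
qed

text \<open>
  The differential raises exponents at fixed multidegree, so it cannot destroy descent.
\<close>

lemma descent_fails_kdiff:
  assumes i: "i \<notin> \<tau>" and "descent_fails v (unit_exp i + m) \<tau>"
  shows "descent_fails v m (insert i \<tau>)"
proof -
  obtain k where k: "k < v" "lookup (unit_exp i + m) k <
      lookup (unit_exp i + m) v + of_bool (v \<in> \<tau>)"
    using assms(2) by (auto simp: descent_fails_def)
  have "lookup (unit_exp i + m) v + of_bool (v \<in> \<tau>) =
      lookup m v + of_bool (v \<in> insert i \<tau>)"
    using i by (auto simp: lookup_add lookup_single when_def)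
  moreover have "lookup m k \<le> lookup (unit_exp i + m) k"
    by (simp add: lookup_add)
  ultimately show ?thesis using k unfolding descent_fails_def by (metis le_less_trans)
qed

text \<open>
  On elements where descent fails at \<open>j\<close>, the differential in direction \<open>j\<close> and the contraction are mutually
  inverse, and the other directions anticommute with the contraction. All terms that enter the coefficient
  at \<open>x\<^sup>m e\<^sub>\<tau>\<close> come from elements where descent fails at \<open>j\<close> as well, by the previous lemma.
\<close>

lemma descent_contract_homotopy:
  fixes c :: "'n::{finite,linorder} set \<Rightarrow> ('n, 'k::field) mpoly"
  assumes descent_fails: "descent_fails j m \<tau>"
  shows "lookup ((c - kdiff (*) (descent_contract j c) - descent_contract j (kdiff (*) c)) \<tau>) m = 0"
proof (cases "j \<in> \<tau>")
  case False
  have mj: "lookup m j > 0" using descent_fails False by (auto simp: descent_fails_def)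
  have "descent_fails j (m - unit_exp j) (insert j \<tau>)"
    using descent_fails descent_fails_move[OF order_refl False, of "m - unit_exp j"] exp_add_minus_single[OF mj] by simp
  then have "lookup (descent_contract j c (insert j \<tau>)) (m - unit_exp j) = insert_sign j \<tau> * lookup (c \<tau>) m"
    using False exp_add_minus_single[OF mj] by (simp add: lookup_descent_contract)
  then have t: "insert_sign j \<tau> * (if lookup m j > 0 then
      lookup (descent_contract j c (insert j \<tau>)) (m - unit_exp j) else 0) = lookup (c \<tau>) m"
    using mj by simp
  have "lookup (kdiff (*) (descent_contract j c) \<tau>) m = (\<Sum>i\<in>{j}. insert_sign i \<tau> *
      (if lookup m i > 0 then lookup (descent_contract j c (insert i \<tau>)) (m - unit_exp i) else 0))"
    unfolding lookup_kdiff using False by (intro sum.mono_neutral_right) (auto simp: lookup_descent_contract)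
  then show ?thesis using t False by (simp add: lookup_minus lookup_descent_contract)
next
  case True
  define \<rho> where "\<rho> = \<tau> - {j}"
  have \<tau>: "\<tau> = insert j \<rho>" "j \<notin> \<rho>" using True by (auto simp: \<rho>_def)
  have compl: "- \<rho> = insert j (- \<tau>)" "j \<notin> - \<tau>" using \<tau> by auto
  let ?x = "\<lambda>i. if lookup m i > 0 then
    lookup (c (insert i \<rho>)) (unit_exp j + (m - unit_exp i)) else 0"
  have "lookup (descent_contract j (kdiff (*) c) \<tau>) m =
      insert_sign j \<rho> * lookup (kdiff (*) c \<rho>) (unit_exp j + m)"
    using True descent_fails by (simp add: lookup_descent_contract \<rho>_def)
  also have "lookup (kdiff (*) c \<rho>) (unit_exp j + m) =
      insert_sign j \<rho> * lookup (c \<tau>) m + (\<Sum>i\<in>-\<tau>. insert_sign i \<rho> * ?x i)"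
  proof -
    have "unit_exp j + m - unit_exp i = unit_exp j + (m - unit_exp i)" if "lookup m i > 0" for i
      using that by (intro poly_mapping_eqI) (auto simp: lookup_add lookup_minus lookup_single when_def)
    then have "(if lookup (unit_exp j + m) i > 0 then
        lookup (c (insert i \<rho>)) (unit_exp j + m - unit_exp i) else 0) = ?x i" if "i \<in> - \<tau>" for i
      using that compl(2) True by (auto simp: lookup_add lookup_single when_def)
    then show ?thesis
      unfolding lookup_kdiff compl(1) by (subst sum.insert) (use compl(2) \<tau> in \<open>auto simp: lookup_add\<close>)
  qed
  also have "insert_sign j \<rho> * \<dots> = lookup (c \<tau>) m + (\<Sum>i\<in>-\<tau>. insert_sign j \<rho> * (insert_sign i \<rho> * ?x i))"
    by (simp add: distrib_left sum_distrib_left)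
  finally have 1: "lookup (descent_contract j (kdiff (*) c) \<tau>) m =
    lookup (c \<tau>) m + (\<Sum>i\<in>-\<tau>. insert_sign j \<rho> * (insert_sign i \<rho> * ?x i))" .
  have "lookup (kdiff (*) (descent_contract j c) \<tau>) m = (\<Sum>i\<in>-\<tau>. - (insert_sign j \<rho> * (insert_sign i \<rho> * ?x i)))"
    unfolding lookup_kdiff
  proof (intro sum.cong refl)
    fix i assume "i \<in> - \<tau>"
    then have i: "i \<notin> \<tau>" "i \<noteq> j" "i \<notin> \<rho>" "insert i \<tau> - {j} = insert i \<rho>" using \<tau> by auto
    show "insert_sign i \<tau> * (if lookup m i > 0
        then lookup (descent_contract j c (insert i \<tau>)) (m - unit_exp i) else 0) = - (insert_sign j \<rho> * (insert_sign i \<rho> * ?x i))"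
    proof (cases "lookup m i > 0")
      case mi: True
      have "descent_fails j (m - unit_exp i) (insert i \<tau>)"
        using descent_fails_kdiff[OF i(1), of j "m - unit_exp i"] descent_fails exp_add_minus_single[OF mi] by simp
      then have "lookup (descent_contract j c (insert i \<tau>)) (m - unit_exp i) = insert_sign j (insert i \<rho>) * ?x i"
        using mi True by (simp add: lookup_descent_contract i(4))
      moreover have "insert_sign i \<tau> * insert_sign j (insert i \<rho>) = - (insert_sign j \<rho> * insert_sign i \<rho> :: 'k)"
        using insert_sign_swap_both[OF i(2,3) \<tau>(2)] by (simp add: \<tau>(1) mult.commute)
      ultimately show ?thesis using mi by (simp flip: mult.assoc)
    qed simp
  qed
  then show ?thesis using 1 by (simp add: lookup_minus sum_negf)
qed

text \<open>
  The homotopy retracts the chains with descent at \<open>V\<close> to those with descent at \<open>insert j V\<close>; on the latter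
  the contraction is zero, so cycles there are not changed. The contraction preserves descent at
  the variables of \<open>V\<close> because these are smaller than \<open>j\<close>.
\<close>

lemma deformation_step:
  fixes U :: "('n::{finite,linorder} \<Rightarrow>\<^sub>0 nat) set"
  assumes up: "\<And>m i. m \<in> U \<Longrightarrow> unit_exp i + m \<in> U"
    and down: "\<And>m i j. i < j \<Longrightarrow> unit_exp j + m \<in> U \<Longrightarrow> lookup m i \<le> lookup m j \<Longrightarrow> m \<in> U"
    and V: "\<And>v. v \<in> V \<Longrightarrow> v < j"
  defines "Q \<equiv> \<lambda>V m \<tau>. m \<in> U \<and> (\<forall>v\<in>V. \<not> descent_fails v m \<tau>)"
  shows "subquot_iso (range Inl :: ('k + ('n \<Rightarrow> 'n)) set) (chain_op (*) \<psi>)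
    (kcycles (*) (supp_chains (Q V) :: nat \<Rightarrow> ('n set \<Rightarrow> ('n, 'k::field) mpoly) set) l) (kbounds (*) (supp_chains (Q V)) l)
    (chain_op (*) \<psi>) (kcycles (*) (supp_chains (Q (insert j V))) l) (kbounds (*) (supp_chains (Q (insert j V))) l)"
proof -
  let ?C = "\<lambda>V. supp_chains (Q V) :: nat \<Rightarrow> ('n set \<Rightarrow> ('n, 'k) mpoly) set"
  have Qk: "Q W (unit_exp i + m) \<tau>" if "i \<notin> \<tau>" "Q W m (insert i \<tau>)" for W m i \<tau>
    using that up descent_fails_kdiff[OF that(1)] by (auto simp: Q_def)
  have dC: "kdiff (*) c \<in> ?C W m" if "c \<in> ?C W (Suc m)" for c W m
    using kdiff_supp_chains[OF that Qk] .
  have sub: "?C (insert j V) m \<subseteq> ?C V m" for m by (rule supp_chains_mono) (auto simp: Q_def)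
  have hC: "descent_contract j c \<in> ?C V (Suc m)" if c: "c \<in> ?C V m" for c m
  proof (rule supp_chainsI)
    fix \<tau> :: "'n set" assume "card \<tau> \<noteq> Suc m"
    then have "j \<in> \<tau> \<Longrightarrow> card (\<tau> - {j}) \<noteq> m" by (metis card_Suc_Diff1 finite)
    then show "descent_contract j c \<tau> = 0"
      by (intro poly_mapping_eqI) (auto simp: lookup_descent_contract supp_chainsD(1)[OF c])
  next
    fix \<tau> a assume "lookup (descent_contract j c \<tau>) a \<noteq> 0"
    then have \<tau>: "j \<in> \<tau>" "descent_fails j a \<tau>" "lookup (c (\<tau> - {j})) (unit_exp j + a) \<noteq> 0"
      by (auto simp: lookup_descent_contract split: if_splits)
    then have q: "Q V (unit_exp j + a) (\<tau> - {j})" using supp_chainsD(2)[OF c] by blast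
    obtain i where "i < j" "lookup a i \<le> lookup a j"
      using \<tau>(1,2) by (auto simp: descent_fails_def)
    then have "a \<in> U" using down q by (auto simp: Q_def)
    moreover have "\<not> descent_fails v a \<tau>" if "v \<in> V" for v
      using descent_fails_move[of v j "\<tau> - {j}" a] V[OF that] \<tau>(1) q that by (auto simp: Q_def insert_absorb)
    ultimately show "Q V a \<tau>" by (simp add: Q_def)
  qed
  have h0: "descent_contract j c = 0" if c: "c \<in> ?C (insert j V) m" for c m
  proof (rule ext, rule poly_mapping_eqI)
    fix \<tau> a
    have "lookup (descent_contract j c \<tau>) a = 0"
    proof (rule ccontr)
      assume "lookup (descent_contract j c \<tau>) a \<noteq> 0"
      then have \<tau>: "j \<in> \<tau>" "descent_fails j a \<tau>" "lookup (c (\<tau> - {j})) (unit_exp j + a) \<noteq> 0"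
        by (auto simp: lookup_descent_contract split: if_splits)
      then have "\<not> descent_fails j (unit_exp j + a) (\<tau> - {j})" using supp_chainsD(2)[OF c] by (auto simp: Q_def)
      then show False using descent_fails_move[of j j "\<tau> - {j}" a] \<tau> by (simp add: insert_absorb)
    qed
    then show "lookup (descent_contract j c \<tau>) a = lookup (0 \<tau>) a" by simp
  qed
  have cyc: "diff_closed (kcycles (*) (?C W) m)" and bnd: "diff_closed (kbounds (*) (?C W) m)" for W m
    by (intro R.diff_closed_kcycles R.diff_closed_kbounds diff_closed_supp_chains)+
  have bc: "kbounds (*) (?C W) m \<subseteq> kcycles (*) (?C W) m" for W m
    by (intro R.kbounds_subset_kcycles dC)
  have ret: "c - kdiff (*) (descent_contract j c) - descent_contract j (kdiff (*) c) \<in> ?C (insert j V) m"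
    if c: "c \<in> ?C V m" and hk: "descent_contract j (kdiff (*) c) \<in> ?C V m" for c m
  proof (rule supp_chainsI)
    let ?r = "c - kdiff (*) (descent_contract j c) - descent_contract j (kdiff (*) c)"
    have r: "?r \<in> ?C V m"
      using diff_closedD(2)[OF diff_closed_supp_chains] c dC[OF hC[OF c]] hk by blast
    show "?r \<tau> = 0" if "card \<tau> \<noteq> m" for \<tau> using supp_chainsD(1)[OF r that] .
    fix \<tau> a assume a: "lookup (?r \<tau>) a \<noteq> 0"
    then have "\<not> descent_fails j a \<tau>" using descent_contract_homotopy by blast
    then show "Q (insert j V) a \<tau>" using supp_chainsD(2)[OF r a] by (simp add: Q_def)
  qed
  have h00: "descent_contract j 0 = (0 :: 'n set \<Rightarrow> ('n, 'k) mpoly)"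
    by (rule h0[OF diff_closedD(1)[OF diff_closed_supp_chains]])
  let ?\<rho> = "{(z, w). z \<in> kcycles (*) (?C V) l \<and> w \<in> kcycles (*) (?C (insert j V)) l \<and> z - w \<in> kbounds (*) (?C V) l}"
  have subz: "kcycles (*) (?C (insert j V)) l \<subseteq> kcycles (*) (?C V) l"
    and subb: "kbounds (*) (?C (insert j V)) l \<subseteq> kbounds (*) (?C V) l"
    using sub by (auto simp: kcycles_def kbounds_def)
  show ?thesis
  proof (rule subquot_isoI[of ?\<rho>])
    fix z assume z: "z \<in> kcycles (*) (?C V) l"
    then have z': "z \<in> ?C V l" "kdiff (*) z = 0" by (auto simp: kcycles_def)
    define w where "w = z - kdiff (*) (descent_contract j z)"
    have "w \<in> ?C (insert j V) l"
      using ret[OF z'(1)] z'(2) diff_closedD(1)[OF diff_closed_supp_chains, of "Q V" l] by (simp add: w_def h00)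
    then have "w \<in> kcycles (*) (?C (insert j V)) l"
      using z' by (simp add: kcycles_def w_def R.kdiff_diff R.kdiff_kdiff)
    moreover have "z - w \<in> kbounds (*) (?C V) l" using hC[OF z'(1)] by (auto simp: w_def kbounds_def)
    ultimately show "\<exists>w. (z, w) \<in> ?\<rho>" using z by blast
  next
    fix w assume w: "w \<in> kcycles (*) (?C (insert j V)) l"
    have "w - w \<in> kbounds (*) (?C V) l" unfolding diff_self by (rule diff_closedD(1)[OF bnd])
    then show "\<exists>z. (z, w) \<in> ?\<rho>" using w subz by blast
  next
    fix z w z' w' assume "(z, w) \<in> ?\<rho>" "(z', w') \<in> ?\<rho>"
    then have *: "z \<in> kcycles (*) (?C V) l" "w \<in> kcycles (*) (?C (insert j V)) l" "z - w \<in> kbounds (*) (?C V) l"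
      "z' \<in> kcycles (*) (?C V) l" "w' \<in> kcycles (*) (?C (insert j V)) l" "z' - w' \<in> kbounds (*) (?C V) l" by auto
    have "(z - z') - (w - w') = (z - w) - (z' - w')" by simp
    then have "(z - z') - (w - w') \<in> kbounds (*) (?C V) l"
      using diff_closedD(2)[OF bnd *(3,6)] by presburger
    then show "(z - z', w - w') \<in> ?\<rho>" using diff_closedD(2)[OF cyc] * by blast
  next
    fix a z w assume "a \<in> (range Inl :: ('k + ('n \<Rightarrow> 'n)) set)" and zw: "(z, w) \<in> ?\<rho>"
    then obtain b where a: "a = Inl b" by auto
    have "chain_scale (*) b (z - w) \<in> kbounds (*) (?C V) l"
    proof -
      obtain b' where b': "b' \<in> ?C V (Suc l)" "z - w = kdiff (*) b'" using zw by (auto simp: kbounds_def)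
      then have "chain_scale (*) b (z - w) = kdiff (*) (chain_scale (*) b b')" by (simp add: R.kdiff_chain_scale)
      then show ?thesis using chain_scale_supp_chains[OF b'(1)] unfolding kbounds_def by blast
    qed
    then show "(chain_op (*) \<psi> a z, chain_op (*) \<psi> a w) \<in> ?\<rho>" using zw by (auto simp: chain_op_def a R.chain_scale_diff chain_scale_kcycles)
  next
    fix z w assume zw: "(z, w) \<in> ?\<rho>"
    show "z \<in> kbounds (*) (?C V) l \<longleftrightarrow> w \<in> kbounds (*) (?C (insert j V)) l"
    proof
      assume "z \<in> kbounds (*) (?C V) l"
      then have "z - (z - w) \<in> kbounds (*) (?C V) l" using diff_closedD(2)[OF bnd] zw by blast
      then obtain b where b: "b \<in> ?C V (Suc l)" "w = kdiff (*) b" by (auto simp: kbounds_def)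
      have w: "w \<in> ?C (insert j V) l" using zw by (auto simp: kcycles_def)
      define b' where "b' = b - kdiff (*) (descent_contract j b)"
      have "b' \<in> ?C (insert j V) (Suc l)"
        using ret[OF b(1)] diff_closedD(1)[OF diff_closed_supp_chains, of "Q V" "Suc l"]
        by (simp add: b'_def flip: b(2)) (simp add: h0[OF w])
      moreover have "kdiff (*) b' = w" by (simp add: b'_def R.kdiff_diff R.kdiff_kdiff b(2))
      ultimately show "w \<in> kbounds (*) (?C (insert j V)) l" unfolding kbounds_def by blast
    next
      assume "w \<in> kbounds (*) (?C (insert j V)) l"
      then have "(z - w) + w \<in> kbounds (*) (?C V) l"
        using zw subb by (intro diff_closedD(4)[OF bnd]) auto
      then show "z \<in> kbounds (*) (?C V) l" by simp
    qed
  qed auto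
qed

proposition deformation:
  fixes U :: "('n::{finite,linorder} \<Rightarrow>\<^sub>0 nat) set"
  assumes up: "\<And>m i. m \<in> U \<Longrightarrow> unit_exp i + m \<in> U"
    and down: "\<And>m i j. i < j \<Longrightarrow> unit_exp j + m \<in> U \<Longrightarrow> lookup m i \<le> lookup m j \<Longrightarrow> m \<in> U"
  defines "Q \<equiv> \<lambda>V m \<tau>. m \<in> U \<and> (\<forall>v\<in>V. \<not> descent_fails v m \<tau>)"
  shows "subquot_iso (range Inl :: ('k + ('n \<Rightarrow> 'n)) set) (chain_op (*) \<psi>)
    (kcycles (*) (supp_chains (\<lambda>m \<tau>. m \<in> U) :: nat \<Rightarrow> ('n set \<Rightarrow> ('n, 'k::field) mpoly) set) l) (kbounds (*) (supp_chains (\<lambda>m \<tau>. m \<in> U)) l)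
    (chain_op (*) \<psi>) (kcycles (*) (supp_chains (Q V)) l) (kbounds (*) (supp_chains (Q V)) l)"
  using finite[of V]
proof (induct V rule: finite_linorder_max_induct)
  case empty
  have Q: "(\<lambda>m \<tau>. m \<in> U) = Q {}" by (simp add: Q_def fun_eq_iff)
  show ?case
    unfolding Q
  proof (rule subquot_iso_refl)
    fix c c' :: "'n set \<Rightarrow> ('n, 'k) mpoly"
    assume "c \<in> kcycles (*) (supp_chains (Q {})) l" "c' \<in> kcycles (*) (supp_chains (Q {})) l"
    then show "c - c' \<in> kcycles (*) (supp_chains (Q {})) l"
      by (rule diff_closedD(2)[OF R.diff_closed_kcycles[where C = "supp_chains (Q {})"], OF diff_closed_supp_chains])
  next
    fix a and c :: "'n set \<Rightarrow> ('n, 'k) mpoly" assume "a \<in> (range Inl :: ('k + ('n \<Rightarrow> 'n)) set)" "c \<in> kcycles (*) (supp_chains (Q {})) l"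
    then show "chain_op (*) \<psi> a c \<in> kcycles (*) (supp_chains (Q {})) l"
      by (auto simp: chain_op_def chain_scale_kcycles)
  qed
next
  case (insert j V)
  have "subquot_iso (range Inl) (chain_op (*) \<psi>)
    (kcycles (*) (supp_chains (Q V) :: nat \<Rightarrow> ('n set \<Rightarrow> ('n, 'k) mpoly) set) l) (kbounds (*) (supp_chains (Q V)) l)
    (chain_op (*) \<psi>) (kcycles (*) (supp_chains (Q (insert j V))) l) (kbounds (*) (supp_chains (Q (insert j V))) l)"
    unfolding Q_def by (rule deformation_step) (fact up, fact down, use insert(2) in blast)
  with insert(3) show ?case by (rule subquot_iso_trans)
qed

section \<open>Sorting exponents\<close>

lemma sort_exponent:
  fixes b :: "'n::{finite,linorder} \<Rightarrow>\<^sub>0 nat"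
  shows "\<exists>\<sigma>. bij \<sigma> \<and> perm_exp \<sigma> b \<in> partitions"
proof -
  obtain us :: "'n list" where us: "set us = UNIV" "distinct us"
    using finite_distinct_list[OF finite[of "UNIV :: 'n set"]] by blast
  \<comment> \<open>Sorting by the negative exponents gives the decreasing order.\<close>
  define vs where "vs = sort_key (\<lambda>i. - int (lookup b i)) us"
  have vs: "distinct vs" "length vs = CARD('n)"
    using us by (simp_all add: vs_def flip: distinct_card)
  have sorted: "sorted (map (\<lambda>i. - int (lookup b i)) vs)" by (simp add: vs_def)
  \<comment> \<open>\<open>r x\<close> is the position of \<open>x\<close> in the increasing enumeration of the variables.\<close>
  define r :: "'n \<Rightarrow> nat" where "r x = card {..<x}" for x
  have rl: "r x < length vs" for x
  proof -
    have "{..<x} \<subset> UNIV" by auto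
    then show ?thesis unfolding r_def vs(2) by (intro psubset_card_mono) auto
  qed
  have rm: "r x < r y" if "x < y" for x y
    unfolding r_def using that by (intro psubset_card_mono) auto
  define \<pi> where "\<pi> x = vs ! r x" for x
  have "inj \<pi>"
  proof (rule injI)
    fix x y assume "\<pi> x = \<pi> y"
    then have "r x = r y" using nth_eq_iff_index_eq[OF vs(1) rl rl] by (simp add: \<pi>_def)
    then show "x = y" using rm[of x y] rm[of y x] by (cases x y rule: linorder_cases) auto
  qed
  then have bij: "bij \<pi>" by (simp add: bij_def finite_UNIV_inj_surj)
  have anti: "lookup b (\<pi> y) \<le> lookup b (\<pi> x)" if "x \<le> y" for x y
  proof (cases "x = y")
    case False
    then have "r x \<le> r y" using rm[of x y] order_le_neq_trans[OF that] by simp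
    then show ?thesis
      using sorted_nth_mono[OF sorted, of "r x" "r y"] rl[of x] rl[of y] by (simp add: \<pi>_def)
  qed simp
  show ?thesis
    using bij anti
    by (intro exI[of _ "inv \<pi>"])
      (auto simp: partitions_def antimono_def bij_imp_bij_inv lookup_perm_exp_inv inv_inv_eq)
qed

text \<open>
  Some \<open>j \<le> i\<close> is mapped by \<open>\<sigma>\<close> to a position \<open>\<ge> i\<close>, as \<open>\<sigma>\<close> cannot inject \<open>{..i}\<close> into \<open>{..<i}\<close>; hence
  \<open>a\<^sub>i \<le> a\<^sub>j \<le> m\<^bsub>\<sigma> j\<^esub> \<le> m\<^sub>i\<close>.
\<close>

lemma sorted_le:
  fixes a m :: "'n::{finite,linorder} \<Rightarrow>\<^sub>0 nat"
  assumes \<sigma>: "bij \<sigma>" and a: "a \<in> partitions" and m: "m \<in> partitions"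
    and le: "\<And>i. lookup (perm_exp \<sigma> a) i \<le> lookup m i"
  shows "lookup a i \<le> lookup m i"
proof -
  have "\<not> \<sigma> ` {..i} \<subseteq> {..<i}"
  proof
    assume "\<sigma> ` {..i} \<subseteq> {..<i}"
    then have "card (\<sigma> ` {..i}) \<le> card {..<i}" by (intro card_mono) auto
    also have "\<dots> < card {..i}" by (intro psubset_card_mono) auto
    finally show False using \<sigma> by (metis bij_is_inj card_image inj_on_subset less_irrefl subset_UNIV)
  qed
  then obtain j where "j \<in> {..i}" "\<sigma> j \<notin> {..<i}" by blast
  then have j: "j \<le> i" "i \<le> \<sigma> j" by simp_all
  have "lookup a i \<le> lookup a j"
    using a j(1) by (auto simp: partitions_def antimono_def)
  also have "\<dots> \<le> lookup m (\<sigma> j)" using le[of "\<sigma> j"] \<sigma> by (simp add: lookup_perm_exp)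
  also have "\<dots> \<le> lookup m i" using m j(2) by (auto simp: partitions_def antimono_def)
  finally show ?thesis .
qed

lemma sorted_unique:
  fixes a b :: "'n::{finite,linorder} \<Rightarrow>\<^sub>0 nat"
  assumes "bij \<sigma>" "a \<in> partitions" "perm_exp \<sigma> a \<in> partitions"
  shows "perm_exp \<sigma> a = a"
proof (rule poly_mapping_eqI)
  fix i
  show "lookup (perm_exp \<sigma> a) i = lookup a i"
    using sorted_le[OF assms, of i] sorted_le[OF bij_imp_bij_inv[OF assms(1)] assms(3,2), of i] assms(1) by simp
qed

text \<open>
  If \<open>\<sigma> a\<close> lies below \<open>m\<close> and both \<open>a\<close> and \<open>m\<close> are partitions, then \<open>a\<close> lies below \<open>m\<close> by \<open>sorted_le\<close>. So the
  symmetric and the ordinary ideal differ only in monomials that are not sorted.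
\<close>

lemma exp_ideal_partitions:
  assumes L: "L \<subseteq> partitions" and m: "m \<in> partitions"
  shows "m \<in> exp_ideal {perm_exp \<sigma> a | \<sigma> a. bij \<sigma> \<and> a \<in> L} \<longleftrightarrow> m \<in> exp_ideal (L :: ('n::{finite,linorder} \<Rightarrow>\<^sub>0 nat) set)"
proof
  assume "m \<in> exp_ideal {perm_exp \<sigma> a | \<sigma> a. bij \<sigma> \<and> a \<in> L}"
  then obtain \<sigma> a where "bij \<sigma>" "a \<in> L" "\<And>i. lookup (perm_exp \<sigma> a) i \<le> lookup m i"
    by (auto simp: exp_ideal_def)
  then show "m \<in> exp_ideal L" using sorted_le[of \<sigma> a m] L m by (auto simp: exp_ideal_def)
next
  assume "m \<in> exp_ideal L"
  then obtain a where a: "a \<in> L" "\<forall>i. lookup a i \<le> lookup m i" by (auto simp: exp_ideal_def)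
  have "perm_exp id a = a" by (rule poly_mapping_eqI) (simp add: lookup_perm_exp_inv)
  then have "\<exists>\<sigma> a'. a = perm_exp \<sigma> a' \<and> bij \<sigma> \<and> a' \<in> L" using a(1) bij_id by metis
  then have "a \<in> {perm_exp \<sigma> a | \<sigma> a. bij \<sigma> \<and> a \<in> L}" by blast
  then show "m \<in> exp_ideal {perm_exp \<sigma> a | \<sigma> a. bij \<sigma> \<and> a \<in> L}" using a(2) by (auto simp: exp_ideal_def)
qed

lemma exp_ideal_perm:
  assumes \<sigma>: "bij \<sigma>" and m: "m \<in> exp_ideal {perm_exp \<sigma> a | \<sigma> a. bij \<sigma> \<and> a \<in> L}"
  shows "perm_exp \<sigma> m \<in> exp_ideal {perm_exp \<sigma> a | \<sigma> a. bij \<sigma> \<and> a \<in> L}"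
proof -
  obtain \<rho> a where a: "bij \<rho>" "a \<in> L" "\<And>i. lookup (perm_exp \<rho> a) i \<le> lookup m i"
    using m by (auto simp: exp_ideal_def)
  have "lookup (perm_exp (\<sigma> \<circ> \<rho>) a) i \<le> lookup (perm_exp \<sigma> m) i" for i
    using a \<sigma> by (simp add: perm_exp_comp lookup_perm_exp_inv del: o_apply)
  moreover have "bij (\<sigma> \<circ> \<rho>)" using a(1) \<sigma> by (simp add: bij_comp)
  ultimately show ?thesis using a(2) unfolding exp_ideal_def by blast
qed

text \<open>
  The exponent \<open>2m + \<tau>\<close> encodes the pair \<open>(m, \<tau>)\<close>. If \<open>a = m + \<tau>\<close> is the multidegree, then it equals \<open>2a - \<tau>\<close>; so sorting
  it in decreasing order sorts \<open>a\<close>, and puts the elements of \<open>\<tau>\<close> last among indices with equal \<open>a\<close>.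
\<close>

definition double_plus :: "('n::finite \<Rightarrow>\<^sub>0 nat) \<Rightarrow> 'n set \<Rightarrow> ('n \<Rightarrow>\<^sub>0 nat)" where
  "double_plus m \<tau> = Abs_poly_mapping (\<lambda>i. 2 * lookup m i + of_bool (i \<in> \<tau>))"

lemma lookup_double_plus: "lookup (double_plus m \<tau>) i = 2 * lookup m i + of_bool (i \<in> \<tau>)"
  by (simp add: double_plus_def)

lemma double_plus_inject: "double_plus m \<tau> = double_plus m' \<tau>' \<longleftrightarrow> m = m' \<and> \<tau> = \<tau>'"
proof
  assume eq: "double_plus m \<tau> = double_plus m' \<tau>'"
  have eq': "2 * lookup m i + of_bool (i \<in> \<tau>) = 2 * lookup m' i + of_bool (i \<in> \<tau>')" for i
    using arg_cong[OF eq, of "\<lambda>b. lookup b i"] by (simp add: lookup_double_plus)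
  have "lookup m i = lookup m' i \<and> (i \<in> \<tau> \<longleftrightarrow> i \<in> \<tau>')" for i
    using eq'[of i] by (cases "i \<in> \<tau>"; cases "i \<in> \<tau>'"; simp; presburger)
  then show "m = m' \<and> \<tau> = \<tau>'" by (auto intro: poly_mapping_eqI)
qed simp

lemma perm_exp_double_plus:
  assumes \<sigma>: "bij \<sigma>" shows "perm_exp \<sigma> (double_plus m \<tau>) = double_plus (perm_exp \<sigma> m) (\<sigma> ` \<tau>)"
proof (rule poly_mapping_eqI)
  fix i
  have "i \<in> \<sigma> ` \<tau> \<longleftrightarrow> inv \<sigma> i \<in> \<tau>" using \<sigma> by (metis bij_inv_eq_iff image_iff)
  then show "lookup (perm_exp \<sigma> (double_plus m \<tau>)) i = lookup (double_plus (perm_exp \<sigma> m) (\<sigma> ` \<tau>)) i"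
    using \<sigma> by (simp add: lookup_perm_exp_inv lookup_double_plus)
qed

definition descending :: "('n::linorder \<Rightarrow>\<^sub>0 nat) \<Rightarrow> 'n set \<Rightarrow> bool" where
  "descending m \<tau> \<longleftrightarrow> (\<forall>j. \<not> descent_fails j m \<tau>)"

lemma descending_iff: "descending m \<tau> \<longleftrightarrow> (\<forall>i j. i < j \<longrightarrow> lookup m j + of_bool (j \<in> \<tau>) \<le> lookup m i)"
  unfolding descending_def descent_fails_def using linorder_not_less by blast

lemma descending_partition: "descending m \<tau> \<Longrightarrow> m \<in> partitions"
  unfolding partitions_def antimono_def
proof (intro CollectI allI impI)
  fix i j :: 'a assume "descending m \<tau>" "i \<le> j"
  then have "i = j \<or> i < j" "descending m \<tau>" by (auto simp: order_le_less)
  then have "i = j \<or> lookup m j + of_bool (j \<in> \<tau>) \<le> lookup m i"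
    unfolding descending_iff by blast
  then show "lookup m j \<le> lookup m i" by auto
qed

lemma descending_double_plus: "descending m \<tau> \<Longrightarrow> double_plus m \<tau> \<in> partitions"
  unfolding partitions_def antimono_def
proof (intro CollectI allI impI)
  fix i j :: 'a assume "descending m \<tau>" "i \<le> j"
  then have "i = j \<or> i < j" "descending m \<tau>" by (auto simp: order_le_less)
  then have "i = j \<or> lookup m j + of_bool (j \<in> \<tau>) \<le> lookup m i"
    unfolding descending_iff by blast
  then show "lookup (double_plus m \<tau>) j \<le> lookup (double_plus m \<tau>) i"
    by (auto simp: lookup_double_plus)
qed

lemma descending_unique:
  fixes m :: "'n::{finite,linorder} \<Rightarrow>\<^sub>0 nat"
  assumes "bij \<sigma>" "descending m \<tau>" "descending (perm_exp \<sigma> m) (\<sigma> ` \<tau>)"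
  shows "perm_exp \<sigma> m = m \<and> \<sigma> ` \<tau> = \<tau>"
  using sorted_unique[OF assms(1) descending_double_plus[OF assms(2)]] descending_double_plus[OF assms(3)]
  by (simp add: perm_exp_double_plus assms(1) double_plus_inject)

definition stab :: "('n::linorder \<Rightarrow>\<^sub>0 nat) \<Rightarrow> 'n set \<Rightarrow> ('n \<Rightarrow> 'n) set" where
  "stab m \<tau> = {\<sigma>. bij \<sigma> \<and> perm_exp \<sigma> m = m \<and> \<sigma> ` \<tau> = \<tau>}"

text \<open>
  Two variables of \<open>\<tau>\<close> have different exponents in \<open>m\<close>, so a permutation that preserves \<open>m\<close> and \<open>\<tau>\<close> fixes \<open>\<tau>\<close>
  pointwise.
\<close>

lemma perm_sign_stab:
  fixes m :: "'n::{finite,linorder} \<Rightarrow>\<^sub>0 nat"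
  assumes "descending m \<tau>" "\<sigma> \<in> stab m \<tau>"
  shows "perm_sign \<sigma> \<tau> = 1"
proof (rule perm_sign_fixed)
  show "bij \<sigma>" using assms by (simp add: stab_def)
  fix i assume i: "i \<in> \<tau>"
  have "lookup m (\<sigma> i) = lookup m i"
    using assms(2) lookup_perm_exp[of \<sigma> m i] by (simp add: stab_def)
  moreover have "\<sigma> i \<in> \<tau>" using assms(2) i by (auto simp: stab_def)
  ultimately show "\<sigma> i = i" using assms(1) i unfolding descending_iff
    by (metis add_le_same_cancel1 linorder_neqE not_one_le_zero of_bool_eq(2))
qed

text \<open>
  The fibres of \<open>\<sigma> \<mapsto> (\<sigma> m, \<sigma> \<tau>)\<close> are cosets of the stabiliser.
\<close>

lemma card_stab_dvd:
  fixes m :: "'n::{finite,linorder} \<Rightarrow>\<^sub>0 nat"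
  shows "card (stab m \<tau>) dvd card {\<sigma> :: 'n \<Rightarrow> 'n. bij \<sigma>}"
proof -
  let ?B = "{\<sigma> :: 'n \<Rightarrow> 'n. bij \<sigma>}"
  let ?f = "\<lambda>\<sigma>. (perm_exp \<sigma> m, \<sigma> ` \<tau>)"
  have fibre: "card {\<sigma> \<in> ?B. ?f \<sigma> = y} = card (stab m \<tau>)" if "y \<in> ?f ` ?B" for y
  proof -
    obtain \<rho> where \<rho>: "bij \<rho>" "y = ?f \<rho>" using \<open>y \<in> ?f ` ?B\<close> by auto
    have "{\<sigma> \<in> ?B. ?f \<sigma> = y} = (\<circ>) \<rho> ` stab m \<tau>"
    proof (intro equalityI subsetI)
      fix \<sigma> assume "\<sigma> \<in> {\<sigma> \<in> ?B. ?f \<sigma> = y}"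
      then have \<sigma>: "bij \<sigma>" "perm_exp \<sigma> m = perm_exp \<rho> m" "\<sigma> ` \<tau> = \<rho> ` \<tau>" using \<rho>(2) by auto
      have "inv \<rho> \<circ> \<sigma> \<in> stab m \<tau>"
        using \<sigma> \<rho>(1) by (auto simp: stab_def bij_comp bij_imp_bij_inv perm_exp_comp image_comp[symmetric]
            bij_is_inj inv_f_f image_inv_f_f simp del: o_apply)
      moreover have "\<rho> \<circ> (inv \<rho> \<circ> \<sigma>) = \<sigma>" using \<rho>(1) by (simp add: fun_eq_iff bij_is_surj surj_f_inv_f)
      ultimately show "\<sigma> \<in> (\<circ>) \<rho> ` stab m \<tau>" by (metis imageI)
    next
      fix \<sigma> assume "\<sigma> \<in> (\<circ>) \<rho> ` stab m \<tau>"
      then obtain \<pi> where \<pi>: "\<pi> \<in> stab m \<tau>" "\<sigma> = \<rho> \<circ> \<pi>" by blast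
      have "(\<rho> \<circ> \<pi>) ` \<tau> = \<rho> ` \<tau>" using \<pi>(1) by (simp add: stab_def image_comp[symmetric] del: o_apply)
      then show "\<sigma> \<in> {\<sigma> \<in> ?B. ?f \<sigma> = y}"
        using \<pi> \<rho> by (simp add: stab_def bij_comp perm_exp_comp)
    qed
    moreover have "inj_on ((\<circ>) \<rho>) (stab m \<tau>)"
      using \<rho>(1) by (intro inj_onI) (auto simp: fun_eq_iff bij_is_inj inj_eq)
    ultimately show ?thesis by (simp add: card_image)
  qed
  have "card ?B = (\<Sum>y\<in>?f ` ?B. card {\<sigma> \<in> ?B. ?f \<sigma> = y})"
    using sum.image_gen[of ?B "\<lambda>_. 1 :: nat" ?f] by simp
  also have "\<dots> = card (?f ` ?B) * card (stab m \<tau>)" using fibre by simp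
  finally show ?thesis by simp
qed

section \<open>Averaging over the symmetric group\<close>

definition perm_chain :: "('n \<Rightarrow> 'n) \<Rightarrow> ('n::{finite,linorder} set \<Rightarrow> ('n, 'k::field) mpoly) \<Rightarrow> 'n set \<Rightarrow> ('n, 'k) mpoly" where
  "perm_chain \<sigma> = chain_perm (*) \<sigma> (perm_poly \<sigma>)"

text \<open>
  The sum over the group, without division by its order.
\<close>

definition average :: "('n::{finite,linorder} set \<Rightarrow> ('n, 'k::field) mpoly) \<Rightarrow> 'n set \<Rightarrow> ('n, 'k) mpoly" where
  "average c = (\<Sum>\<sigma> | bij \<sigma>. perm_chain \<sigma> c)"

lemma sum_fun_apply: "(\<Sum>i\<in>A. f i) x = (\<Sum>i\<in>A. f i x)"
  by (induct A rule: infinite_finite_induct) auto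

lemma lookup_perm_chain:
  "bij \<sigma> \<Longrightarrow> lookup (perm_chain \<sigma> c \<tau>) m =
    perm_sign \<sigma> (inv \<sigma> ` \<tau>) * lookup (c (inv \<sigma> ` \<tau>)) (perm_exp (inv \<sigma>) m)"
  by (simp add: perm_chain_def chain_perm_def lookup_mconst_mult lookup_perm_poly_inv)

lemma poly_chain_eqI:
  assumes "\<And>\<tau> m. lookup (c \<tau>) m = lookup (c' \<tau>) m"
  shows "c = c'"
  by (rule ext, rule poly_mapping_eqI) (rule assms)

lemma lookup_average: "lookup (average c \<tau>) m = (\<Sum>\<sigma> | bij \<sigma>.
    perm_sign \<sigma> (inv \<sigma> ` \<tau>) * lookup (c (inv \<sigma> ` \<tau>)) (perm_exp (inv \<sigma>) m))"
  by (simp add: average_def sum_fun_apply lookup_sum lookup_perm_chain)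

lemma perm_chain_diff: "bij \<sigma> \<Longrightarrow> perm_chain \<sigma> (c - c') = perm_chain \<sigma> c - perm_chain \<sigma> c'"
  by (rule poly_chain_eqI) (simp add: lookup_perm_chain lookup_minus right_diff_distrib)

lemma perm_chain_chain_scale: "bij \<sigma> \<Longrightarrow> perm_chain \<sigma> (chain_scale (*) a c) = chain_scale (*) a (perm_chain \<sigma> c)"
  by (rule poly_chain_eqI) (simp add: lookup_perm_chain chain_scale_def lookup_mconst_mult)

lemma perm_chain_comp: "bij \<sigma> \<Longrightarrow> bij \<rho> \<Longrightarrow> perm_chain (\<sigma> \<circ> \<rho>) c = perm_chain \<sigma> (perm_chain \<rho> c)"
proof (rule poly_chain_eqI)
  fix \<tau> m assume \<sigma>: "bij \<sigma>" and \<rho>: "bij \<rho>"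
  have "\<rho> ` inv \<rho> ` inv \<sigma> ` \<tau> = inv \<sigma> ` \<tau>" using \<rho> by (simp add: image_f_inv_f bij_is_surj)
  moreover have "inv (\<sigma> \<circ> \<rho>) ` \<tau> = inv \<rho> ` inv \<sigma> ` \<tau>" using \<sigma> \<rho> by (simp add: o_inv_distrib image_comp)
  moreover have "perm_exp (inv (\<sigma> \<circ> \<rho>)) m = perm_exp (inv \<rho>) (perm_exp (inv \<sigma>) m)"
    using \<sigma> \<rho> by (simp add: o_inv_distrib perm_exp_comp bij_imp_bij_inv)
  ultimately show "lookup (perm_chain (\<sigma> \<circ> \<rho>) c \<tau>) m = lookup (perm_chain \<sigma> (perm_chain \<rho> c) \<tau>) m"
    using \<sigma> \<rho> by (simp add: lookup_perm_chain bij_comp perm_sign_comp mult.assoc del: o_apply)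
qed

lemma perm_chain_average: assumes \<sigma>: "bij \<sigma>" shows "perm_chain \<sigma> (average c) = average c"
proof -
  have add: "perm_chain \<sigma> (x + y) = perm_chain \<sigma> x + perm_chain \<sigma> y" for x y
    using perm_chain_diff[OF \<sigma>, of "x + y" y] by (simp add: algebra_simps)
  have "perm_chain \<sigma> (average c) = (\<Sum>\<rho> | bij \<rho>. perm_chain \<sigma> (perm_chain \<rho> c))"
    unfolding average_def
    by (rule sum_image_on[of UNIV "perm_chain \<sigma>" "{\<sigma>. bij \<sigma>}" "\<lambda>\<rho>. perm_chain \<rho> c"]) (auto simp: add)
  also have "\<dots> = (\<Sum>\<rho> | bij \<rho>. perm_chain (\<sigma> \<circ> \<rho>) c)" using \<sigma> by (simp add: perm_chain_comp)
  also have "\<dots> = average c"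
    unfolding average_def
    by (rule sum.reindex_bij_witness[of _ "\<lambda>\<rho>. inv \<sigma> \<circ> \<rho>" "\<lambda>\<rho>. \<sigma> \<circ> \<rho>"])
      (use \<sigma> in \<open>auto simp: bij_comp bij_imp_bij_inv fun_eq_iff bij_is_inj bij_is_surj surj_f_inv_f\<close>)
  finally show ?thesis .
qed

lemma average_diff: "average (c - c') = average c - average c'"
  by (simp add: average_def perm_chain_diff sum_subtractf)

lemma average_chain_scale: "average (chain_scale (*) a c) = chain_scale (*) a (average c)"
  by (rule poly_chain_eqI) (simp add: lookup_average chain_scale_def lookup_mconst_mult sum_distrib_left mult_ac)

lemma sum_const_chain: "(\<Sum>i\<in>A. c) = chain_scale (*) (of_nat (card A)) (c :: 'n set \<Rightarrow> ('n, 'k::field) mpoly)"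
  by (intro poly_chain_eqI, simp only: sum_fun_apply lookup_sum chain_scale_def lookup_mconst_mult) simp

lemma average_invariant:
  fixes c :: "'n::{finite,linorder} set \<Rightarrow> ('n, 'k::field) mpoly"
  assumes "\<And>\<sigma>. bij \<sigma> \<Longrightarrow> perm_chain \<sigma> c = c"
  shows "average c = chain_scale (*) (of_nat (card {\<sigma> :: 'n \<Rightarrow> 'n. bij \<sigma>})) c"
  using assms by (simp add: average_def flip: sum_const_chain)

lemma semilinear_perm_poly:
  "bij \<sigma> \<Longrightarrow> semilinear_on (perm_poly \<sigma>) (*) (*) UNIV (perm_poly \<sigma> :: ('n::{finite,linorder}, 'k::field) mpoly \<Rightarrow> _)"
  by (simp add: semilinear_on_def perm_poly_add perm_poly_mult)

lemma kdiff_perm_chain: "bij \<sigma> \<Longrightarrow> kdiff (*) (perm_chain \<sigma> c) = perm_chain \<sigma> (kdiff (*) c)"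
  unfolding perm_chain_def by (rule R.kdiff_chain_perm[OF R.subspace_UNIV _ semilinear_perm_poly]) auto

lemma kdiff_average: "kdiff (*) (average c) = average (kdiff (*) c)"
proof -
  have "kdiff (*) (average c) = (\<Sum>\<rho> | bij \<rho>. kdiff (*) (perm_chain \<rho> c))"
    unfolding average_def
    by (rule sum_image_on[of UNIV "kdiff (*)" "{\<sigma>. bij \<sigma>}" "\<lambda>\<sigma>. perm_chain \<sigma> c"]) (auto simp: R.kdiff_add)
  then show ?thesis by (simp add: kdiff_perm_chain average_def)
qed

lemma of_nat_nonzero:
  assumes "CHAR('k::field) = 0 \<or> CHAR('k) > n" "0 < k" "k \<le> n"
  shows "of_nat k \<noteq> (0 :: 'k)"
  using assms by (auto simp: of_nat_eq_0_iff_char_dvd dest: dvd_imp_le)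

lemma of_nat_card_perms_nonzero:
  assumes char: "CHAR('k::field) = 0 \<or> CHAR('k) > CARD('n::finite)"
  shows "of_nat (card {\<sigma> :: 'n \<Rightarrow> 'n. bij \<sigma>}) \<noteq> (0 :: 'k)"
proof -
  have "{\<sigma> :: 'n \<Rightarrow> 'n. bij \<sigma>} = {\<sigma>. \<sigma> permutes UNIV}"
    by (auto simp: permutes_bij intro: bij_imp_permutes)
  then have "card {\<sigma> :: 'n \<Rightarrow> 'n. bij \<sigma>} = fact CARD('n)" by (simp add: card_permutations)
  moreover have "of_nat (fact k) \<noteq> (0 :: 'k)" if "k \<le> CARD('n)" for k
    using that
  proof (induct k)
    case (Suc k)
    have "of_nat (Suc k) \<noteq> (0 :: 'k)" using of_nat_nonzero[OF char, of "Suc k"] Suc(2) by blast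
    moreover have "(of_nat (fact (Suc k)) :: 'k) = of_nat (Suc k) * of_nat (fact k)"
      by (simp only: fact_Suc of_nat_mult of_nat_id)
    ultimately show ?case using Suc by (simp del: of_nat_Suc fact_Suc)
  qed simp
  ultimately show ?thesis by simp
qed

text \<open>
  An orbit contains at most one descending basis element, so only the stabiliser of \<open>x\<^sup>m e\<^sub>\<tau>\<close> contributes to
  its coefficient, and it does so with sign \<open>1\<close>.
\<close>

lemma lookup_average_descending:
  fixes c :: "'n::{finite,linorder} set \<Rightarrow> ('n, 'k::field) mpoly"
  assumes c: "\<And>\<tau> m. lookup (c \<tau>) m \<noteq> 0 \<Longrightarrow> descending m \<tau>" and g: "descending m \<tau>"
  shows "lookup (average c \<tau>) m = of_nat (card (stab m \<tau>)) * lookup (c \<tau>) m"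
proof -
  let ?t = "\<lambda>\<sigma>. perm_sign \<sigma> (inv \<sigma> ` \<tau>) * lookup (c (inv \<sigma> ` \<tau>)) (perm_exp (inv \<sigma>) m)"
  have "lookup (average c \<tau>) m = (\<Sum>\<sigma>\<in>stab m \<tau>. ?t \<sigma>)"
    unfolding lookup_average
  proof (rule sum.mono_neutral_right)
    show "\<forall>\<sigma>\<in>{\<sigma>. bij \<sigma>} - stab m \<tau>. ?t \<sigma> = 0"
    proof (rule ballI, rule ccontr)
      fix \<sigma> assume \<sigma>: "\<sigma> \<in> {\<sigma>. bij \<sigma>} - stab m \<tau>" and "?t \<sigma> \<noteq> 0"
      then have "descending (perm_exp (inv \<sigma>) m) (inv \<sigma> ` \<tau>)" using c by auto
      then have "perm_exp (inv \<sigma>) m = m \<and> inv \<sigma> ` \<tau> = \<tau>"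
        using descending_unique[OF bij_imp_bij_inv g] \<sigma> by simp
      then have "\<sigma> \<in> stab m \<tau>"
        using \<sigma> perm_exp_inv_right[of \<sigma> m] image_f_inv_f[of \<sigma> \<tau>] by (simp add: stab_def bij_is_surj)
      then show False using \<sigma> by blast
    qed
  qed (auto simp: stab_def)
  also have "\<dots> = (\<Sum>\<sigma>\<in>stab m \<tau>. lookup (c \<tau>) m)"
  proof (rule sum.cong[OF refl])
    fix \<sigma> assume \<sigma>: "\<sigma> \<in> stab m \<tau>"
    then have "inv \<sigma> ` \<tau> = \<tau>" "perm_exp (inv \<sigma>) m = m"
      using perm_exp_inv[of \<sigma> m] image_inv_f_f[of \<sigma> \<tau>] by (auto simp: stab_def bij_is_inj)
    then show "?t \<sigma> = lookup (c \<tau>) m" by (simp add: perm_sign_stab[OF g \<sigma>])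
  qed
  finally show ?thesis by simp
qed

text \<open>
  Sorting \<open>2m + \<tau>\<close> moves any coefficient, up to sign, to a position that is descending or has two variables
  of \<open>\<tau>\<close> with equal exponents. In the second case the transposition of these variables shows that the
  coefficient equals its negative.
\<close>

lemma invariant_eq_0:
  fixes y :: "'n::{finite,linorder} set \<Rightarrow> ('n, 'k::field) mpoly"
  assumes char: "CHAR('k) = 0 \<or> CHAR('k) > CARD('n)"
    and inv: "\<And>\<sigma>. bij \<sigma> \<Longrightarrow> perm_chain \<sigma> y = y" and y: "\<And>\<tau> m. descending m \<tau> \<Longrightarrow> lookup (y \<tau>) m = 0"
  shows "y = 0"
proof (rule poly_chain_eqI)
  fix \<tau> :: "'n set" and m
  obtain \<sigma> where \<sigma>: "bij \<sigma>" "perm_exp \<sigma> (double_plus m \<tau>) \<in> partitions" using sort_exponent by blast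
  define m' \<tau>' where "m' = perm_exp \<sigma> m" and "\<tau>' = \<sigma> ` \<tau>"
  have sorted: "double_plus m' \<tau>' \<in> partitions" using \<sigma> by (simp add: perm_exp_double_plus m'_def \<tau>'_def)
  have "lookup (y \<tau>') m' = 0"
  proof (cases "descending m' \<tau>'")
    case False
    then obtain i j where ij: "i < j" "lookup m' i < lookup m' j + of_bool (j \<in> \<tau>')"
      by (auto simp: descending_iff not_le)
    have "lookup (double_plus m' \<tau>') j \<le> lookup (double_plus m' \<tau>') i"
      using sorted ij(1) by (auto simp: partitions_def antimono_def)
    then have eq: "lookup m' i = lookup m' j" and mem: "i \<in> \<tau>'" "j \<in> \<tau>'"
      using ij(2) by (auto simp: lookup_double_plus of_bool_def split: if_splits)
    let ?t = "transpose i j"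
    have "perm_exp ?t m' = m'"
      using eq by (intro poly_mapping_eqI) (auto simp: lookup_perm_exp_inv transpose_def)
    moreover have "?t ` \<tau>' = \<tau>'" using mem by (simp add: transpose_image_eq)
    ultimately have "lookup (perm_chain ?t y \<tau>') m' = - lookup (y \<tau>') m'"
      using ij(1) by (simp add: lookup_perm_chain perm_sign_transpose[OF mem])
    then have "2 * lookup (y \<tau>') m' = 0"
      using inv[of ?t] by simp
    moreover have "(2 :: 'k) \<noteq> 0"
    proof -
      have "card {i, j} \<le> CARD('n)" by (intro card_mono) auto
      then show ?thesis using of_nat_nonzero[OF char, of 2] ij(1) by simp
    qed
    ultimately show ?thesis by simp
  qed (rule y)
  moreover have "lookup (y \<tau>) m = lookup (perm_chain (Hilbert_Choice.inv \<sigma>) y \<tau>) m"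
    using inv \<sigma>(1) by (simp add: bij_imp_bij_inv)
  ultimately show "lookup (y \<tau>) m = lookup (0 \<tau>) m"
    using \<sigma>(1) by (simp add: lookup_perm_chain bij_imp_bij_inv inv_inv_eq m'_def \<tau>'_def)
qed

lemma card_stab_nonzero:
  fixes m :: "'n::{finite,linorder} \<Rightarrow>\<^sub>0 nat"
  assumes char: "CHAR('k::field) = 0 \<or> CHAR('k) > CARD('n)"
  shows "of_nat (card (stab m \<tau>)) \<noteq> (0 :: 'k)"
proof -
  obtain q where "card {\<sigma> :: 'n \<Rightarrow> 'n. bij \<sigma>} = card (stab m \<tau>) * q" using card_stab_dvd[of m \<tau>] by (elim dvdE)
  then show ?thesis using of_nat_card_perms_nonzero[OF char] by auto
qed

lemma average_inject:
  fixes c :: "'n::{finite,linorder} set \<Rightarrow> ('n, 'k::field) mpoly"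
  assumes char: "CHAR('k) = 0 \<or> CHAR('k) > CARD('n)"
    and c: "\<And>\<tau> m. lookup (c \<tau>) m \<noteq> 0 \<Longrightarrow> descending m \<tau>" and "average c = 0"
  shows "c = 0"
proof (rule poly_chain_eqI)
  fix \<tau> :: "'n set" and m
  show "lookup (c \<tau>) m = lookup (0 \<tau>) m"
    using lookup_average_descending[where c = c and m = m and \<tau> = \<tau>, OF c] c[of \<tau> m] \<open>average c = 0\<close> card_stab_nonzero[OF char, of m \<tau>] by auto
qed

text \<open>
  Take the coefficients of \<open>y\<close> at descending elements, divided by the orders of the stabilisers: the average
  of this chain and \<open>y\<close> agree at descending elements, hence everywhere.
\<close>

lemma average_surj:
  fixes y :: "'n::{finite,linorder} set \<Rightarrow> ('n, 'k::field) mpoly"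
  assumes char: "CHAR('k) = 0 \<or> CHAR('k) > CARD('n)" and inv: "\<And>\<sigma>. bij \<sigma> \<Longrightarrow> perm_chain \<sigma> y = y"
    and y: "y \<in> supp_chains Q l"
  shows "\<exists>c\<in>supp_chains (\<lambda>m \<tau>. Q m \<tau> \<and> descending m \<tau>) l. average c = y"
proof -
  define c where "c \<tau> = Poly_Mapping.mapp (\<lambda>m v. if descending m \<tau> then v / of_nat (card (stab m \<tau>)) else 0) (y \<tau>)" for \<tau>
  have lc: "lookup (c \<tau>) m =
      (if descending m \<tau> then lookup (y \<tau>) m / of_nat (card (stab m \<tau>)) else 0)" for \<tau> m
    by (auto simp: c_def lookup_mapp when_def in_keys_iff)
  have "c \<in> supp_chains (\<lambda>m \<tau>. Q m \<tau> \<and> descending m \<tau>) l"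
  proof (rule supp_chainsI)
    show "c \<tau> = 0" if "card \<tau> \<noteq> l" for \<tau>
      using supp_chainsD(1)[OF y that] by (intro poly_mapping_eqI) (simp add: lc)
    show "Q m \<tau> \<and> descending m \<tau>" if "lookup (c \<tau>) m \<noteq> 0" for m \<tau>
      using that supp_chainsD(2)[OF y, of \<tau> m] by (auto simp: lc split: if_splits)
  qed
  moreover have "average c - y = 0"
  proof (rule invariant_eq_0[OF char])
    show "perm_chain \<sigma> (average c - y) = average c - y" if "bij \<sigma>" for \<sigma> using inv that by (simp add: perm_chain_diff perm_chain_average)
    fix \<tau> :: "'n set" and m assume g: "descending m \<tau>"
    have "lookup (average c \<tau>) m = of_nat (card (stab m \<tau>)) * lookup (c \<tau>) m"
      by (rule lookup_average_descending[OF _ g]) (simp add: lc split: if_splits)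
    also have "\<dots> = lookup (y \<tau>) m" using g card_stab_nonzero[OF char, of m \<tau>] by (simp add: lc)
    finally show "lookup ((average c - y) \<tau>) m = 0" by (simp add: lookup_minus)
  qed
  ultimately show ?thesis by (intro bexI[of _ c]) simp_all
qed

lemma perm_chain_supp_chains:
  assumes U: "\<And>m. m \<in> U \<Longrightarrow> perm_exp \<sigma> m \<in> U" and \<sigma>: "bij \<sigma>" and c: "c \<in> supp_chains (\<lambda>m \<tau>. m \<in> U) l"
  shows "perm_chain \<sigma> c \<in> supp_chains (\<lambda>m \<tau>. m \<in> U) l"
proof (rule supp_chainsI)
  fix \<tau> :: "'a set" assume "card \<tau> \<noteq> l"
  then have "card (inv \<sigma> ` \<tau>) \<noteq> l"
    using \<sigma> by (metis bij_imp_bij_inv bij_is_inj card_image inj_on_subset subset_UNIV)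
  then show "perm_chain \<sigma> c \<tau> = 0"
    using \<sigma> by (intro poly_mapping_eqI) (simp add: lookup_perm_chain supp_chainsD(1)[OF c])
next
  fix \<tau> m assume "lookup (perm_chain \<sigma> c \<tau>) m \<noteq> 0"
  then have "lookup (c (inv \<sigma> ` \<tau>)) (perm_exp (inv \<sigma>) m) \<noteq> 0" using \<sigma> by (auto simp: lookup_perm_chain)
  then have "perm_exp \<sigma> (perm_exp (inv \<sigma>) m) \<in> U" using U supp_chainsD(2)[OF c] by blast
  then show "m \<in> U" using \<sigma> by simp
qed

lemma sum_diff_closed:
  assumes A: "diff_closed A" and "\<And>i. i \<in> I \<Longrightarrow> f i \<in> A" shows "sum f I \<in> A"
  using assms(2) by (induct I rule: infinite_finite_induct) (auto intro: diff_closedD[OF A])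

text \<open>
  Averaging is an isomorphism of complexes from \<open>D\<close> to the invariant chains of \<open>C\<close>. As the order of the group
  is invertible, an invariant homology class contains an invariant cycle, and an invariant
  boundary is the boundary of an invariant chain.
\<close>

proposition invariants_iso:
  fixes U :: "('n::{finite,linorder} \<Rightarrow>\<^sub>0 nat) set"
  assumes char: "CHAR('k::field) = 0 \<or> CHAR('k) > CARD('n)"
    and U: "\<And>\<sigma> m. bij \<sigma> \<Longrightarrow> m \<in> U \<Longrightarrow> perm_exp \<sigma> m \<in> U" "\<And>m i. m \<in> U \<Longrightarrow> unit_exp i + m \<in> U"
  defines "C \<equiv> (supp_chains (\<lambda>m \<tau>. m \<in> U) :: nat \<Rightarrow> ('n set \<Rightarrow> ('n, 'k) mpoly) set)"
  defines "D \<equiv> (supp_chains (\<lambda>m \<tau>. m \<in> U \<and> descending m \<tau>) :: nat \<Rightarrow> ('n set \<Rightarrow> ('n, 'k) mpoly) set)"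
  shows "subquot_iso (range Inl :: ('k + ('n \<Rightarrow> 'n)) set)
    (chain_op (*) \<psi>) {z \<in> kcycles (*) C l. \<forall>\<sigma>. bij \<sigma> \<longrightarrow> perm_chain \<sigma> z - z \<in> kbounds (*) C l} (kbounds (*) C l)
    (chain_op (*) \<psi>) (kcycles (*) D l) (kbounds (*) D l)"
proof -
  let ?N = "of_nat (card {\<sigma> :: 'n \<Rightarrow> 'n. bij \<sigma>}) :: 'k"
  have N: "?N \<noteq> 0" by (rule of_nat_card_perms_nonzero[OF char])
  have DC: "D m \<subseteq> C m" for m unfolding C_def D_def by (rule supp_chains_mono) auto
  have dC: "kdiff (*) c \<in> C m" if "c \<in> C (Suc m)" for c m
    using that U(2) unfolding C_def by (intro kdiff_supp_chains) auto
  have dD: "kdiff (*) c \<in> D m" if "c \<in> D (Suc m)" for c m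
    using that U(2) descent_fails_kdiff unfolding D_def descending_def by (intro kdiff_supp_chains) blast+
  have clC: "diff_closed (C m)" and clD: "diff_closed (D m)" for m
    unfolding C_def D_def by (rule diff_closed_supp_chains)+
  have bnd: "diff_closed (kbounds (*) C l)" by (rule R.diff_closed_kbounds[OF clC])
  have zyC: "diff_closed (kcycles (*) C l)" and zyD: "diff_closed (kcycles (*) D l)"
    by (rule R.diff_closed_kcycles clC clD)+
  have aC: "perm_chain \<sigma> c \<in> C m" if "bij \<sigma>" "c \<in> C m" for \<sigma> c m
    using that U(1) unfolding C_def by (intro perm_chain_supp_chains) auto
  have avC: "average c \<in> C m" if "c \<in> C m" for c m
    unfolding average_def using aC that by (intro sum_diff_closed[OF clC]) auto
  have sC: "chain_scale (*) a c \<in> C m" if "c \<in> C m" for a c m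
    using that unfolding C_def by (rule chain_scale_supp_chains)
  have sb: "chain_scale (*) a c \<in> kbounds (*) C l" if "c \<in> kbounds (*) C l" for a c
    using that sC by (auto simp: kbounds_def simp flip: R.kdiff_chain_scale)
  have ab: "perm_chain \<sigma> c \<in> kbounds (*) C l" if "bij \<sigma>" "c \<in> kbounds (*) C l" for \<sigma> c
    using that aC by (auto simp: kbounds_def simp flip: kdiff_perm_chain)
  have goodD: "descending m \<tau>" if "c \<in> D k" "lookup (c \<tau>) m \<noteq> 0" for c k \<tau> m
    using supp_chainsD(2)[of c _ k \<tau> m] that unfolding D_def by blast
  have descending_kdiff: "descending m \<tau>" if c: "c \<in> D k" and "lookup (kdiff (*) c \<tau>) m \<noteq> 0" for c k \<tau> m
  proof (cases k)
    case 0
    have "kdiff (*) c = 0"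
      by (rule R.kdiff_kchains_0[where M = UNIV]) (use c 0 in \<open>auto simp: D_def supp_chains_def kchains_def\<close>)
    then show ?thesis using that by simp
  next
    case (Suc k') then show ?thesis using goodD[OF dD] that by blast
  qed
  have surj: "\<exists>c\<in>D k. average c = y" if "y \<in> C k" "\<And>\<sigma>. bij \<sigma> \<Longrightarrow> perm_chain \<sigma> y = y" for y k
    using average_surj[OF char that(2)] that(1) unfolding C_def D_def by blast
  let ?\<rho> = "{(z, c). z \<in> kcycles (*) C l \<and> c \<in> kcycles (*) D l \<and> z - average c \<in> kbounds (*) C l}"
  show ?thesis
  proof (rule subquot_isoI[of ?\<rho>])
    fix z c assume zc: "(z, c) \<in> ?\<rho>"
    have "perm_chain \<sigma> z - z \<in> kbounds (*) C l" if \<sigma>: "bij \<sigma>" for \<sigma>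
    proof -
      have "perm_chain \<sigma> z - z = perm_chain \<sigma> (z - average c) - (z - average c)" by (simp add: perm_chain_diff perm_chain_average \<sigma>)
      also have "\<dots> \<in> kbounds (*) C l" using diff_closedD(2)[OF bnd ab[OF \<sigma>]] zc by blast
      finally show ?thesis .
    qed
    then show "z \<in> {z \<in> kcycles (*) C l. \<forall>\<sigma>. bij \<sigma> \<longrightarrow> perm_chain \<sigma> z - z \<in> kbounds (*) C l} \<and> c \<in> kcycles (*) D l"
      using zc by blast
    show "z \<in> kbounds (*) C l \<longleftrightarrow> c \<in> kbounds (*) D l"
    proof
      assume "z \<in> kbounds (*) C l"
      then have "z - (z - average c) \<in> kbounds (*) C l" using diff_closedD(2)[OF bnd] zc by blast
      then obtain y where y: "y \<in> C (Suc l)" "average c = kdiff (*) y" by (auto simp: kbounds_def)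
      have "chain_scale (*) ?N (average c) = average (average c)" by (rule average_invariant[OF perm_chain_average, symmetric])
      also have "\<dots> = kdiff (*) (average y)" by (simp only: y(2) kdiff_average)
      finally have "chain_scale (*) ?N (average c) = kdiff (*) (average y)" .
      then have "kdiff (*) (chain_scale (*) (inverse ?N) (average y)) = chain_scale (*) (inverse ?N) (chain_scale (*) ?N (average c))"
        by (simp add: R.kdiff_chain_scale)
      then have 1: "kdiff (*) (chain_scale (*) (inverse ?N) (average y)) = average c" using N by (simp add: R.chain_scale_chain_scale)
      obtain b where b: "b \<in> D (Suc l)" "average b = chain_scale (*) (inverse ?N) (average y)"
        using surj[OF sC[OF avC[OF y(1)]], of "inverse ?N"] by (auto simp: perm_chain_chain_scale perm_chain_average)
      \<comment> \<open>Both \<open>c\<close> and \<open>kdiff (*) b\<close> are descending with the same average.\<close>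
      have "c - kdiff (*) b = 0"
      proof (rule average_inject[OF char])
        show "average (c - kdiff (*) b) = 0" using 1 b(2) by (simp add: average_diff flip: kdiff_average)
        have "c - kdiff (*) b \<in> D l" using diff_closedD(2)[OF clD _ dD[OF b(1)]] zc by (auto simp: kcycles_def)
        then show "descending m \<tau>" if "lookup ((c - kdiff (*) b) \<tau>) m \<noteq> 0" for \<tau> m
          using goodD that by blast
      qed
      then have "c = kdiff (*) b" by simp
      then show "c \<in> kbounds (*) D l" using b(1) by (auto simp: kbounds_def)
    next
      assume "c \<in> kbounds (*) D l"
      then obtain b where b: "b \<in> D (Suc l)" "c = kdiff (*) b" by (auto simp: kbounds_def)
      then have "average c = kdiff (*) (average b)" by (simp add: kdiff_average)
      moreover have "average b \<in> C (Suc l)" using avC DC b(1) by blast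
      ultimately have "average c \<in> kbounds (*) C l" unfolding kbounds_def by blast
      then have "(z - average c) + average c \<in> kbounds (*) C l" using zc by (intro diff_closedD(4)[OF bnd]) auto
      then show "z \<in> kbounds (*) C l" by simp
    qed
  next
    fix z assume "z \<in> {z \<in> kcycles (*) C l. \<forall>\<sigma>. bij \<sigma> \<longrightarrow> perm_chain \<sigma> z - z \<in> kbounds (*) C l}"
    then have z: "z \<in> C l" "kdiff (*) z = 0" "\<And>\<sigma>. bij \<sigma> \<Longrightarrow> perm_chain \<sigma> z - z \<in> kbounds (*) C l"
      by (auto simp: kcycles_def)
    obtain c where c: "c \<in> D l" "average c = chain_scale (*) (inverse ?N) (average z)"
      using surj[OF sC[OF avC[OF z(1)]], of "inverse ?N"] by (auto simp: perm_chain_chain_scale perm_chain_average)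
    have act0: "average 0 = (0 :: 'n set \<Rightarrow> ('n, 'k) mpoly)" using average_diff[of 0 0] by simp
    have "kdiff (*) c = 0"
    proof (rule average_inject[OF char])
      have "average (kdiff (*) c) = chain_scale (*) (inverse ?N) (average (kdiff (*) z))"
        by (simp add: c(2) R.kdiff_chain_scale flip: kdiff_average)
      then show "average (kdiff (*) c) = 0" by (simp add: z(2) act0 chain_scale_def fun_eq_iff)
    qed (rule descending_kdiff[OF c(1)])
    then have "c \<in> kcycles (*) D l" using c(1) by (simp add: kcycles_def)
    moreover have "z - average c \<in> kbounds (*) C l"
    proof -
      have "average z - chain_scale (*) ?N z = (\<Sum>\<sigma> | bij \<sigma>. perm_chain \<sigma> z - z)"
        by (simp add: average_def sum_subtractf flip: sum_const_chain)
      also have "\<dots> \<in> kbounds (*) C l" using z(3) by (intro sum_diff_closed[OF bnd]) auto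
      finally have "chain_scale (*) ?N z - average z \<in> kbounds (*) C l"
        using diff_closedD(3)[OF bnd] by fastforce
      then have "chain_scale (*) (inverse ?N) (chain_scale (*) ?N z - average z) \<in> kbounds (*) C l" by (rule sb)
      then show ?thesis using N by (simp add: c(2) R.chain_scale_diff R.chain_scale_chain_scale)
    qed
    ultimately show "\<exists>c. (z, c) \<in> ?\<rho>" using z by (auto simp: kcycles_def)
  next
    fix c assume c: "c \<in> kcycles (*) D l"
    have "average c - average c \<in> kbounds (*) C l" unfolding diff_self by (rule diff_closedD(1)[OF bnd])
    moreover have "kdiff (*) (average c) = 0"
      using c average_diff[of 0 0] by (simp add: kcycles_def kdiff_average)
    ultimately show "\<exists>z. (z, c) \<in> ?\<rho>" using c avC DC by (intro exI[of _ "average c"]) (auto simp: kcycles_def)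
  next
    fix z c z' c' assume "(z, c) \<in> ?\<rho>" "(z', c') \<in> ?\<rho>"
    then have *: "z \<in> kcycles (*) C l" "c \<in> kcycles (*) D l" "z - average c \<in> kbounds (*) C l"
      "z' \<in> kcycles (*) C l" "c' \<in> kcycles (*) D l" "z' - average c' \<in> kbounds (*) C l" by auto
    have "(z - z') - average (c - c') = (z - average c) - (z' - average c')" by (simp add: average_diff)
    then have "(z - z') - average (c - c') \<in> kbounds (*) C l"
      using diff_closedD(2)[OF bnd *(3,6)] by presburger
    then show "(z - z', c - c') \<in> ?\<rho>" using diff_closedD(2)[OF zyC *(1,4)] diff_closedD(2)[OF zyD *(2,5)] by blast
  next
    fix a z c assume "a \<in> (range Inl :: ('k + ('n \<Rightarrow> 'n)) set)" and zc: "(z, c) \<in> ?\<rho>"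
    then obtain b where a: "a = Inl b" by auto
    have "chain_scale (*) b z - average (chain_scale (*) b c) \<in> kbounds (*) C l"
      using sb[of "z - average c" b] zc by (simp add: average_chain_scale R.chain_scale_diff)
    then show "(chain_op (*) \<psi> a z, chain_op (*) \<psi> a c) \<in> ?\<rho>"
      using zc by (auto simp: chain_op_def a C_def D_def chain_scale_kcycles)
  qed
qed

section \<open>The comparison\<close>

theorem theorem1p5:
  fixes lam :: "nat \<Rightarrow> ('n::{finite,linorder} \<Rightarrow>\<^sub>0 nat)" and r :: nat
    and sF :: "('n, 'k::field) mpoly \<Rightarrow> 'f::ab_group_add \<Rightarrow> 'f"
    and F :: "nat \<Rightarrow> 'f set" and dF :: "nat \<Rightarrow> 'f \<Rightarrow> 'f" and eF :: "'f \<Rightarrow> ('n, 'k) mpoly"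
    and \<phi> :: "('n \<Rightarrow> 'n) \<Rightarrow> nat \<Rightarrow> 'f \<Rightarrow> 'f"
    and sG :: "('n, 'k) mpoly \<Rightarrow> 'g::ab_group_add \<Rightarrow> 'g"
    and G :: "nat \<Rightarrow> 'g set" and dG :: "nat \<Rightarrow> 'g \<Rightarrow> 'g" and eG :: "'g \<Rightarrow> ('n, 'k) mpoly"
  assumes char: "CHAR('k) = 0 \<or> CHAR('k) > CARD('n)"
    and lam: "\<And>k. k \<in> {1..r} \<Longrightarrow> lam k \<in> partitions"
    and resF: "free_resolution (*) (sym_ideal (lam ` {1..r})) sF F dF eF"
    and lifts: "\<And>\<sigma>. bij \<sigma> \<Longrightarrow> perm_lift sF F dF eF \<sigma> (\<phi> \<sigma>)"
    and resG: "free_resolution (*) (mono_ideal (lam ` {1..r})) sG G dG eG"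
  shows "\<forall>i. vs_isomorphic
           (\<lambda>c. tor_scale sF F dF res_scale i (mconst c)) (tor_invariants sF F dF \<phi> i)
           (\<lambda>c. tor_scale sG G dG res_scale i (mconst c)) (tor sG G dG res_scale i)"
proof
  fix i
  \<comment> \<open>\<open>C\<close> and \<open>E\<close> are the Koszul complexes of the symmetric and of the ordinary ideal, \<open>D\<close> is their
      common subcomplex of descending chains.\<close>
  define L where "L = lam ` {1..r}"
  have L: "L \<subseteq> partitions" using lam by (auto simp: L_def)
  define PL where "PL = {perm_exp \<sigma> a | \<sigma> a. bij \<sigma> \<and> a \<in> L}"
  define C where "C = (supp_chains (\<lambda>m \<tau>. m \<in> exp_ideal PL) :: nat \<Rightarrow> ('n set \<Rightarrow> ('n, 'k) mpoly) set)"
  define E where "E = (supp_chains (\<lambda>m \<tau>. m \<in> exp_ideal L) :: nat \<Rightarrow> ('n set \<Rightarrow> ('n, 'k) mpoly) set)"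
  define D where "D = (supp_chains (\<lambda>m \<tau>. m \<in> exp_ideal L \<and> (\<forall>v\<in>UNIV. \<not> descent_fails v m \<tau>)) :: nat \<Rightarrow> ('n set \<Rightarrow> ('n, 'k) mpoly) set)"
  have C: "kchains (sym_ideal L :: ('n, 'k) mpoly set) = C"
    by (rule ext) (simp add: C_def PL_def sym_ideal_eq_mono_ideal mono_ideal_eq kchains_monomial)
  have E: "kchains (mono_ideal L :: ('n, 'k) mpoly set) = E"
    by (rule ext) (simp add: E_def mono_ideal_eq kchains_monomial)
  let ?op = "chain_op (*) perm_poly :: 'k + ('n \<Rightarrow> 'n) \<Rightarrow> ('n set \<Rightarrow> ('n, 'k) mpoly) \<Rightarrow> _"
  let ?k = "range Inl :: ('k + ('n \<Rightarrow> 'n)) set" and ?S = "Inr ` {\<sigma>. bij \<sigma>} :: ('k + ('n \<Rightarrow> 'n)) set"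
  have "subquot_iso (?k \<union> ?S) ?op (kcycles (*) C i) (kbounds (*) C i)
      (module_op sF (\<lambda>\<sigma>. \<phi> \<sigma> i)) (res_cycles sF F dF i) (res_boundaries sF F dF i)"
    unfolding C[symmetric] L_def by (rule koszul_homology_resolution[OF resF]) (use lifts in auto)
  note CF = subquot_iso_invariants[OF this Un_upper1 Un_upper2]
  have CD: "subquot_iso ?k ?op {z \<in> kcycles (*) C i. \<forall>a\<in>?S. ?op a z - z \<in> kbounds (*) C i} (kbounds (*) C i)
      ?op (kcycles (*) D i) (kbounds (*) D i)"
  proof -
    have D: "D = supp_chains (\<lambda>m \<tau>. m \<in> exp_ideal PL \<and> descending m \<tau>)"
      using exp_ideal_partitions[OF L] descending_partition
      by (auto simp: D_def PL_def descending_def intro!: ext arg_cong[of _ _ "\<lambda>Q. supp_chains Q _"])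
    have inv: "{z \<in> kcycles (*) C i. \<forall>a\<in>?S. ?op a z - z \<in> kbounds (*) C i} =
        {z \<in> kcycles (*) C i. \<forall>\<sigma>. bij \<sigma> \<longrightarrow> perm_chain \<sigma> z - z \<in> kbounds (*) C i}"
      by (auto simp: chain_op_def perm_chain_def)
    show ?thesis
      unfolding inv unfolding D C_def
    proof (rule invariants_iso[OF char])
      show "perm_exp \<sigma> m \<in> exp_ideal PL" if "bij \<sigma>" "m \<in> exp_ideal PL" for \<sigma> m
        using exp_ideal_perm that unfolding PL_def by blast
    qed (rule exp_ideal_add)
  qed
  have ED: "subquot_iso ?k ?op (kcycles (*) E i) (kbounds (*) E i) ?op (kcycles (*) D i) (kbounds (*) D i)"
    unfolding D_def E_def by (rule deformation) (use exp_ideal_add exp_ideal_down[OF L] in blast)+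
  have EG: "subquot_iso ?k ?op (kcycles (*) E i) (kbounds (*) E i)
      (module_op sG (\<lambda>_. id)) (res_cycles sG G dG i) (res_boundaries sG G dG i)"
    using koszul_homology_resolution[OF resG, of ?k "\<lambda>_ _. id" i] unfolding E[symmetric] L_def by auto
  let ?W = "{x \<in> res_cycles sF F dF i. \<forall>a\<in>?S. module_op sF (\<lambda>\<sigma>. \<phi> \<sigma> i) a x - x \<in> res_boundaries sF F dF i}"
  have W: "?W = {x \<in> res_cycles sF F dF i. \<forall>\<sigma>. bij \<sigma> \<longrightarrow> \<phi> \<sigma> i x - x \<in> res_boundaries sF F dF i}"
    by (auto simp: module_op_def)
  have iso: "subquot_iso ?k (module_op sF (\<lambda>\<sigma>. \<phi> \<sigma> i)) ?W (res_boundaries sF F dF i)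
      (module_op sG (\<lambda>_. id)) (res_cycles sG G dG i) (res_boundaries sG G dG i)"
    by (rule subquot_iso_trans[OF subquot_iso_sym[OF CF[OF subquot_iso_closed[OF CD]]]
        subquot_iso_trans[OF CD subquot_iso_trans[OF subquot_iso_sym[OF ED] EG]]])
  have "tor_invariants sF F dF \<phi> i = module_sequence.tor_class sF F dF i ` ?W"
    unfolding W by (rule tor_invariants_eq[OF resF lifts])
  moreover have "?W \<subseteq> F i" by (auto simp: res_cycles_def)
  ultimately show "vs_isomorphic
       (\<lambda>c. tor_scale sF F dF res_scale i (mconst c)) (tor_invariants sF F dF \<phi> i)
       (\<lambda>c. tor_scale sG G dG res_scale i (mconst c)) (tor sG G dG res_scale i)"
    using vs_isomorphic_tor[OF module_sequence_free_resolution[OF resF] module_sequence_free_resolution[OF resG] _ iso]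
    by simp
qed

end
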